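(* Let $\mathcal{H}$ be a semicomplete digraph. If $\mathcal{H}$ has at most one cycle, or has both a source and a sink, then $\mathrm{id\mbox{-}Pol}(\mathcal{H})$ has the PGP. Otherwise, $\mathrm{id\mbox{-}Pol}(\mathcal{H})$ has the EGP.
   Context: A digraph is semicomplete if it is finite, irreflexive, and for all distinct vertices $x,y$ at least one of the edges $(x,y),(y,x)$ is present. Cycles are directed cycles (a pair of opposite edges counts as a cycle of length 2). A source (resp. sink) is a vertex of in-degree (resp. out-degree) zero. A $k$-ary polymorphism of a digraph with vertex set $A$ is a map $f:A^k\to A$ mapping edges coordinatewise to edges; it is idempotent if $f(a,\dots,a)=a$ for all $a$. $\mathrm{id\mbox{-}Pol}(\mathcal{H})$ is the set of idempotent polymorphisms, viewed as an algebra $\mathbb{A}$ on $A$. A set $S\subseteq A^m$ generates $\mathbb{A}^m$ if every $t\in A^m$ equals $f$ applied coordinatewise to some $s_1,\dots,s_k\in S$ for some $k$-ary $f\in\mathrm{id\mbox{-}Pol}(\mathcal{H})$. Let $f_{\mathbb{A}}(m)$ be the minimum size of a generating set of $\mathbb{A}^m$. PGP: $f_{\mathbb{A}}(m)=O(p(m))$ for some polynomial $p$; EGP: $f_{\mathbb{A}}(m)=\Omega(b^m)$ for some constant $b>1$. *)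

theory Defs
  imports
    "Graph_Theory.Graph_Theory"
    "HOL-Library.FuncSet"
    "HOL-Library.Landau_Symbols"
    "HOL-Computational_Algebra.Polynomial"
begin

section \<open>Semicomplete digraphs\<close>

locale semicomplete_digraph = pair_digraph +
  assumes semicomplete:
    "\<lbrakk>x \<in> pverts G; y \<in> pverts G; x \<noteq> y\<rbrakk> \<Longrightarrow> (x, y) \<in> parcs G \<or> (y, x) \<in> parcs G"

definition is_source :: "'a pair_pre_digraph \<Rightarrow> 'a \<Rightarrow> bool" where
  "is_source H v \<longleftrightarrow> v \<in> pverts H \<and> in_degree (with_proj H) v = 0"

definition is_sink :: "'a pair_pre_digraph \<Rightarrow> 'a \<Rightarrow> bool" where
  "is_sink H v \<longleftrightarrow> v \<in> pverts H \<and> out_degree (with_proj H) v = 0"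

text \<open>
  The library predicate \<^const>\<open>pre_digraph.cycle\<close> describes closed arc lists with a chosen
  starting point. Passing to the set of arcs identifies exactly the rotations of a
  cycle, so each directed cycle is counted once, as a subgraph.
\<close>

definition cycles_of :: "'a pair_pre_digraph \<Rightarrow> 'a rel set" where
  "cycles_of H = {set p | p. pre_digraph.cycle (with_proj H) p}"

definition at_most_one_cycle :: "'a pair_pre_digraph \<Rightarrow> bool" where
  "at_most_one_cycle H \<longleftrightarrow> (\<forall>C \<in> cycles_of H. \<forall>D \<in> cycles_of H. C = D)"


section \<open>Generating powers of an algebra\<close>

text \<open>
  An algebra is given by its carrier \<open>A\<close> and, for each arity \<open>k\<close>, the set \<open>F k\<close> of its
  \<open>k\<close>-ary operations. Elements of the power \<open>A\<^sup>n\<close> are functions on \<open>{0, \<dots>, n - 1}\<close>,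
  extended by \<^const>\<open>undefined\<close>; an operation is only relevant on the tuples over \<open>A\<close>.
\<close>

definition tuples :: "'a set \<Rightarrow> nat \<Rightarrow> (nat \<Rightarrow> 'a) set" where
  "tuples A n = ({..<n} \<rightarrow>\<^sub>E A)"

type_synonym 'a operation = "(nat \<Rightarrow> 'a) \<Rightarrow> 'a"

definition apply_coordinatewise ::
    "'a operation \<Rightarrow> nat \<Rightarrow> nat \<Rightarrow> (nat \<Rightarrow> nat \<Rightarrow> 'a) \<Rightarrow> nat \<Rightarrow> 'a" where
  "apply_coordinatewise f k m s = (\<lambda>j\<in>{..<m}. f (\<lambda>i\<in>{..<k}. s i j))"

definition generates ::
    "'a set \<Rightarrow> (nat \<Rightarrow> 'a operation set) \<Rightarrow> nat \<Rightarrow> (nat \<Rightarrow> 'a) set \<Rightarrow> bool" where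
  "generates A F m S \<longleftrightarrow> S \<subseteq> tuples A m \<and>
     (\<forall>t \<in> tuples A m. \<exists>k>0. \<exists>f \<in> F k. \<exists>s. (\<forall>i<k. s i \<in> S) \<and> t = apply_coordinatewise f k m s)"

definition min_generating_size :: "'a set \<Rightarrow> (nat \<Rightarrow> 'a operation set) \<Rightarrow> nat \<Rightarrow> nat" where
  "min_generating_size A F m = (LEAST n. \<exists>S. finite S \<and> generates A F m S \<and> card S = n)"

definition PGP :: "'a set \<Rightarrow> (nat \<Rightarrow> 'a operation set) \<Rightarrow> bool" where
  "PGP A F \<longleftrightarrow> (\<exists>p :: real poly.
     (\<lambda>m. real (min_generating_size A F m)) \<in> O(\<lambda>m. poly p (real m)))"

definition EGP :: "'a set \<Rightarrow> (nat \<Rightarrow> 'a operation set) \<Rightarrow> bool" where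
  "EGP A F \<longleftrightarrow> (\<exists>b :: real. b > 1 \<and>
     (\<lambda>m. real (min_generating_size A F m)) \<in> \<Omega>(\<lambda>m. b ^ m))"


section \<open>Idempotent polymorphisms\<close>

definition polymorphism :: "'a pair_pre_digraph \<Rightarrow> nat \<Rightarrow> 'a operation \<Rightarrow> bool" where
  "polymorphism H k f \<longleftrightarrow> f \<in> tuples (pverts H) k \<rightarrow> pverts H \<and>
     (\<forall>x \<in> tuples (pverts H) k. \<forall>y \<in> tuples (pverts H) k.
        (\<forall>i<k. (x i, y i) \<in> parcs H) \<longrightarrow> (f x, f y) \<in> parcs H)"

definition idempotent :: "'a set \<Rightarrow> nat \<Rightarrow> 'a operation \<Rightarrow> bool" where
  "idempotent A k f \<longleftrightarrow> (\<forall>a \<in> A. f (\<lambda>i\<in>{..<k}. a) = a)"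

definition id_Pol :: "'a pair_pre_digraph \<Rightarrow> nat \<Rightarrow> 'a operation set" where
  "id_Pol H k = {f. polymorphism H k f \<and> idempotent (pverts H) k f}"

end

theory Submission
  imports Defs
begin

text \<open>
  \<^bold>\<open>EGP.\<close> If \<open>H\<close> has no sink, let \<open>L\<close> be its terminal strong component. Every vertex has an
  out-neighbour \<open>g v\<close> in \<open>L\<close>. If a polymorphism \<open>f\<close> is a projection \<open>\<pi>\<^sub>i\<close> on \<open>L\<close>, then \<open>f x \<rightarrow> g (x i)\<close>, so
  \<open>f x \<noteq> g (x i)\<close> for all \<open>x\<close>; a generator then accounts for at most \<open>(|V| - 1)^m\<close> of the \<open>|V|^m\<close> tuples.
  If \<open>L\<close> is not just a cycle, then all idempotent polymorphisms of \<open>L\<close> are projections: a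
  minimal set of coordinates that determines \<open>f\<close> on two-valued tuples is a singleton, since there
  are neither binary non-projections nor majority operations, and a map that is the identity
  for one value of the remaining arguments is the identity for all of them, because the identity is
  alone in its strong component of the digraph of self-maps of \<open>L\<close>.
  If \<open>L\<close> is a cycle, there is another nontrivial component \<open>M\<close> above it. Mixed tuples over \<open>M\<close> and
  \<open>L\<close> show that for each set \<open>W\<close> of coordinates, either \<open>f\<close> depends only on \<open>W\<close> on \<open>M\<close> or only on the
  complement of \<open>W\<close> on \<open>L\<close>, which again makes \<open>f\<close> a projection on \<open>L\<close>.

  \<^bold>\<open>PGP.\<close> In both cases linearly many generators suffice, because polymorphisms are almost
  unconstrained on the columns of a suitable matrix of generators. Digraphs without source are
  handled by reversing all arcs, which does not change the polymorphisms.
\<close>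

section \<open>Strong sets\<close>

text \<open>The induction behind both nonexistence results has to stop at directed cycles, which
  have further idempotent polymorphisms: identified with Z/3, the 3-cycle has the binary operation
  2x + 2y, and both the 2-cycle and the 3-cycle have majority operations. So the induction
  hypothesis speaks only of \<open>branching\<close> preserved sets, and cycles are treated by hand.
  Preserved sets come from singletons: neighbourhoods, intersections and strong components of
  preserved sets are preserved again, and in a strong branching digraph these constructions reach a
  proper strong set with at least two vertices. Branching also makes a strong semicomplete digraph
  aperiodic: any two vertices are joined by walks of every large length. Walks of one common length
  combine into walks of a power, so all powers are strong; this connects the values of a
  polymorphism at different arguments. Many local arguments have one form: a value that has arcs to
  all its arguments, or from all of them, would by idempotence carry a loop.\<close>

definition strong :: "'a rel \<Rightarrow> 'a set \<Rightarrow> bool" where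
  "strong R C \<longleftrightarrow> C \<noteq> {} \<and> (\<forall>x\<in>C. \<forall>y\<in>C. (x, y) \<in> (R \<inter> C \<times> C)\<^sup>*)"

text \<open>Singletons are \<open>strong\<close>, so nontrivial strong sets are marked by
  \<open>2 \<le> card C\<close>. In a semicomplete relation a nontrivial strong set that is not
  branching is a directed cycle of length two or three.\<close>

definition branching :: "'a rel \<Rightarrow> 'a set \<Rightarrow> bool" where
  "branching R C \<longleftrightarrow> (\<exists>v\<in>C. \<exists>x\<in>C. \<exists>y\<in>C. x \<noteq> y \<and> (v, x) \<in> R \<and> (v, y) \<in> R)"

lemma strong_restrict [simp]: "strong (R \<inter> S \<times> S) S = strong R S"
  by (simp add: strong_def)

lemma branching_restrict [simp]: "branching (R \<inter> S \<times> S) S = branching R S"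
  by (auto simp: branching_def)

lemma strong_converse [simp]: "strong (R\<inverse>) C = strong R C"
proof -
  have "R\<inverse> \<inter> C \<times> C = (R \<inter> C \<times> C)\<inverse>" by auto
  then show ?thesis unfolding strong_def by (auto simp: rtrancl_converse)
qed

lemma rtrancl_leaves:
  assumes "(x, y) \<in> T\<^sup>*" "x \<in> S" "y \<notin> S"
  obtains u v where "u \<in> S" "v \<notin> S" "(u, v) \<in> T" "(v, y) \<in> T\<^sup>*"
  using assms
proof (induction arbitrary: thesis rule: converse_rtrancl_induct)
  case base
  then show ?case by simp
next
  case (step x z)
  show ?case
  proof (cases "z \<in> S")
    case True
    show ?thesis by (rule step.IH[OF step.prems(1) True step.prems(3)])
  next
    case False
    then show ?thesis using step by blast
  qed
qed

lemma strong_leaves: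
  assumes "strong R C" "S \<subseteq> C" "S \<noteq> {}" "S \<noteq> C"
  obtains u v where "u \<in> S" "v \<in> C - S" "(u, v) \<in> R"
proof -
  obtain x y where xy: "x \<in> S" "y \<in> C - S" using assms by blast
  then have "(x, y) \<in> (R \<inter> C \<times> C)\<^sup>*" using assms unfolding strong_def by blast
  then obtain u v where "u \<in> S" "v \<notin> S" "(u, v) \<in> R \<inter> C \<times> C"
    by (rule rtrancl_leaves[where S = S]) (use xy in auto)
  then show ?thesis using that by blast
qed

lemma strong_enters:
  assumes "strong R C" "S \<subseteq> C" "S \<noteq> {}" "S \<noteq> C"
  obtains u v where "u \<in> C - S" "v \<in> S" "(u, v) \<in> R"
  using strong_leaves[of "R\<inverse>" C S] assms by (metis strong_converse converse_iff)

lemma strong_insert: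
  assumes "strong R C" "c \<in> C" "d \<in> C" "(z, c) \<in> R" "(d, z) \<in> R"
  shows "strong R (insert z C)"
proof -
  let ?T = "R \<inter> insert z C \<times> insert z C"
  have sub: "(R \<inter> C \<times> C)\<^sup>* \<subseteq> ?T\<^sup>*" by (rule rtrancl_mono) auto
  have C: "(x, y) \<in> ?T\<^sup>*" if "x \<in> C" "y \<in> C" for x y
    using assms(1) that sub unfolding strong_def by blast
  have "(z, c) \<in> ?T" "(d, z) \<in> ?T" using assms by auto
  then have zto: "(z, y) \<in> ?T\<^sup>*" and zfrom: "(y, z) \<in> ?T\<^sup>*" if "y \<in> C" for y
    using C[OF assms(2) that] C[OF that assms(3)] by (meson converse_rtrancl_into_rtrancl rtrancl_into_rtrancl)+
  show ?thesis using C zto zfrom unfolding strong_def by blast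
qed

lemma strong_enlarge:
  assumes "finite D" "strong R C" "\<forall>z\<in>D. (\<exists>c\<in>C. (z, c) \<in> R) \<and> (\<exists>c\<in>C. (c, z) \<in> R)"
  shows "strong R (C \<union> D)"
  using assms(1,3)
proof (induction D)
  case empty
  then show ?case using assms by simp
next
  case (insert z D)
  then obtain c d where "c \<in> C" "d \<in> C" "(z, c) \<in> R" "(d, z) \<in> R" by blast
  with insert show ?case
    using strong_insert[of R "C \<union> D" c d z] by auto
qed

lemma strong_succ:
  assumes "strong R C" "2 \<le> card C" "x \<in> C"
  shows "\<exists>y\<in>C. (x, y) \<in> R"
proof -
  have "C \<noteq> {x}" using assms(2) by auto
  then show ?thesis using strong_leaves[OF assms(1), of "{x}"] assms(3) by blast
qed

lemma strong_pred:
  assumes "strong R C" "2 \<le> card C" "x \<in> C"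
  shows "\<exists>y\<in>C. (y, x) \<in> R"
  using strong_succ[of "R\<inverse>" C x] assms by auto

text \<open>Some arc leaves \<open>C\<close> inside \<open>D\<close>, and its tail also has a
  successor within \<open>C\<close>.\<close>

lemma strong_subset_branching:
  assumes "strong R C" "2 \<le> card C" "strong R D" "C \<subset> D"
  shows "branching R D"
proof -
  have "C \<noteq> {}" using assms(2) by auto
  then obtain u v where uv: "u \<in> C" "v \<in> D - C" "(u, v) \<in> R"
    using strong_leaves[OF assms(3), of C] assms(4) by blast
  obtain w where "w \<in> C" "(u, w) \<in> R" using strong_succ[OF assms(1,2) uv(1)] by blast
  then have "u \<in> D" "v \<in> D" "w \<in> D" "v \<noteq> w" using uv assms(4) by auto
  then show ?thesis using uv(3) \<open>(u, w) \<in> R\<close> unfolding branching_def by blast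
qed

lemma relpow_period: "(a, a) \<in> T ^^ p \<Longrightarrow> (a, a) \<in> T ^^ (k * p)"
  by (induction k) (auto simp: relpow_add)

text \<open>Of the \<open>q\<close> rounds of length \<open>p\<close> in
  \<open>l = q * p + r\<close>, \<open>r\<close> are replaced by rounds of length
  \<open>Suc p\<close>. The bound \<open>p * p\<close> guarantees \<open>r < p\<close> and
  \<open>p \<le> q\<close>.\<close>

lemma exact_lengths:
  fixes p :: nat
  assumes p: "(a, a) \<in> T ^^ p" "(a, a) \<in> T ^^ Suc p" and "p * p \<le> l"
  shows "(a, a) \<in> T ^^ l"
proof (cases "p = 0")
  case True
  have *: "(a, a) \<in> T" using p(2) True by simp
  show ?thesis
  proof (induction l)
    case (Suc l)
    then show ?case using * by auto
  qed simp
next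
  case False
  define q r where "q = l div p" and "r = l mod p"
  have "r < p" "p \<le> q" using False assms(3) by (auto simp: q_def r_def less_eq_div_iff_mult_less_eq)
  then have "l = (q - r) * p + r * Suc p"
    by (metis add.commute add_mult_distrib diff_add_inverse2 div_mult_mod_eq le_add_diff_inverse less_imp_le_nat
        less_le_trans mult_Suc_right q_def r_def add.assoc)
  then show ?thesis using relpow_period[OF p(1), of "q - r"] relpow_period[OF p(2), of r] by (auto simp: relpow_add)
qed

text \<open>If \<open>v\<close> has out-neighbours \<open>x\<close> and \<open>y\<close> with an arc
  from \<open>x\<close> to \<open>y\<close>, then the direct route to \<open>y\<close> and the route
  through \<open>x\<close>, both continued by one walk from \<open>y\<close> back to
  \<open>v\<close>, are closed walks of consecutive lengths.\<close>

lemma strong_branching_exact: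
  assumes "finite V" "strong R V" "branching R V" "\<And>x. (x, x) \<notin> R"
    and tot: "\<And>x y. x \<in> V \<Longrightarrow> y \<in> V \<Longrightarrow> x \<noteq> y \<Longrightarrow> (x, y) \<in> R \<or> (y, x) \<in> R"
  obtains N where "\<And>l x y. N \<le> l \<Longrightarrow> x \<in> V \<Longrightarrow> y \<in> V \<Longrightarrow> (x, y) \<in> (R \<inter> V \<times> V) ^^ l"
proof -
  let ?T = "R \<inter> V \<times> V"
  have conn: "(x, y) \<in> ?T\<^sup>*" if "x \<in> V" "y \<in> V" for x y
    using assms(2) that unfolding strong_def by blast
  obtain v x y where v: "v \<in> V" "x \<in> V" "y \<in> V" "(v, x) \<in> R" "(v, y) \<in> R" "(x, y) \<in> R"
    using assms(3) tot unfolding branching_def by blast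
  obtain d where d: "(y, v) \<in> ?T ^^ d" using conn[OF v(3,1)] rtrancl_imp_relpow by metis
  have 1: "(v, v) \<in> ?T ^^ Suc d" using relpow_Suc_I2[OF _ d, of v] v by blast
  have "(x, v) \<in> ?T ^^ Suc d" using relpow_Suc_I2[OF _ d, of x] v by blast
  then have 2: "(v, v) \<in> ?T ^^ Suc (Suc d)" using relpow_Suc_I2[of v x ?T v "Suc d"] v by blast
  have "\<forall>x\<in>V. \<exists>n. (x, v) \<in> ?T ^^ n" "\<forall>x\<in>V. \<exists>n. (v, x) \<in> ?T ^^ n"
    using conn v(1) rtrancl_imp_relpow by metis+
  then obtain i j where ij: "\<And>x. x \<in> V \<Longrightarrow> (x, v) \<in> ?T ^^ i x" "\<And>x. x \<in> V \<Longrightarrow> (v, x) \<in> ?T ^^ j x"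
    by metis
  define I J where "I = Max (i ` V)" and "J = Max (j ` V)"
  have IJ: "i x \<le> I" "j x \<le> J" if "x \<in> V" for x using that assms(1) by (auto simp: I_def J_def)
  show ?thesis
  proof (rule that)
    fix l x y assume l: "I + J + Suc d * Suc d \<le> l" and xy: "x \<in> V" "y \<in> V"
    define k where "k = l - i x - j y"
    have k: "l = i x + (k + j y)" "Suc d * Suc d \<le> k" using l IJ(1)[OF xy(1)] IJ(2)[OF xy(2)] by (auto simp: k_def)
    have "(v, v) \<in> ?T ^^ k" by (rule exact_lengths[OF 1 2 k(2)])
    then show "(x, y) \<in> ?T ^^ l" unfolding k(1) relpow_add using ij xy by blast
  qed
qed

text \<open>Going forward from \<open>c\<close>, no \<open>\<phi> w\<close> sends a point to an in-neighbour of itself. Going backward from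
  \<open>c\<close>, this excludes the only alternative to \<open>\<phi> u x = x\<close>.\<close>

lemma rigid:
  assumes irr: "\<And>x. (x, x) \<notin> R"
    and tot: "\<And>x y. x \<in> X \<Longrightarrow> y \<in> X \<Longrightarrow> x \<noteq> y \<Longrightarrow> (x, y) \<in> R \<or> (y, x) \<in> R"
    and mem: "\<And>u x. u \<in> D \<Longrightarrow> x \<in> X \<Longrightarrow> \<phi> u x \<in> X"
    and hom: "\<And>u w x y. (u, w) \<in> T \<Longrightarrow> x \<in> X \<Longrightarrow> y \<in> X \<Longrightarrow> (x, y) \<in> R \<Longrightarrow> (\<phi> u x, \<phi> w y) \<in> R"
    and T: "T \<subseteq> D \<times> D"
    and c: "c \<in> D" "\<And>x. x \<in> X \<Longrightarrow> \<phi> c x = x"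
    and u: "(c, u) \<in> T\<^sup>*" "(u, c) \<in> T\<^sup>*" and x: "x \<in> X"
  shows "\<phi> u x = x"
proof -
  have backward: "\<forall>x\<in>X. (\<phi> w x, x) \<notin> R" if "(c, w) \<in> T\<^sup>*" for w
    using that
  proof (induction rule: rtrancl_induct)
    case base
    then show ?case using c irr by simp
  next
    case (step u w)
    then have "w \<in> D" using T by blast
    show ?case
    proof
      fix x assume "x \<in> X"
      then show "(\<phi> w x, x) \<notin> R"
        using hom[OF step.hyps(2), of "\<phi> w x" x] mem[OF \<open>w \<in> D\<close>] step.IH by blast
    qed
  qed
  have "(c, u) \<in> T\<^sup>* \<longrightarrow> (\<forall>x\<in>X. \<phi> u x = x)"
    using u(2)
  proof (induction rule: converse_rtrancl_induct)
    case base
    then show ?case using c by simp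
  next
    case (step u w)
    show ?case
    proof (intro impI ballI)
      fix x assume cu: "(c, u) \<in> T\<^sup>*" and x: "x \<in> X"
      have w: "\<forall>x\<in>X. \<phi> w x = x" using step cu by (meson rtrancl.rtrancl_into_rtrancl)
      have z: "\<phi> u x \<in> X" using mem x step.hyps(1) T by blast
      have "(\<phi> u x, x) \<notin> R" using backward[OF cu] x by blast
      moreover have "(x, \<phi> u x) \<notin> R"
        using hom[OF step.hyps(1) x z] w z irr by auto
      ultimately show "\<phi> u x = x" using tot[OF x z] by metis
    qed
  qed
  then show ?thesis using u x by blast
qed

lemma relpow_tuples:
  fixes T :: "'a rel"
  assumes "\<And>i. (v i, w i) \<in> T ^^ n"
  shows "(v, w) \<in> {(v, w). \<forall>i. (v i, w i) \<in> T} ^^ n"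
  using assms
proof (induction n arbitrary: w)
  case (Suc n)
  have "\<forall>i. \<exists>z. (v i, z) \<in> T ^^ n \<and> (z, w i) \<in> T" using Suc.prems by (metis relpow_Suc_E)
  then obtain z where "\<And>i. (v i, z i) \<in> T ^^ n" "\<And>i. (z i, w i) \<in> T" by metis
  then show ?case using Suc.IH[of z] by auto
qed auto

text \<open>For a vertex with the fewest ancestors in \<open>Y\<close>, every ancestor has, by
  minimality, the same ancestors. So the ancestor set is strong.\<close>

lemma no_source_strong:
  assumes "finite Y" "Y \<noteq> {}" "\<And>y. y \<in> Y \<Longrightarrow> \<exists>x\<in>Y. (x, y) \<in> R" "\<And>x. (x, x) \<notin> R"
  obtains C where "C \<subseteq> Y" "strong R C" "2 \<le> card C"
proof -
  let ?T = "R \<inter> Y \<times> Y"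
  define anc where "anc y = {x. (x, y) \<in> ?T\<^sup>+}" for y
  have ancY: "anc y \<subseteq> Y" for y
    unfolding anc_def by (auto dest: tranclD)
  obtain y where y: "y \<in> Y" "\<And>z. z \<in> Y \<Longrightarrow> card (anc y) \<le> card (anc z)"
  proof -
    obtain y0 where "y0 \<in> Y" using assms(2) by blast
    then show ?thesis using ex_has_least_nat[of "\<lambda>z. z \<in> Y" y0 "\<lambda>z. card (anc z)"] that by blast
  qed
  have eq: "anc x = anc y" if "x \<in> anc y" for x
  proof (rule card_subset_eq)
    show "finite (anc y)" using ancY assms(1) finite_subset by blast
    show sub: "anc x \<subseteq> anc y" using that unfolding anc_def by auto
    show "card (anc x) = card (anc y)"
      using y(2)[of x] that ancY card_mono[OF \<open>finite (anc y)\<close> sub] by fastforce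
  qed
  obtain x where "x \<in> Y" "(x, y) \<in> R" using assms(3) y(1) by blast
  then have x: "x \<in> anc y" using y(1) unfolding anc_def by blast
  have path: "(a, b) \<in> (R \<inter> anc y \<times> anc y)\<^sup>*" if ab: "(a, b) \<in> ?T\<^sup>+" and b: "b \<in> anc y" for a b
    using ab
  proof (induction rule: converse_trancl_induct)
    case (base u)
    then have "u \<in> anc b" unfolding anc_def by blast
    then show ?case using base b eq by blast
  next
    case (step u w)
    then have "u \<in> anc b" "w \<in> anc b" unfolding anc_def by (auto intro: trancl_into_trancl2)
    then have "(u, w) \<in> R \<inter> anc y \<times> anc y" using step b eq by blast
    then show ?case using step.IH by (rule converse_rtrancl_into_rtrancl)
  qed
  have "strong R (anc y)"
    unfolding strong_def using x path eq unfolding anc_def by blast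
  moreover have "2 \<le> card (anc y)"
  proof -
    have "x \<in> anc x" using eq[OF x] x by simp
    then obtain z where "(x, z) \<in> ?T" "(z, x) \<in> ?T\<^sup>*" unfolding anc_def by (auto dest: tranclD)
    then have "(z, x) \<in> ?T\<^sup>+" "z \<noteq> x" using assms(4) by (auto elim: rtranclE intro: rtrancl_into_trancl1)
    then have "z \<in> anc y" using eq[OF x] unfolding anc_def by blast
    then have "{x, z} \<subseteq> anc y" using x by blast
    moreover have "finite (anc y)" using ancY assms(1) finite_subset by blast
    ultimately have "card {x, z} \<le> card (anc y)" by (rule card_mono[rotated])
    then show ?thesis using \<open>z \<noteq> x\<close> by simp
  qed
  ultimately show ?thesis using that ancY by blast
qed

section \<open>Semicomplete relations\<close>

lemma ex_max_card:
  assumes "finite V" "Q C" "\<And>D. Q D \<Longrightarrow> D \<subseteq> V"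
  obtains D where "Q D" "\<And>E. Q E \<Longrightarrow> card E \<le> card D"
proof -
  have "\<forall>D. Q D \<longrightarrow> card D < Suc (card V)"
    using assms(1,3) by (simp add: card_mono le_imp_less_Suc)
  then show ?thesis using ex_has_greatest_nat[of Q C card, OF assms(2)] that by blast
qed

locale semicomplete_rel =
  fixes V :: "'a set" and R :: "'a rel"
  assumes finite_V: "finite V" and R_sub: "R \<subseteq> V \<times> V"
    and irrefl: "(x, x) \<notin> R"
    and total: "x \<in> V \<Longrightarrow> y \<in> V \<Longrightarrow> x \<noteq> y \<Longrightarrow> (x, y) \<in> R \<or> (y, x) \<in> R"
begin

lemma R_V: "(x, y) \<in> R \<Longrightarrow> x \<in> V" "(x, y) \<in> R \<Longrightarrow> y \<in> V"
  using R_sub by auto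

lemma restrict: "S \<subseteq> V \<Longrightarrow> semicomplete_rel S (R \<inter> S \<times> S)"
  by unfold_locales (use finite_V irrefl total finite_subset in blast)+

lemma converse: "semicomplete_rel V (R\<inverse>)"
  by unfold_locales (use finite_V R_sub irrefl total in blast)+

text \<open>Unique successors are followed from \<open>a\<close> to \<open>b\<close> to
  \<open>c\<close>. If \<open>c\<close> differs from \<open>a\<close>, uniqueness excludes an arc
  from \<open>a\<close> to \<open>c\<close>, and semicompleteness closes the walk by the arc from
  \<open>c\<close> to \<open>a\<close>.\<close>

lemma nonbranching_cases:
  assumes "C \<subseteq> V" "strong R C" "2 \<le> card C" "\<not> branching R C"
  obtains (two) a b where "a \<noteq> b" "C = {a, b}" "R \<inter> C \<times> C = {(a, b), (b, a)}"
  | (three) a b c where "a \<noteq> b" "b \<noteq> c" "a \<noteq> c" "C = {a, b, c}"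
      "R \<inter> C \<times> C = {(a, b), (b, c), (c, a)}"
proof -
  have un: "y = z" if "(x, y) \<in> R" "(x, z) \<in> R" "x \<in> C" "y \<in> C" "z \<in> C" for x y z
    using assms(4) that unfolding branching_def by blast
  have closed: "S = C" if S: "S \<subseteq> C" "S \<noteq> {}" "\<forall>x\<in>S. \<exists>y\<in>S. (x, y) \<in> R" for S
  proof (rule ccontr)
    assume "S \<noteq> C"
    then obtain u v where uv: "u \<in> S" "v \<in> C - S" "(u, v) \<in> R"
      using strong_leaves[OF assms(2) S(1,2)] by metis
    then obtain y where "y \<in> S" "(u, y) \<in> R" using S(3) uv(1) by blast
    then show False using un[of u y v] uv S(1) by blast
  qed
  obtain a where a: "a \<in> C" using assms(2) unfolding strong_def by blast
  obtain b where b: "b \<in> C" "(a, b) \<in> R" using strong_succ[OF assms(2,3) a] by blast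
  obtain c where c: "c \<in> C" "(b, c) \<in> R" using strong_succ[OF assms(2,3) b(1)] by blast
  have ne: "a \<noteq> b" "b \<noteq> c" using b c irrefl by auto
  show ?thesis
  proof (cases "c = a")
    case True
    have C: "C = {a, b}" using closed[of "{a, b}"] a b c True by auto
    moreover have "R \<inter> C \<times> C = {(a, b), (b, a)}" unfolding C using b c True irrefl by auto
    ultimately show ?thesis by (rule two[OF ne(1)])
  next
    case False
    have "(a, c) \<notin> R" using un[OF b(2)] a b c ne by blast
    then have ca: "(c, a) \<in> R" using total a c assms(1) False by blast
    have C: "C = {a, b, c}" using closed[of "{a, b, c}"] a b c ca by auto
    have "(b, a) \<notin> R" "(c, b) \<notin> R" "(a, c) \<notin> R"
      using un[OF c(2), of a] un[OF ca, of b] un[OF b(2), of c] a b c ne False by auto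
    then have "R \<inter> C \<times> C = {(a, b), (b, c), (c, a)}" unfolding C using b c ca irrefl by auto
    then show ?thesis by (rule three[OF ne False[symmetric] C])
  qed
qed

text \<open>The exponent 6 is the least common multiple of the possible lengths 2 and 3.\<close>

lemma nonbranching_cycle:
  assumes "C \<subseteq> V" "strong R C" "2 \<le> card C" "\<not> branching R C"
  shows "\<exists>\<sigma>. bij_betw \<sigma> C C \<and> (\<forall>x\<in>C. \<forall>y\<in>C. (x, y) \<in> R \<longleftrightarrow> y = \<sigma> x) \<and>
    (\<forall>x\<in>C. \<sigma> x \<noteq> x \<and> (\<sigma> ^^ 6) x = x)"
  using assms
proof (cases rule: nonbranching_cases)
  case (two a b)
  let ?s = "\<lambda>x. if x = a then b else a"
  have "bij_betw ?s C C" unfolding bij_betw_def inj_on_def using two by auto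
  moreover have "\<forall>x\<in>C. \<forall>y\<in>C. (x, y) \<in> R \<longleftrightarrow> y = ?s x"
  proof (intro ballI)
    fix x y assume xy: "x \<in> C" "y \<in> C"
    then have "(x, y) \<in> R \<longleftrightarrow> (x, y) \<in> R \<inter> C \<times> C" by simp
    then show "(x, y) \<in> R \<longleftrightarrow> y = ?s x" using xy two unfolding two(3) by auto
  qed
  moreover have "\<forall>x\<in>C. ?s x \<noteq> x \<and> (?s ^^ 6) x = x" using two by (auto simp: eval_nat_numeral)
  ultimately show ?thesis by (intro exI[of _ ?s]) simp
next
  case (three a b c)
  let ?s = "\<lambda>x. if x = a then b else if x = b then c else a"
  have "bij_betw ?s C C" unfolding bij_betw_def inj_on_def using three by auto
  moreover have "\<forall>x\<in>C. \<forall>y\<in>C. (x, y) \<in> R \<longleftrightarrow> y = ?s x"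
  proof (intro ballI)
    fix x y assume xy: "x \<in> C" "y \<in> C"
    then have "(x, y) \<in> R \<longleftrightarrow> (x, y) \<in> R \<inter> C \<times> C" by simp
    then show "(x, y) \<in> R \<longleftrightarrow> y = ?s x" using xy three unfolding three(5) by auto
  qed
  moreover have "\<forall>x\<in>C. ?s x \<noteq> x \<and> (?s ^^ 6) x = x" using three by (auto simp: eval_nat_numeral)
  ultimately show ?thesis by (intro exI[of _ ?s]) simp
qed

text \<open>A strong set without two arcs into one vertex is a cycle of the converse relation. There
  the successor map is injective, so no two arcs leave one vertex either.\<close>

lemma branching_converse:
  assumes "C \<subseteq> V" "strong R C" "branching R C"
  shows "branching (R\<inverse>) C"
proof (rule ccontr)
  interpret c: semicomplete_rel V "R\<inverse>" by (rule converse)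
  assume nb: "\<not> branching (R\<inverse>) C"
  obtain v x y where v: "v \<in> C" "x \<in> C" "y \<in> C" "x \<noteq> y" "(v, x) \<in> R" "(v, y) \<in> R"
    using assms(3) unfolding branching_def by blast
  have "card {x, y} \<le> card C" by (rule card_mono) (use v assms finite_V finite_subset in auto)
  then have "2 \<le> card C" using v by simp
  moreover have "strong (R\<inverse>) C" using assms(2) by simp
  ultimately obtain \<sigma> where s: "bij_betw \<sigma> C C"
      "\<forall>x\<in>C. \<forall>y\<in>C. (x, y) \<in> R\<inverse> \<longleftrightarrow> y = \<sigma> x"
    using c.nonbranching_cycle[OF assms(1) _ _ nb] by blast
  have "\<sigma> x = \<sigma> y" using s(2) v by auto
  then show False using s(1) v unfolding bij_betw_def inj_on_def by blast
qed

end

locale strong_branching = semicomplete_rel +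
  assumes strong_V: "strong R V" and branching_V: "branching R V"
begin

lemma card_V: "2 \<le> card V"
proof -
  obtain x y where "x \<in> V" "y \<in> V" "x \<noteq> y" using branching_V unfolding branching_def by blast
  then have "card {x, y} \<le> card V" using finite_V by (intro card_mono) auto
  then show ?thesis using \<open>x \<noteq> y\<close> by simp
qed

lemma V_succ: "x \<in> V \<Longrightarrow> \<exists>y\<in>V. (x, y) \<in> R" and V_pred: "x \<in> V \<Longrightarrow> \<exists>y\<in>V. (y, x) \<in> R"
  using strong_succ[OF strong_V card_V] strong_pred[OF strong_V card_V] by blast+

lemma exact: "\<exists>N. \<forall>l\<ge>N. \<forall>x\<in>V. \<forall>y\<in>V. (x, y) \<in> R ^^ l"
proof -
  have "R \<inter> V \<times> V = R" using R_sub by blast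
  then show ?thesis
    using strong_branching_exact[OF finite_V strong_V branching_V irrefl total] by metis
qed

end

section \<open>Families closed under neighbourhoods, intersections and strong components\<close>

text \<open>The family \<open>P\<close> abstracts the sets that are preserved, in one sense or another, by a polymorphism.\<close>

locale definable_family = strong_branching +
  fixes P :: "'a set \<Rightarrow> bool"
  assumes P_sing: "v \<in> V \<Longrightarrow> P {v}"
    and P_Int: "P X \<Longrightarrow> P Y \<Longrightarrow> P (X \<inter> Y)"
    and P_succ: "X \<subseteq> V \<Longrightarrow> P X \<Longrightarrow> P (R `` X)" and P_pred: "X \<subseteq> V \<Longrightarrow> P X \<Longrightarrow> P (R\<inverse> `` X)"
    and P_comp: "Z \<subseteq> V \<Longrightarrow> P Z \<Longrightarrow> C \<subseteq> Z \<Longrightarrow> strong R C \<Longrightarrow>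
      (\<And>z c d. z \<in> Z - C \<Longrightarrow> c \<in> C \<Longrightarrow> d \<in> C \<Longrightarrow> (z, c) \<in> R \<Longrightarrow> (d, z) \<in> R \<Longrightarrow> False) \<Longrightarrow> P C"
begin

text \<open>A largest strong set between \<open>C\<^sub>0\<close> and \<open>Z\<close> meets the
  premise of \<open>P_comp\<close>, since a vertex with arcs both to and from it could be
  added.\<close>

lemma component:
  assumes "Z \<subseteq> V" "P Z" "C\<^sub>0 \<subseteq> Z" "strong R C\<^sub>0"
  obtains C where "C\<^sub>0 \<subseteq> C" "C \<subseteq> Z" "strong R C" "P C"
proof -
  have fin: "finite Z" using assms(1) finite_V finite_subset by blast
  have "C\<^sub>0 \<subseteq> C\<^sub>0 \<and> C\<^sub>0 \<subseteq> Z \<and> strong R C\<^sub>0" using assms by blast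
  then obtain C where C: "C\<^sub>0 \<subseteq> C" "C \<subseteq> Z" "strong R C"
      and max: "\<And>D. C\<^sub>0 \<subseteq> D \<and> D \<subseteq> Z \<and> strong R D \<Longrightarrow> card D \<le> card C"
    by (rule ex_max_card[OF fin]) auto
  have "P C"
  proof (rule P_comp[OF assms(1,2) C(2,3)])
    fix z c d assume z: "z \<in> Z - C" "c \<in> C" "d \<in> C" "(z, c) \<in> R" "(d, z) \<in> R"
    have "card (insert z C) \<le> card C"
      using strong_insert[OF C(3) z(2-5)] C z by (intro max) auto
    moreover have "finite C" using C(2) fin finite_subset by blast
    ultimately show False using z by simp
  qed
  then show ?thesis using that C by blast
qed

text \<open>The iterated out-neighbourhoods of a vertex reach \<open>V\<close>, because walks of
  every large length exist. A proper one that is followed by \<open>V\<close> contains an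
  in-neighbour of each of its members, hence a nontrivial strong set.\<close>

lemma proper_strong_exists:
  obtains C where "P C" "strong R C" "2 \<le> card C" "C \<subset> V"
proof -
  obtain v where v: "v \<in> V" using strong_V unfolding strong_def by blast
  define Y where "Y k = ((``) R ^^ k) {v}" for k
  have Y0: "Y 0 = {v}" and YS: "Y (Suc k) = R `` Y k" for k by (auto simp: Y_def)
  have PY: "Y k \<subseteq> V \<and> P (Y k) \<and> Y k \<noteq> {}" for k
  proof (induction k)
    case 0
    then show ?case using v P_sing by (simp add: Y0)
  next
    case (Suc k)
    then obtain y where "y \<in> Y k" "y \<in> V" by blast
    then have "R `` Y k \<noteq> {}" using V_succ by blast
    then show ?case using Suc P_succ R_V unfolding YS by blast
  qed
  obtain N where N: "\<forall>l\<ge>N. \<forall>x\<in>V. \<forall>y\<in>V. (x, y) \<in> R ^^ l"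
    using exact by blast
  have "Y k = (R ^^ k) `` {v}" for k
    by (induction k) (auto simp: Y0 YS)
  then have "Y N = V" using N v PY[of N] by auto
  moreover have "Y 0 \<noteq> V" using card_V by (auto simp: Y0)
  ultimately have "\<exists>k. Y k \<noteq> V \<and> Y (Suc k) = V"
    by (induction N) auto
  then obtain k where k: "Y k \<noteq> V" "Y (Suc k) = V" by blast
  have "\<exists>x\<in>Y k. (x, y) \<in> R" if "y \<in> Y k" for y
    using that PY[of k] k(2) unfolding YS by blast
  then obtain C\<^sub>0 where C0: "C\<^sub>0 \<subseteq> Y k" "strong R C\<^sub>0" "2 \<le> card C\<^sub>0"
    using no_source_strong[of "Y k" R] PY[of k] irrefl finite_V finite_subset by metis
  obtain C where C: "C\<^sub>0 \<subseteq> C" "C \<subseteq> Y k" "strong R C" "P C"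
    using component C0 PY[of k] by blast
  have "finite C" using C PY[of k] finite_V finite_subset by metis
  then have "2 \<le> card C" using C0(3) card_mono[OF _ C(1)] by linarith
  then show ?thesis using that C k(1) PY[of k] by blast
qed

lemma maximal_strong:
  assumes "P C" "strong R C" "C \<subset> V"
  obtains D where "C \<subseteq> D" "P D" "strong R D" "D \<subset> V"
    "\<forall>E. P E \<longrightarrow> strong R E \<longrightarrow> D \<subset> E \<longrightarrow> E \<subseteq> V \<longrightarrow> E = V"
proof -
  let ?Q = "\<lambda>D. C \<subseteq> D \<and> P D \<and> strong R D \<and> D \<subset> V"
  have "?Q C" using assms by blast
  then obtain D where D: "?Q D" and max: "\<And>E. ?Q E \<Longrightarrow> card E \<le> card D"
    by (rule ex_max_card[OF finite_V]) auto
  have "E = V" if E: "P E" "strong R E" "D \<subset> E" "E \<subseteq> V" for E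
  proof (rule ccontr)
    assume "E \<noteq> V"
    then have "card E \<le> card D" using E D by (intro max) auto
    moreover have "card D < card E" using E finite_V finite_subset psubset_card_mono by metis
    ultimately show False by simp
  qed
  then show ?thesis using that D by blast
qed

text \<open>The vertices with arcs both to and from \<open>C\<close> form a strong set in the family
  that contains \<open>C\<close>; by maximality they are all of \<open>V\<close> or just
  \<open>C\<close>. In the second case every other vertex either dominates \<open>C\<close> or is
  dominated by it.\<close>

lemma module_cases:
  assumes C: "C \<subset> V" "P C" "strong R C" "2 \<le> card C"
    and max: "\<forall>E. P E \<longrightarrow> strong R E \<longrightarrow> C \<subset> E \<longrightarrow> E \<subseteq> V \<longrightarrow> E = V"
  obtains (dense) "R `` C = V" "R\<inverse> `` C = V"
  | (module) A B where "V = A \<union> B \<union> C" "A \<inter> B = {}" "A \<inter> C = {}" "B \<inter> C = {}" "A \<noteq> {}" "B \<noteq> {}"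
      "\<And>a c. a \<in> A \<Longrightarrow> c \<in> C \<Longrightarrow> (a, c) \<in> R \<and> (c, a) \<notin> R"
      "\<And>b c. b \<in> B \<Longrightarrow> c \<in> C \<Longrightarrow> (c, b) \<in> R \<and> (b, c) \<notin> R"
      "\<And>b. b \<in> B \<Longrightarrow> \<exists>a\<in>A. (b, a) \<in> R" "\<And>a. a \<in> A \<Longrightarrow> \<exists>b\<in>B. (b, a) \<in> R"
proof -
  let ?D = "R `` C \<inter> R\<inverse> `` C"
  have fin: "finite ?D" "?D \<subseteq> V" using finite_V R_V finite_subset[of ?D V] by blast+
  have CD: "C \<subseteq> ?D" using strong_succ[OF C(3,4)] strong_pred[OF C(3,4)] by blast
  have "strong R (C \<union> ?D)" by (rule strong_enlarge[OF fin(1) C(3)]) blast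
  then have "strong R ?D" using CD by (simp add: Un_absorb1)
  moreover have "P ?D" using C by (auto intro!: P_Int P_succ P_pred)
  ultimately have "?D = V \<or> ?D = C" using max fin(2) CD by (metis psubsetI)
  then show ?thesis
  proof
    assume "?D = V"
    then show ?thesis using dense R_V by blast
  next
    assume D: "?D = C"
    define A B where "A = R\<inverse> `` C - C" and "B = R `` C - C"
    have adj: "(x, c) \<in> R \<or> (c, x) \<in> R" if "x \<in> V - C" "c \<in> C" for x c
      using total[of x c] that C(1) by blast
    have V: "V = A \<union> B \<union> C"
    proof -
      obtain c where "c \<in> C" using C(3) unfolding strong_def by blast
      then show ?thesis using adj C(1) R_V unfolding A_def B_def by blast
    qed
    have disj: "A \<inter> B = {}" "A \<inter> C = {}" "B \<inter> C = {}" using D unfolding A_def B_def by blast+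
    have AV: "A \<subseteq> V" "B \<subseteq> V" using V by auto
    have Ca: "(c, a) \<notin> R" if "a \<in> A" "c \<in> C" for a c using that disj unfolding A_def B_def by blast
    have Cb: "(b, c) \<notin> R" if "b \<in> B" "c \<in> C" for b c using that disj unfolding A_def B_def by blast
    have aC: "(a, c) \<in> R" if "a \<in> A" "c \<in> C" for a c using adj[of a c] Ca that AV disj by blast
    have bC: "(c, b) \<in> R" if "b \<in> B" "c \<in> C" for b c using adj[of b c] Cb that AV disj by blast
    have Cne: "C \<noteq> {}" "V \<noteq> C" using C(1,3) unfolding strong_def by auto
    have "B \<noteq> {}"
    proof -
      obtain u v where "u \<in> C" "v \<in> V - C" "(u, v) \<in> R" using strong_leaves[OF strong_V] C(1) Cne by blast
      then show ?thesis unfolding B_def by blast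
    qed
    have "C \<union> B \<noteq> V" if "A = {}"
    proof
      assume "C \<union> B = V"
      moreover obtain u v where "u \<in> V - C" "v \<in> C" "(u, v) \<in> R"
        using strong_enters[OF strong_V, of C] C(1) Cne by blast
      ultimately show False using Cb by blast
    qed
    then have "A \<noteq> {}" using V by auto
    obtain u v where uv: "u \<in> C \<union> B" "v \<in> V - (C \<union> B)" "(u, v) \<in> R"
      using strong_leaves[OF strong_V, of "C \<union> B"] \<open>A \<noteq> {}\<close> disj V Cne by blast
    then have ba: "u \<in> B" "v \<in> A" using V Ca by blast+
    \<comment> \<open>\<open>?Q\<close> holds the vertices with walks of length exactly two from
      \<open>C\<close> and to \<open>C\<close>. Its component around \<open>C\<close>,
      \<open>u\<close> and \<open>v\<close> is \<open>V\<close> by maximality, so all vertices have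
      such walks. From \<open>B\<close> the walk to \<open>C\<close> passes through
      \<open>A\<close>; the walk from \<open>C\<close> to a vertex of \<open>A\<close> passes
      through \<open>B\<close>.\<close>
    let ?Q = "R `` (R `` C) \<inter> R\<inverse> `` (R\<inverse> `` C)"
    have Q: "?Q \<subseteq> V" "P ?Q" using C R_V by (auto intro!: P_Int P_succ P_pred)
    have CQ: "C \<subseteq> ?Q" using CD by blast
    obtain c where c: "c \<in> C" using Cne by blast
    have "u \<in> ?Q" "v \<in> ?Q" using aC[OF ba(2) c] bC[OF ba(1) c] c uv(3) CD by blast+
    then have CQ': "insert u (insert v C) \<subseteq> ?Q" using CQ by blast
    have s: "strong R (insert u (insert v C))"
    proof -
      define T where "T = R \<inter> insert u (insert v C) \<times> insert u (insert v C)"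
      have sub: "(R \<inter> C \<times> C)\<^sup>* \<subseteq> T\<^sup>*" unfolding T_def by (rule rtrancl_mono) auto
      have CC: "(x, y) \<in> T\<^sup>*" if "x \<in> C" "y \<in> C" for x y
        using C(3) that sub unfolding strong_def by blast
      have t: "(v, c) \<in> T" "(c, u) \<in> T" "(u, v) \<in> T"
        using aC[OF ba(2) c] bC[OF ba(1) c] c uv(3) unfolding T_def by auto
      then have "(v, c) \<in> T\<^sup>*" "(u, c) \<in> T\<^sup>*" "(c, u) \<in> T\<^sup>*" "(c, v) \<in> T\<^sup>*"
        by (auto intro: r_into_rtrancl converse_rtrancl_into_rtrancl)
      then have "(x, c) \<in> T\<^sup>* \<and> (c, x) \<in> T\<^sup>*" if "x \<in> insert u (insert v C)" for x
        using that CC c by blast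
      then show ?thesis unfolding strong_def T_def[symmetric] by (meson insert_not_empty rtrancl_trans)
    qed
    obtain E where E: "insert u (insert v C) \<subseteq> E" "E \<subseteq> ?Q" "strong R E" "P E"
      using component[OF Q CQ' s] .
    have "C \<subset> E" using E(1) ba disj by blast
    then have "E = V" using max E Q(1) by blast
    then have QV: "V \<subseteq> ?Q" using E(2) by blast
    have "R `` C \<subseteq> B \<union> C" "R\<inverse> `` C \<subseteq> A \<union> C" unfolding A_def B_def by auto
    then have *: "V \<subseteq> R `` (B \<union> C)" "V \<subseteq> R\<inverse> `` (A \<union> C)" using QV by blast+
    have "\<exists>a\<in>A. (b, a) \<in> R" if "b \<in> B" for b
    proof -
      have "b \<in> R\<inverse> `` (A \<union> C)" using *(2) AV that by blast
      then show ?thesis using Cb[OF that] by blast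
    qed
    moreover have "\<exists>b\<in>B. (b, a) \<in> R" if "a \<in> A" for a
    proof -
      have "a \<in> R `` (B \<union> C)" using *(1) AV that by blast
      then show ?thesis using Ca[OF that] by blast
    qed
    ultimately show ?thesis
      using module[OF V disj \<open>A \<noteq> {}\<close> \<open>B \<noteq> {}\<close>] aC Ca bC Cb by blast
  qed
qed

end

section \<open>Absorbing sets of binary polymorphisms\<close>

text \<open>\<open>IH\<close> is the induction hypothesis of
  \<open>binary_polymorphism_projection\<close>. It is symmetric in the two projections, so
  \<open>flip\<close> gives the mirror image of every result.\<close>

locale binary_polymorphism = strong_branching +
  fixes h :: "'a \<Rightarrow> 'a \<Rightarrow> 'a"
  assumes h_V: "x \<in> V \<Longrightarrow> y \<in> V \<Longrightarrow> h x y \<in> V"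
    and h_R: "(x, x') \<in> R \<Longrightarrow> (y, y') \<in> R \<Longrightarrow> (h x y, h x' y') \<in> R"
    and h_idem: "x \<in> V \<Longrightarrow> h x x = x"
    and IH: "S \<subset> V \<Longrightarrow> \<forall>x\<in>S. \<forall>y\<in>S. h x y \<in> S \<Longrightarrow> strong R S \<Longrightarrow> branching R S \<Longrightarrow>
      (\<forall>x\<in>S. \<forall>y\<in>S. h x y = x) \<or> (\<forall>x\<in>S. \<forall>y\<in>S. h x y = y)"
begin

definition closed :: "'a set \<Rightarrow> bool" where
  "closed S \<longleftrightarrow> (\<forall>x\<in>S. \<forall>y\<in>S. h x y \<in> S)"

lemma closedD: "closed S \<Longrightarrow> x \<in> S \<Longrightarrow> y \<in> S \<Longrightarrow> h x y \<in> S"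
  by (simp add: closed_def)

lemma flip: "binary_polymorphism V R (\<lambda>x y. h y x)"
proof
  show "(\<forall>x\<in>S. \<forall>y\<in>S. h y x = x) \<or> (\<forall>x\<in>S. \<forall>y\<in>S. h y x = y)"
    if "S \<subset> V" "\<forall>x\<in>S. \<forall>y\<in>S. h y x \<in> S" "strong R S" "branching R S" for S
    using IH[OF that(1) _ that(3,4)] that(2) by blast
qed (use h_V h_R h_idem in simp_all)

sublocale definable_family V R closed
proof
  show "closed (X \<inter> Y)" if "closed X" "closed Y" for X Y
    using that unfolding closed_def by blast
  show "closed (R `` X)" if "closed X" for X
    unfolding closed_def using closedD[OF that] h_R by (meson Image_iff)
  show "closed (R\<inverse> `` X)" if "closed X" for X
    unfolding closed_def using closedD[OF that] h_R by (meson Image_iff converse_iff)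
  show "closed C" if Z: "Z \<subseteq> V" "closed Z" "C \<subseteq> Z" "strong R C"
    and nz: "\<And>z c d. z \<in> Z - C \<Longrightarrow> c \<in> C \<Longrightarrow> d \<in> C \<Longrightarrow> (z, c) \<in> R \<Longrightarrow> (d, z) \<in> R \<Longrightarrow> False" for Z C
    unfolding closed_def
  proof (intro ballI, rule ccontr)
    fix a b assume ab: "a \<in> C" "b \<in> C" and "h a b \<notin> C"
    define z where "z = h a b"
    have z: "z \<in> Z - C" using closedD[OF Z(2)] ab Z(3) \<open>h a b \<notin> C\<close> unfolding z_def by blast
    then have zV: "z \<in> V" "a \<in> V" "b \<in> V" using Z ab by auto
    have "z \<noteq> a" "z \<noteq> b" using z ab by auto
    \<comment> \<open>As \<open>z\<close> cannot have arcs both to and from \<open>C\<close>, it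
      lies on the same side of \<open>a\<close> and \<open>b\<close>. Applying \<open>h\<close> to
      these two arcs joins \<open>h z z\<close> and \<open>h a b\<close>, both equal to
      \<open>z\<close>.\<close>
    then have "((z, a) \<in> R \<and> (z, b) \<in> R) \<or> ((a, z) \<in> R \<and> (b, z) \<in> R)"
      using nz[OF z ab] nz[OF z ab(2,1)] total[OF zV(1,2)] total[OF zV(1,3)] by blast
    then have "(h z z, z) \<in> R \<or> (z, h z z) \<in> R" using h_R unfolding z_def by metis
    then show False using h_idem zV(1) irrefl by auto
  qed
qed (use h_idem in \<open>auto simp: closed_def\<close>)

text \<open>The aim is to make all singletons absorbing, which says that \<open>h\<close> is the
  first projection.\<close>

definition absorbing :: "'a set \<Rightarrow> bool" where
  "absorbing X \<longleftrightarrow> X \<subseteq> V \<and> X \<noteq> {} \<and> (\<forall>x\<in>X. \<forall>y\<in>V. h x y \<in> X)"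

lemma absorbing_succ:
  assumes "absorbing X" shows "absorbing (R `` X)"
proof -
  obtain x where "x \<in> X" "x \<in> V" using assms unfolding absorbing_def by blast
  then have "R `` X \<noteq> {}" using V_succ by blast
  moreover have "h x y \<in> R `` X" if xy: "x \<in> R `` X" "y \<in> V" for x y
  proof -
    obtain x' y' where "x' \<in> X" "(x', x) \<in> R" "y' \<in> V" "(y', y) \<in> R" using xy V_pred by blast
    then show ?thesis using assms h_R unfolding absorbing_def by blast
  qed
  ultimately show ?thesis using R_V unfolding absorbing_def by blast
qed

lemma absorbing_pred:
  assumes "absorbing X" shows "absorbing (R\<inverse> `` X)"
proof -
  obtain x where "x \<in> X" "x \<in> V" using assms unfolding absorbing_def by blast
  then have "R\<inverse> `` X \<noteq> {}" using V_pred by blast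
  moreover have "h x y \<in> R\<inverse> `` X" if xy: "x \<in> R\<inverse> `` X" "y \<in> V" for x y
  proof -
    obtain x' y' where "x' \<in> X" "(x, x') \<in> R" "y' \<in> V" "(y, y') \<in> R" using xy V_succ by blast
    then show ?thesis using assms h_R unfolding absorbing_def by blast
  qed
  ultimately show ?thesis using R_V unfolding absorbing_def by blast
qed

lemma absorbing_Int:
  "absorbing X \<Longrightarrow> absorbing Y \<Longrightarrow> X \<inter> Y \<noteq> {} \<Longrightarrow> absorbing (X \<inter> Y)"
  unfolding absorbing_def by blast

lemma walk_image:
  assumes "absorbing Y" "(a, b) \<in> (R \<inter> Y \<times> Y) ^^ l" "(u, w) \<in> R ^^ l" "a \<in> Y" "u \<in> V"
  shows "(h a u, h b w) \<in> (R \<inter> Y \<times> Y) ^^ l"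
  using assms(2,3)
proof (induction l arbitrary: b w)
  case (Suc l)
  then obtain b' w' where b: "(a, b') \<in> (R \<inter> Y \<times> Y) ^^ l" "(b', b) \<in> R \<inter> Y \<times> Y"
    "(u, w') \<in> R ^^ l" "(w', w) \<in> R" by (meson relpow_Suc_E)
  have "(h b' w', h b w) \<in> R \<inter> Y \<times> Y"
    using b(2,4) h_R R_V assms(1) unfolding absorbing_def by blast
  then show ?case using Suc.IH[OF b(1,3)] by auto
qed auto

text \<open>\<open>D\<close> is the strong component in \<open>Y\<close> of a vertex on a cycle. For
  \<open>z\<close> in \<open>D\<close> and \<open>y\<close> in \<open>V\<close>, a closed walk at
  \<open>z\<close> in \<open>Y\<close> of length \<open>N * p\<close> is paired with walks of that
  length from \<open>z\<close> to \<open>y\<close> and back; \<open>h\<close> maps the pairs to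
  walks in \<open>Y\<close> from \<open>z\<close> to \<open>h z y\<close> and back. So
  \<open>D\<close> is absorbing.\<close>

lemma minimal_absorbing_strong:
  assumes Y: "absorbing Y" "2 \<le> card Y" and min: "\<And>X. absorbing X \<Longrightarrow> X \<subseteq> Y \<Longrightarrow> X = Y"
  shows "strong R Y"
proof -
  let ?T = "R \<inter> Y \<times> Y"
  have YV: "Y \<subseteq> V" "finite Y" using Y(1) finite_V finite_subset unfolding absorbing_def by auto
  obtain x y where "x \<in> Y" "y \<in> Y" "x \<noteq> y"
    using Y(2) YV(2) by (metis card_le_Suc0_iff_eq not_less_eq_eq numeral_2_eq_2)
  \<comment> \<open>\<open>Y\<close> contains an arc, so its intersection with its own
    out-neighbourhood is a nonempty absorbing set, by minimality all of \<open>Y\<close>. Hence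
    \<open>Y\<close> has no source.\<close>
  then have "Y \<inter> R `` Y \<noteq> {}" using total[of x y] YV by blast
  then have "Y \<inter> R `` Y = Y" using min[of "Y \<inter> R `` Y"] absorbing_Int[OF Y(1) absorbing_succ[OF Y(1)]] by blast
  then have src: "\<exists>x\<in>Y. (x, y) \<in> R" if "y \<in> Y" for y using that by blast
  obtain C where C: "C \<subseteq> Y" "strong R C" "2 \<le> card C"
    using no_source_strong[OF YV(2) _ src irrefl] Y(1) unfolding absorbing_def by metis
  obtain c where c: "c \<in> C" using C(2) unfolding strong_def by blast
  obtain c' where c': "c' \<in> C" "(c, c') \<in> R" using strong_succ[OF C(2,3) c] by blast
  have "(c', c) \<in> (R \<inter> C \<times> C)\<^sup>*" using C(2) c c' unfolding strong_def by blast
  then have "(c', c) \<in> ?T\<^sup>*" by (rule rtrancl_mono[THEN subsetD, rotated]) (use C(1) in blast)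
  then have cc: "(c, c) \<in> ?T\<^sup>+" using c c' C(1) by (meson IntI SigmaI rtrancl_into_trancl2 subsetD)
  define D where "D = {z. (c, z) \<in> ?T\<^sup>* \<and> (z, c) \<in> ?T\<^sup>*}"
  have "c \<in> Y" using c C(1) by blast
  have DY: "D \<subseteq> Y"
  proof
    fix z assume "z \<in> D"
    then have "(c, z) \<in> ?T\<^sup>*" unfolding D_def by blast
    then show "z \<in> Y" using \<open>c \<in> Y\<close> by (induction rule: rtrancl_induct) auto
  qed
  obtain N where N: "\<forall>l\<ge>N. \<forall>x\<in>V. \<forall>y\<in>V. (x, y) \<in> R ^^ l" using exact by blast
  have "h z y \<in> D" if z: "z \<in> D" "y \<in> V" for z y
  proof -
    have "(c, z) \<in> ?T\<^sup>*" "(z, c) \<in> ?T\<^sup>*" using z(1) unfolding D_def by auto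
    then have "(z, z) \<in> ?T\<^sup>+"
      using rtrancl_trancl_trancl trancl_rtrancl_trancl[OF cc] by metis
    then obtain p where p: "0 < p" "(z, z) \<in> ?T ^^ p" by (auto simp: trancl_power)
    have zz: "(z, z) \<in> ?T ^^ (N * p)" by (rule relpow_period[OF p(2)])
    have zY: "z \<in> Y" "z \<in> V" using z(1) DY YV(1) by auto
    have "N \<le> N * p" using p(1) by simp
    then have "(z, y) \<in> R ^^ (N * p)" "(y, z) \<in> R ^^ (N * p)" using N z(2) zY(2) by auto
    then have "(h z z, h z y) \<in> ?T ^^ (N * p)" "(h z y, h z z) \<in> ?T ^^ (N * p)"
      using walk_image[OF Y(1) zz] zY z(2) by blast+
    then have "(z, h z y) \<in> ?T\<^sup>*" "(h z y, z) \<in> ?T\<^sup>*" using h_idem[OF zY(2)] relpow_imp_rtrancl by metis+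
    then show ?thesis using z(1) unfolding D_def by (auto intro: rtrancl_trans)
  qed
  then have "absorbing D" using DY YV(1) unfolding absorbing_def D_def by blast
  then have "D = Y" using min DY by blast
  have "(x, y) \<in> ?T\<^sup>*" if "x \<in> Y" "y \<in> Y" for x y
  proof -
    have "x \<in> D" "y \<in> D" using that \<open>D = Y\<close> by auto
    then have "(x, c) \<in> ?T\<^sup>*" "(c, y) \<in> ?T\<^sup>*" unfolding D_def by auto
    then show ?thesis by (rule rtrancl_trans)
  qed
  then show ?thesis using \<open>c \<in> Y\<close> unfolding strong_def by blast
qed

lemma singleton_absorbing: "absorbing {a} \<longleftrightarrow> a \<in> V \<and> (\<forall>y\<in>V. h a y = a)"
  unfolding absorbing_def by auto

lemma minimal_absorbing:
  assumes Y: "absorbing Y" "Y \<noteq> V" and min: "\<And>X. absorbing X \<Longrightarrow> X \<subseteq> Y \<Longrightarrow> X = Y"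
  shows "\<exists>a. Y = {a}"
proof (cases "2 \<le> card Y")
  case False
  have "finite Y" "Y \<noteq> {}" using Y(1) finite_V finite_subset unfolding absorbing_def by auto
  then have "card Y = 1" using False by (metis One_nat_def Suc_leI card_gt_0_iff le_antisym not_less_eq_eq numeral_2_eq_2)
  then show ?thesis by (rule card_1_singletonE) blast
next
  case True
  have YV: "Y \<subset> V" "Y \<noteq> {}" using Y unfolding absorbing_def by auto
  have s: "strong R Y" by (rule minimal_absorbing_strong[OF Y(1) True min])
  have hY: "h x y \<in> Y" if "x \<in> Y" "y \<in> V" for x y using Y(1) that unfolding absorbing_def by blast
  obtain a where a: "a \<in> Y" "a \<in> V" using YV by auto
  have fix_imp: ?thesis if "\<And>y. y \<in> V \<Longrightarrow> h a y = a"
    using min[of "{a}"] that a singleton_absorbing by blast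
  show ?thesis
  proof (cases "branching R Y")
    case False
    obtain \<sigma> where sig: "\<forall>x\<in>Y. \<forall>y\<in>Y. (x, y) \<in> R \<longleftrightarrow> y = \<sigma> x"
      using nonbranching_cycle[OF _ s True False] YV(1) by blast
    \<comment> \<open>Successors in the cycle \<open>Y\<close> are unique, so
      \<open>h b u = b\<close> propagates along pairs of walks. Starting from
      \<open>h a a = a\<close>, the first walk returns to \<open>a\<close> after
      \<open>N * p\<close> steps while the second can end in any \<open>y\<close>.\<close>
    have follow: "h c w = c" if "(b, c) \<in> (R \<inter> Y \<times> Y) ^^ l" "(u, w) \<in> R ^^ l" "h b u = b" for b c u w l
      using that(1,2)
    proof (induction l arbitrary: c w)
      case 0
      then show ?case using that(3) by auto
    next
      case (Suc l)
      then obtain c' w' where c: "(b, c') \<in> (R \<inter> Y \<times> Y) ^^ l" "(c', c) \<in> R \<inter> Y \<times> Y"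
        "(u, w') \<in> R ^^ l" "(w', w) \<in> R" by (meson relpow_Suc_E)
      have "(c', h c w) \<in> R" using Suc.IH[OF c(1,3)] h_R[of c' c w' w] c by auto
      moreover have "h c w \<in> Y" using hY c(2,4) R_V by blast
      ultimately show ?case using sig c(2) by auto
    qed
    obtain a' where a': "a' \<in> Y" "(a, a') \<in> R" using strong_succ[OF s True a(1)] by blast
    have "(a', a) \<in> (R \<inter> Y \<times> Y)\<^sup>*" using s a a' unfolding strong_def by blast
    then have "(a, a) \<in> (R \<inter> Y \<times> Y)\<^sup>+" using a a' by (meson IntI SigmaI rtrancl_into_trancl2)
    then obtain p where p: "0 < p" "(a, a) \<in> (R \<inter> Y \<times> Y) ^^ p" by (auto simp: trancl_power)
    obtain N where N: "\<forall>l\<ge>N. \<forall>x\<in>V. \<forall>y\<in>V. (x, y) \<in> R ^^ l" using exact by blast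
    have "N \<le> N * p" using p(1) by simp
    then have "h a y = a" if "y \<in> V" for y
      using follow[OF relpow_period[OF p(2)], of a y N] N that a(2) h_idem by blast
    then show ?thesis using fix_imp by blast
  next
    case True
    have "\<forall>x\<in>Y. \<forall>y\<in>Y. h x y \<in> Y" using hY YV(1) by blast
    then have "(\<forall>x\<in>Y. \<forall>y\<in>Y. h x y = x) \<or> (\<forall>x\<in>Y. \<forall>y\<in>Y. h x y = y)"
      using IH[OF YV(1) _ s True] by blast
    then show ?thesis
    proof
      assume p1: "\<forall>x\<in>Y. \<forall>y\<in>Y. h x y = x"
      have RV: "R \<inter> V \<times> V = R" using R_sub by blast
      have conn: "(x, y) \<in> R\<^sup>*" if "x \<in> V" "y \<in> V" for x y
        using strong_V that unfolding strong_def RV by blast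
      \<comment> \<open>\<open>rigid\<close> is applied to the self-maps of \<open>Y\<close> that
        send \<open>x\<close> to \<open>h x u\<close>, for \<open>u\<close> in \<open>V\<close>; the
        map for \<open>u = a\<close> is the identity.\<close>
      have "h a y = a" if "y \<in> V" for y
      proof (rule rigid[of R Y V "\<lambda>u x. h x u" R a y a])
        show "\<And>x y. x \<in> Y \<Longrightarrow> y \<in> Y \<Longrightarrow> x \<noteq> y \<Longrightarrow> (x, y) \<in> R \<or> (y, x) \<in> R" using total YV(1) by blast
      qed (use irrefl hY h_R R_sub a p1 conn that in auto)
      then show ?thesis using fix_imp by blast
    next
      assume p2: "\<forall>x\<in>Y. \<forall>y\<in>Y. h x y = y"
      \<comment> \<open>The value \<open>z = h a v\<close> lies in \<open>Y\<close>, where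
        \<open>h\<close> returns its second argument. So an arc between \<open>v\<close> and
        \<open>z\<close> is mapped to a loop at \<open>z\<close>.\<close>
      obtain v where v: "v \<in> V - Y" using YV(1) by blast
      define z where "z = h a v"
      have zY: "z \<in> Y" using hY[OF a(1)] v unfolding z_def by blast
      obtain a' where a': "a' \<in> Y" "(a, a') \<in> R" using strong_succ[OF s \<open>2 \<le> card Y\<close> a(1)] by blast
      obtain a'' where a'': "a'' \<in> Y" "(a'', a) \<in> R" using strong_pred[OF s \<open>2 \<le> card Y\<close> a(1)] by blast
      have "(v, z) \<in> R \<or> (z, v) \<in> R" using total[of v z] v zY YV(1) by blast
      then show ?thesis
      proof
        assume "(v, z) \<in> R"
        then have "(h a v, h a' z) \<in> R" using h_R a'(2) by blast
        then show ?thesis using p2 a'(1) zY irrefl unfolding z_def by metis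
      next
        assume "(z, v) \<in> R"
        then have "(h a'' z, h a v) \<in> R" using h_R a''(2) by blast
        then show ?thesis using p2 a''(1) zY irrefl unfolding z_def by metis
      qed
    qed
  qed
qed

lemma ex_minimal_absorbing:
  assumes "absorbing X"
  obtains Y where "absorbing Y" "Y \<subseteq> X" "\<And>Z. absorbing Z \<Longrightarrow> Z \<subseteq> Y \<Longrightarrow> Z = Y"
proof -
  let ?Q = "\<lambda>Y. absorbing Y \<and> Y \<subseteq> X"
  obtain Y where Y: "?Q Y" and min: "\<And>Z. ?Q Z \<Longrightarrow> card Y \<le> card Z"
    using ex_has_least_nat[of ?Q X card] assms by blast
  have "Z = Y" if "absorbing Z" "Z \<subseteq> Y" for Z
  proof (rule card_seteq[OF _ that(2)])
    show "finite Y" using Y finite_V finite_subset unfolding absorbing_def by blast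
    show "card Y \<le> card Z" using min that Y by blast
  qed
  then show ?thesis using that Y by blast
qed

text \<open>\<open>S\<close> holds the vertices whose singletons are absorbing. A smallest absorbing
  set \<open>Y\<close> not inside \<open>S\<close> avoids \<open>S\<close>: for \<open>c\<close> in
  \<open>S\<close> and \<open>b\<close> outside, one of the two neighbourhoods of \<open>c\<close>
  is an absorbing set with \<open>b\<close> and without \<open>c\<close>. So \<open>Y\<close> is
  minimal among all absorbing sets, hence a singleton, which contradicts its choice.\<close>

lemma absorbing_imp_projection:
  assumes "absorbing X" "X \<noteq> V" "x \<in> V" "y \<in> V"
  shows "h x y = x"
proof -
  define S where "S = {a. absorbing {a}}"
  have XV: "X \<subseteq> V" using assms(1) unfolding absorbing_def by blast
  obtain Y0 where Y0: "absorbing Y0" "Y0 \<subseteq> X" "\<And>Z. absorbing Z \<Longrightarrow> Z \<subseteq> Y0 \<Longrightarrow> Z = Y0"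
    using ex_minimal_absorbing[OF assms(1)] by blast
  have "Y0 \<noteq> V" using Y0(2) XV assms(2) by blast
  then obtain s where s: "s \<in> S" using minimal_absorbing[OF Y0(1) _ Y0(3)] Y0(1) unfolding S_def by blast
  have "V \<subseteq> S"
  proof (rule ccontr)
    assume nS: "\<not> V \<subseteq> S"
    have SV: "S \<subseteq> V" unfolding S_def absorbing_def by blast
    let ?Q = "\<lambda>Y. absorbing Y \<and> \<not> Y \<subseteq> S"
    have "?Q V" using nS s SV h_V unfolding absorbing_def by blast
    then obtain Y where Y: "?Q Y" and min: "\<And>Z. ?Q Z \<Longrightarrow> card Y \<le> card Z"
      using ex_has_least_nat[of ?Q V card] by blast
    have YV: "Y \<subseteq> V" using Y unfolding absorbing_def by blast
    have fin: "finite Y" using YV finite_V finite_subset by blast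
    obtain b where b: "b \<in> Y" "b \<notin> S" using Y by blast
    have disj: "c \<notin> S" if c: "c \<in> Y" for c
    proof
      assume cS: "c \<in> S"
      then have ac: "absorbing {c}" unfolding S_def by blast
      have "b \<in> V" "c \<in> V" "c \<noteq> b" using b c cS YV by auto
      then have "(c, b) \<in> R \<or> (b, c) \<in> R" using total by blast
      then obtain W where W: "absorbing W" "b \<in> W" "c \<notin> W"
      proof
        assume "(c, b) \<in> R"
        then show thesis using that[OF absorbing_succ[OF ac]] irrefl by blast
      next
        assume "(b, c) \<in> R"
        then show thesis using that[OF absorbing_pred[OF ac]] irrefl by blast
      qed
      have "?Q (Y \<inter> W)" using absorbing_Int[of Y W] W Y b by blast
      then have "card Y \<le> card (Y \<inter> W)" by (rule min)
      moreover have "card (Y \<inter> W) < card Y" by (rule psubset_card_mono[OF fin]) (use c W in blast)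
      ultimately show False by simp
    qed
    have "Z = Y" if Z: "absorbing Z" "Z \<subseteq> Y" for Z
    proof (rule card_seteq[OF fin Z(2)])
      show "card Y \<le> card Z" using min disj Z unfolding absorbing_def by blast
    qed
    moreover have "Y \<noteq> V" using disj s SV by blast
    ultimately obtain a where "Y = {a}" using minimal_absorbing Y by blast
    then show False using Y unfolding S_def by blast
  qed
  then show ?thesis using assms(3,4) unfolding S_def absorbing_def by auto
qed

end

section \<open>Binary polymorphisms are projections\<close>

context binary_polymorphism
begin

text \<open>One proper absorbing set suffices. It comes from a maximal closed strong set
  \<open>D\<close> around \<open>S\<close>: if \<open>D\<close> is larger than \<open>S\<close>, it
  is branching, so \<open>IH\<close> applies, and \<open>S\<close> rules out the second projection
  on \<open>D\<close>.\<close>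

lemma projection_extends:
  assumes S: "S \<subset> V" "closed S" "strong R S" "2 \<le> card S" and p: "\<forall>x\<in>S. \<forall>y\<in>S. h x y = x"
  shows "\<forall>x\<in>V. \<forall>y\<in>V. h x y = x"
proof -
  obtain D where D: "S \<subseteq> D" "closed D" "strong R D" "D \<subset> V"
    and max: "\<forall>E. closed E \<longrightarrow> strong R E \<longrightarrow> D \<subset> E \<longrightarrow> E \<subseteq> V \<longrightarrow> E = V"
    using maximal_strong[OF S(2,3,1)] by blast
  have fin: "finite D" "finite S" using D(4) S(1) finite_V finite_subset by blast+
  have D2: "2 \<le> card D" using card_mono[OF fin(1) D(1)] S(4) by simp
  have pD: "\<forall>x\<in>D. \<forall>y\<in>D. h x y = x"
  proof (cases "S = D")
    case False
    have "branching R D" using strong_subset_branching[OF S(3,4) D(3)] D(1) False by blast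
    then have "(\<forall>x\<in>D. \<forall>y\<in>D. h x y = x) \<or> (\<forall>x\<in>D. \<forall>y\<in>D. h x y = y)"
      using IH[OF D(4)] D(2,3) unfolding closed_def by blast
    moreover obtain x y where "x \<in> S" "y \<in> S" "x \<noteq> y"
      using S(4) fin(2) by (metis card_le_Suc0_iff_eq not_less_eq_eq numeral_2_eq_2)
    ultimately show ?thesis using p D(1) by (metis subsetD)
  qed (use p in simp)
  have "\<exists>X. absorbing X \<and> X \<noteq> V"
    using D(4,2,3) D2 max
  proof (cases rule: module_cases)
    case dense
    \<comment> \<open>Every \<open>y\<close> has a successor \<open>t\<close> in \<open>D\<close>,
      so an arc from \<open>x\<close> to \<open>s\<close> gives one from \<open>h x y\<close> to
      \<open>h s t = s\<close>. The in-neighbourhood of \<open>s\<close> is thus absorbing, and it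
      omits \<open>s\<close>.\<close>
    obtain s where s: "s \<in> D" "s \<in> V" using D(3,4) unfolding strong_def by blast
    have "h x y \<in> R\<inverse> `` {s}" if xy: "(x, s) \<in> R" "y \<in> V" for x y
    proof -
      obtain t where "t \<in> D" "(y, t) \<in> R" using dense(2) xy(2) by blast
      then show ?thesis using h_R[OF xy(1)] pD s(1) by fastforce
    qed
    then have "absorbing (R\<inverse> `` {s})" using V_pred[OF s(2)] R_V unfolding absorbing_def by blast
    moreover have "R\<inverse> `` {s} \<noteq> V" using s(2) irrefl by blast
    ultimately show ?thesis by blast
  next
    case (module A B)
    have DV: "D \<subseteq> V" using D(4) by blast
    have inA: "h a y \<in> A" if a: "a \<in> A" and y: "y \<in> A \<union> D" for a y
    proof -
      have "(h a y, s) \<in> R" if s: "s \<in> D" for s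
      proof -
        obtain t where "t \<in> D" "(y, t) \<in> R" using y strong_succ[OF D(3) D2] module(7)[OF _ s] s by blast
        then show ?thesis using h_R[of a s y t] module(7)[OF a s] pD s by auto
      qed
      moreover have "h a y \<in> V" using h_V a y module(1) by blast
      moreover obtain s where "s \<in> D" using D(3) unfolding strong_def by blast
      ultimately show ?thesis using module(1,8) irrefl by blast
    qed
    \<comment> \<open>Every \<open>y\<close> has a successor in \<open>A \<union> D\<close>, for
      which \<open>inA\<close> applies. The resulting absorbing set is proper, as \<open>D\<close>
      has no arcs to \<open>A\<close>.\<close>
    have "h x y \<in> R\<inverse> `` A" if xy: "x \<in> R\<inverse> `` A" "y \<in> V" for x y
    proof -
      obtain a where a: "a \<in> A" "(x, a) \<in> R" using xy(1) by blast
      obtain s where s: "s \<in> D" using D(3) unfolding strong_def by blast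
      have "\<exists>y'\<in>A \<union> D. (y, y') \<in> R"
        using xy(2) module(1) module(7)[OF _ s] module(9) strong_succ[OF D(3) D2] s by blast
      then obtain y' where "y' \<in> A \<union> D" "(y, y') \<in> R" by blast
      then show ?thesis using h_R[OF a(2)] inA[OF a(1)] by blast
    qed
    moreover have "R\<inverse> `` A \<noteq> {}" using module(6,9) by blast
    ultimately have "absorbing (R\<inverse> `` A)" using R_V unfolding absorbing_def by blast
    moreover have "R\<inverse> `` A \<noteq> V" using module(7) D(3) DV unfolding strong_def by blast
    ultimately show ?thesis by blast
  qed
  then show ?thesis using absorbing_imp_projection by blast
qed

end

section \<open>Closed strong sets of a binary nonprojection\<close>

locale nonprojection = binary_polymorphism +
  assumes not_proj1: "\<not> (\<forall>x\<in>V. \<forall>y\<in>V. h x y = x)" and not_proj2: "\<not> (\<forall>x\<in>V. \<forall>y\<in>V. h x y = y)"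
begin

lemma flip_nonprojection: "nonprojection V R (\<lambda>x y. h y x)"
proof -
  interpret f: binary_polymorphism V R "\<lambda>x y. h y x" by (rule flip)
  show ?thesis by unfold_locales (use not_proj1 not_proj2 in blast)+
qed

text \<open>A projection on \<open>S\<close> would extend to \<open>V\<close>, the second one by
  symmetry; so \<open>IH\<close> leaves only cycles.\<close>

lemma proper_strong:
  assumes S: "S \<subset> V" "closed S" "strong R S" "2 \<le> card S"
  shows "\<not> (\<forall>x\<in>S. \<forall>y\<in>S. h x y = x)" "\<not> (\<forall>x\<in>S. \<forall>y\<in>S. h x y = y)" "\<not> branching R S"
proof -
  show 1: "\<not> (\<forall>x\<in>S. \<forall>y\<in>S. h x y = x)" using projection_extends[OF S] not_proj1 by blast
  interpret f: nonprojection V R "\<lambda>x y. h y x" by (rule flip_nonprojection)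
  have "f.closed S" using S(2) unfolding f.closed_def closed_def by blast
  then show 2: "\<not> (\<forall>x\<in>S. \<forall>y\<in>S. h x y = y)" using f.projection_extends[OF S(1) _ S(3,4)] not_proj2 by blast
  show "\<not> branching R S" using IH[OF S(1) _ S(3)] S(2) 1 2 unfolding closed_def by blast
qed

text \<open>A constant row has the value \<open>h i i = i\<close>. As \<open>h\<close> commutes with
  the rotation \<sigma> of the cycle \<open>S\<close>, all rows would be constant and
  \<open>h\<close> the first projection on \<open>S\<close>.\<close>

lemma rows_not_constant:
  assumes S: "S \<subset> V" "closed S" "strong R S" "2 \<le> card S" and i: "i \<in> S"
  shows "\<exists>j\<in>S. \<exists>k\<in>S. h i j \<noteq> h i k"
proof (rule ccontr)
  assume const: "\<not> ?thesis"
  obtain \<sigma> where sig: "bij_betw \<sigma> S S" "\<forall>x\<in>S. \<forall>y\<in>S. (x, y) \<in> R \<longleftrightarrow> y = \<sigma> x"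
    using nonbranching_cycle[OF _ S(3,4) proper_strong(3)[OF S]] S(1) by blast
  have sS: "\<sigma> x \<in> S" if "x \<in> S" for x using sig(1) that by (rule bij_betwE[THEN bspec])
  have eqv: "h (\<sigma> x) (\<sigma> y) = \<sigma> (h x y)" if "x \<in> S" "y \<in> S" for x y
  proof -
    have "(h x y, h (\<sigma> x) (\<sigma> y)) \<in> R" using h_R sig(2) that sS by blast
    then show ?thesis using sig(2) closedD[OF S(2)] that sS by blast
  qed
  define G where "G = {i \<in> S. \<forall>j\<in>S. h i j = i}"
  have "h i i = i" using h_idem i S(1) by blast
  then have "\<forall>j\<in>S. h i j = i" using const i by metis
  then have iG: "i \<in> G" using i unfolding G_def by blast
  have step: "\<sigma> x \<in> G" if x: "x \<in> G" for x
  proof -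
    have "h (\<sigma> x) j = \<sigma> x" if j: "j \<in> S" for j
    proof -
      obtain k where "k \<in> S" "j = \<sigma> k" using sig(1) j unfolding bij_betw_def by blast
      then show ?thesis using eqv x unfolding G_def by auto
    qed
    then show ?thesis using x sS unfolding G_def by blast
  qed
  have "G = S"
  proof (rule ccontr)
    assume "G \<noteq> S"
    moreover have GS: "G \<subseteq> S" "G \<noteq> {}" using iG unfolding G_def by auto
    ultimately obtain u v where uv: "u \<in> G" "v \<in> S - G" "(u, v) \<in> R"
      using strong_leaves[OF S(3)] by metis
    then have "v = \<sigma> u" using sig(2) GS(1) by blast
    then show False using step[OF uv(1)] uv(2) by blast
  qed
  then show False using proper_strong(1)[OF S] unfolding G_def by blast
qed

end

context nonprojection
begin

lemma columns_not_constant: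
  assumes "S \<subset> V" "closed S" "strong R S" "2 \<le> card S" "i \<in> S"
  shows "\<exists>j\<in>S. \<exists>k\<in>S. h j i \<noteq> h k i"
proof -
  interpret f: nonprojection V R "\<lambda>x y. h y x" by (rule flip_nonprojection)
  have "f.closed S" using assms(2) unfolding f.closed_def closed_def by blast
  then show ?thesis using f.rows_not_constant assms by blast
qed

text \<open>\<open>C\<close> is maximal, since a larger closed strong set would be branching. If it
  were a module, \<open>A \<union> B\<close> would be a proper absorbing set: for \<open>a\<close>
  in \<open>A\<close> and \<open>i\<close> in \<open>C\<close>, the value \<open>h a i\<close> has
  two different out-neighbours in the cycle \<open>C\<close>, so it lies in \<open>A\<close>; dually
  for \<open>B\<close>.\<close>

lemma proper_strong_dense:
  assumes C: "C \<subset> V" "closed C" "strong R C" "2 \<le> card C"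
  shows "R `` C = V \<and> R\<inverse> `` C = V"
proof -
  have "E = V" if "closed E" "strong R E" "C \<subset> E" "E \<subseteq> V" for E
  proof (rule ccontr)
    assume "E \<noteq> V"
    then have E: "E \<subset> V" using that by blast
    have fin: "finite E" using E finite_V finite_subset by blast
    have "card C \<le> card E" by (rule card_mono[OF fin]) (use that in blast)
    then have "\<not> branching R E" using proper_strong(3)[OF E that(1,2)] C(4) by simp
    then show False using strong_subset_branching[OF C(3,4) that(2,3)] by simp
  qed
  then have max: "\<forall>E. closed E \<longrightarrow> strong R E \<longrightarrow> C \<subset> E \<longrightarrow> E \<subseteq> V \<longrightarrow> E = V" by blast
  have CV: "C \<subseteq> V" using C(1) by blast
  show ?thesis
    using C max
  proof (cases rule: module_cases)
    case (module A B)
    obtain c where c: "c \<in> C" using C(3) unfolding strong_def by blast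
    have nb: "\<not> branching R C" by (rule proper_strong(3)[OF C])
    then have nb': "\<not> branching (R\<inverse>) C"
      using semicomplete_rel.branching_converse[OF converse CV] C(3) by auto
    have V: "a \<in> V" if "a \<in> A \<union> B" for a using that module(1) by blast
    have AC: "h a i \<in> A" if a: "a \<in> A" and i: "i \<in> C" for a i
    proof -
      obtain j where j: "j \<in> C" "(i, j) \<in> R" using strong_succ[OF C(3,4) i] by blast
      have arc: "(h a i, h k j) \<in> R" if "k \<in> C" for k using h_R module(7)[OF a that] j(2) by blast
      obtain k l where kl: "k \<in> C" "l \<in> C" "h k j \<noteq> h l j" using columns_not_constant[OF C j(1)] by blast
      have m: "h k j \<in> C" "h l j \<in> C" using closedD[OF C(2)] kl j(1) by auto
      have "h a i \<notin> C" using nb arc[OF kl(1)] arc[OF kl(2)] m kl(3) unfolding branching_def by blast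
      moreover have "h a i \<notin> B" using module(8) arc[OF kl(1)] m(1) by blast
      moreover have "h a i \<in> V" using h_V V a i CV by blast
      ultimately show ?thesis using module(1) by blast
    qed
    have BC: "h b i \<in> B" if b: "b \<in> B" and i: "i \<in> C" for b i
    proof -
      obtain j where j: "j \<in> C" "(j, i) \<in> R" using strong_pred[OF C(3,4) i] by blast
      have arc: "(h k j, h b i) \<in> R" if "k \<in> C" for k using h_R module(8)[OF b that] j(2) by blast
      obtain k l where kl: "k \<in> C" "l \<in> C" "h k j \<noteq> h l j" using columns_not_constant[OF C j(1)] by blast
      have m: "h k j \<in> C" "h l j \<in> C" using closedD[OF C(2)] kl j(1) by auto
      have "h b i \<notin> C" using nb' arc[OF kl(1)] arc[OF kl(2)] m kl(3) unfolding branching_def by blast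
      moreover have "h b i \<notin> A" using module(7) arc[OF kl(1)] m(1) by blast
      moreover have "h b i \<in> V" using h_V V b i CV by blast
      ultimately show ?thesis using module(1) by blast
    qed
    have CB: "h i b \<in> B" if b: "b \<in> B" and i: "i \<in> C" for b i
    proof -
      obtain j where j: "j \<in> C" "(j, i) \<in> R" using strong_pred[OF C(3,4) i] by blast
      have arc: "(h j k, h i b) \<in> R" if "k \<in> C" for k using h_R module(8)[OF b that] j(2) by blast
      obtain k l where kl: "k \<in> C" "l \<in> C" "h j k \<noteq> h j l" using rows_not_constant[OF C j(1)] by blast
      have m: "h j k \<in> C" "h j l \<in> C" using closedD[OF C(2)] kl j(1) by auto
      have "h i b \<notin> C" using nb' arc[OF kl(1)] arc[OF kl(2)] m kl(3) unfolding branching_def by blast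
      moreover have "h i b \<notin> A" using module(7) arc[OF kl(1)] m(1) by blast
      moreover have "h i b \<in> V" using h_V V b i CV by blast
      ultimately show ?thesis using module(1) by blast
    qed
    \<comment> \<open>Arguments on the same side of \<open>C\<close> give a loop at the value. For
      mixed ones, the argument in \<open>A\<close> has an in-neighbour \<open>b\<close> in
      \<open>B\<close> and the other has the in-neighbour \<open>c\<close>; the value of
      \<open>h\<close> there lies in \<open>B\<close>, which has no arcs to
      \<open>C\<close>.\<close>
    have notC: "h x y \<notin> C" if xy: "x \<in> A \<union> B" "y \<in> A \<union> B" for x y
    proof
      assume hC: "h x y \<in> C"
      note m7 = module(7) note m8 = module(8)
      from xy consider "x \<in> A" "y \<in> A" | "x \<in> B" "y \<in> B" | "x \<in> A" "y \<in> B" | "x \<in> B" "y \<in> A" by blast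
      then show False
      proof cases
        case 1
        then have "(h x y, h (h x y) (h x y)) \<in> R" using m7 hC h_R by blast
        then show ?thesis using h_idem hC CV irrefl by auto
      next
        case 2
        then have "(h (h x y) (h x y), h x y) \<in> R" using m8 hC h_R by blast
        then show ?thesis using h_idem hC CV irrefl by auto
      next
        case 3
        obtain b where b: "b \<in> B" "(b, x) \<in> R" using module(10)[OF 3(1)] by blast
        have "(h b c, h x y) \<in> R" using h_R[OF b(2)] m8[OF 3(2) c] by blast
        then show ?thesis using m8[OF BC[OF b(1) c] hC] by blast
      next
        case 4
        obtain b where b: "b \<in> B" "(b, y) \<in> R" using module(10)[OF 4(2)] by blast
        have "(h c b, h x y) \<in> R" using h_R[OF _ b(2)] m8[OF 4(1) c] by blast
        then show ?thesis using m8[OF CB[OF b(1) c] hC] by blast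
      qed
    qed
    have "h x y \<in> A \<union> B" if x: "x \<in> A \<union> B" and y: "y \<in> V" for x y
    proof (cases "y \<in> C")
      case True
      then show ?thesis using x AC BC by blast
    next
      case False
      then have y': "y \<in> A \<union> B" using y module(1) by blast
      have "h x y \<in> V" using h_V V x y by blast
      then show ?thesis using notC[OF x y'] module(1) by blast
    qed
    then have "absorbing (A \<union> B)" using V module(5) unfolding absorbing_def by blast
    moreover have "A \<union> B \<noteq> V" using c CV module(3,4) by blast
    ultimately show ?thesis using absorbing_imp_projection not_proj1 by blast
  qed auto
qed

text \<open>The closed strong component around the 2-cycle is itself a 2-cycle or a 3-cycle. The
  first admits only projections, because there is an arc from \<open>h a b\<close> to
  \<open>h b a\<close>; the second has no opposite arcs.\<close>

lemma no_two_cycle_in_closed: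
  assumes uw: "(u, w) \<in> R" "(w, u) \<in> R" and Z: "closed Z" "Z \<subset> V" "u \<in> Z" "w \<in> Z"
  shows False
proof -
  have ne: "u \<noteq> w" using uw irrefl by blast
  have "strong R {u, w}"
    unfolding strong_def using uw by auto
  then obtain C where C: "{u, w} \<subseteq> C" "C \<subseteq> Z" "strong R C" "closed C"
    using component[of Z "{u, w}"] Z by blast
  have CV: "C \<subset> V" using C(2) Z(2) by blast
  have "card {u, w} \<le> card C"
    by (rule card_mono) (use C(1) CV finite_V finite_subset in auto)
  then have C2: "2 \<le> card C" using ne by simp
  note pr = proper_strong[OF CV C(4,3) C2]
  have "C \<subseteq> V" using CV by blast
  from this C(3) C2 pr(3) show False
  proof (cases rule: nonbranching_cases)
    case (two a b)
    have "(a, b) \<in> R" "(b, a) \<in> R" using two(3) by auto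
    then have "(h a b, h b a) \<in> R" by (rule h_R)
    then have "h a b \<noteq> h b a" using irrefl by metis
    moreover have "h a b \<in> {a, b}" "h b a \<in> {a, b}" using closedD[OF C(4)] two(2) by auto
    moreover have "h a a = a" "h b b = b" using h_idem two(2) CV by auto
    ultimately show False using pr(1,2) two(2) by auto
  next
    case (three a b c)
    have "(u, w) \<in> R \<inter> C \<times> C" "(w, u) \<in> R \<inter> C \<times> C" using uw C(1) by auto
    then show False unfolding three(5) using three(1-3) by auto
  qed
qed

lemma closed_neighbours: "x \<in> V \<Longrightarrow> closed (R `` {x})" "x \<in> V \<Longrightarrow> closed (R\<inverse> `` {x})"
  using P_sing P_succ[of "{x}"] P_pred[of "{x}"] by auto

text \<open>Both neighbourhoods of \<open>x\<close> are closed and omit \<open>x\<close>, so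
  \<open>no_two_cycle_in_closed\<close> applies to them.\<close>

lemma no_two_cycle_common:
  assumes "(u, w) \<in> R" "(w, u) \<in> R"
  shows "\<not> ((x, u) \<in> R \<and> (x, w) \<in> R)" "\<not> ((u, x) \<in> R \<and> (w, x) \<in> R)"
proof -
  show "\<not> ((x, u) \<in> R \<and> (x, w) \<in> R)"
  proof
    assume x: "(x, u) \<in> R \<and> (x, w) \<in> R"
    then have xV: "x \<in> V" using R_V by blast
    then have "R `` {x} \<subset> V" using R_V irrefl by blast
    then show False using no_two_cycle_in_closed[OF assms closed_neighbours(1)[OF xV]] x by blast
  qed
  show "\<not> ((u, x) \<in> R \<and> (w, x) \<in> R)"
  proof
    assume x: "(u, x) \<in> R \<and> (w, x) \<in> R"
    then have xV: "x \<in> V" using R_V by blast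
    then have "R\<inverse> `` {x} \<subset> V" using R_V irrefl by blast
    then show False using no_two_cycle_in_closed[OF assms closed_neighbours(2)[OF xV]] x by blast
  qed
qed

text \<open>Every vertex has an in-neighbour in \<open>?Y\<close>, since the out-neighbourhood of
  \<open>?Y\<close> is closed and contains the 2-cycle. So \<open>?Y\<close> has no source and
  contains a nontrivial closed strong \<open>C\<close>. By density some \<open>c\<close> in
  \<open>C\<close> has an arc back to \<open>w\<close>; its adjacency with \<open>u\<close>, or a
  successor of \<open>u\<close> in \<open>C\<close> if \<open>c = u\<close>, contradicts
  \<open>no_two_cycle_common\<close>.\<close>

lemma no_two_cycle_via:
  assumes uw: "(u, w) \<in> R" "(w, u) \<in> R" and x: "(w, x) \<in> R" "(x, u) \<in> R"
  shows False
proof -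
  have V: "u \<in> V" "w \<in> V" using uw R_V by auto
  let ?Y = "R `` {w}"
  have YV: "?Y \<subset> V" "closed ?Y" using V closed_neighbours R_V irrefl by blast+
  have cl: "closed (R `` ?Y)" "R `` ?Y \<subseteq> V" using P_succ[of ?Y] YV R_V by auto
  have "u \<in> R `` ?Y" "w \<in> R `` ?Y" using uw x by auto
  then have all: "R `` ?Y = V" using no_two_cycle_in_closed[OF uw cl(1)] cl(2) by blast
  have fin: "finite ?Y" using YV(1) finite_V finite_subset by blast
  have src: "\<exists>z\<in>?Y. (z, y) \<in> R" if "y \<in> ?Y" for y
  proof -
    have "y \<in> R `` ?Y" using that YV(1) all by blast
    then show ?thesis by blast
  qed
  have "?Y \<noteq> {}" using x by blast
  then obtain C0 where C0: "C0 \<subseteq> ?Y" "strong R C0" "2 \<le> card C0"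
    using no_source_strong[OF fin _ src irrefl] by metis
  then obtain C where C: "C0 \<subseteq> C" "C \<subseteq> ?Y" "strong R C" "closed C"
    using component[of ?Y C0] YV by blast
  have CV: "C \<subset> V" using C(2) YV(1) by blast
  have "card C0 \<le> card C" by (rule card_mono[OF finite_subset[OF C(2) fin] C(1)])
  then have C2: "2 \<le> card C" using C0(3) by simp
  have "R `` C = V" using proper_strong_dense[OF CV C(4,3) C2] by blast
  then obtain c where c: "c \<in> C" "(c, w) \<in> R" using V by blast
  have wc: "(w, c) \<in> R" using c C(2) by blast
  show False
  proof (cases "c = u")
    case False
    have "(u, c) \<in> R \<or> (c, u) \<in> R" using total[OF V(1)] False R_V(1)[OF c(2)] by blast
    then show False using no_two_cycle_common[OF uw] c(2) wc by blast
  next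
    case True
    obtain d where "d \<in> C" "(u, d) \<in> R" using strong_succ[OF C(3) C2 c(1)] True by blast
    then show False using no_two_cycle_common(2)[OF uw] C(2) by blast
  qed
qed

lemma no_two_cycle:
  assumes uw: "(u, w) \<in> R" "(w, u) \<in> R"
  shows False
proof -
  have V: "u \<in> V" "w \<in> V" using uw R_V by auto
  have "V \<noteq> {u, w}"
  proof
    assume eq: "V = {u, w}"
    obtain v x y where v: "v \<in> V" "x \<in> V" "y \<in> V" "x \<noteq> y" "(v, x) \<in> R" "(v, y) \<in> R"
      using branching_V unfolding branching_def by blast
    have "v \<noteq> x" "v \<noteq> y" using v irrefl by auto
    then show False using v(1-4) unfolding eq by auto
  qed
  then obtain x where x: "x \<in> V" "x \<noteq> u" "x \<noteq> w" using V by blast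
  have "(x, u) \<in> R \<or> (u, x) \<in> R" "(x, w) \<in> R \<or> (w, x) \<in> R" using total x V by metis+
  then show False using no_two_cycle_common[OF uw] no_two_cycle_via[OF uw] no_two_cycle_via[OF uw(2,1)] by blast
qed

text \<open>Here \<open>v\<close> bypasses the arc from \<open>p\<close> to \<open>q\<close>. One of
  its neighbourhoods meets \<open>C\<close> in \<open>{q, r}\<close> or \<open>{p, r}\<close>, which
  is therefore closed, and this forces \<open>h p q\<close> and \<open>h q p\<close> into
  \<open>{p, q}\<close>. They differ, so \<open>h\<close> is a projection on \<open>{p, q}\<close>,
  and rotation extends it to \<open>C\<close>.\<close>

lemma no_three_cycle:
  assumes C: "C \<subset> V" "closed C" "strong R C" "2 \<le> card C"
    and pqr: "C = {p, q, r}" "p \<noteq> q" "q \<noteq> r" "p \<noteq> r" "R \<inter> C \<times> C = {(p, q), (q, r), (r, p)}"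
    and v: "v \<in> V - C" "(p, v) \<in> R" "(v, q) \<in> R"
  shows False
proof -
  have arcs: "(p, q) \<in> R" "(q, r) \<in> R" "(r, p) \<in> R" using pqr(5) by auto
  have un: "y = q" if "(p, y) \<in> R" "y \<in> C" for y
  proof -
    have "(p, y) \<in> R \<inter> C \<times> C" using that pqr(1) by auto
    then show ?thesis unfolding pqr(5) using pqr by auto
  qed
  have un2: "y = r" if "(q, y) \<in> R" "y \<in> C" for y
  proof -
    have "(q, y) \<in> R \<inter> C \<times> C" using that pqr(1) by auto
    then show ?thesis unfolding pqr(5) using pqr by auto
  qed
  have un3: "y = p" if "(r, y) \<in> R" "y \<in> C" for y
  proof -
    have "(r, y) \<in> R \<inter> C \<times> C" using that pqr(1) by auto
    then show ?thesis unfolding pqr(5) using pqr by auto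
  qed
  have mem: "h x y \<in> {p, q, r}" if "x \<in> {p, q, r}" "y \<in> {p, q, r}" for x y
    using closedD[OF C(2)] that unfolding pqr(1) by blast
  have rot: "(h p q, h q r) \<in> R" "(h q r, h r p) \<in> R" "(h r p, h p q) \<in> R"
      "(h q p, h r q) \<in> R" "(h r q, h p r) \<in> R" "(h p r, h q p) \<in> R"
    using h_R arcs by blast+
  have V: "p \<in> V" "q \<in> V" "r \<in> V" "v \<in> V" using C(1) v pqr(1) by auto
  have idem: "h p p = p" "h q q = q" "h r r = r" using h_idem V by auto
  have "v \<noteq> r" using v(1) pqr(1) by blast
  have "h p q \<in> {p, q} \<and> h q p \<in> {p, q}"
  proof -
    consider "(v, r) \<in> R" | "(r, v) \<in> R" using total[OF V(4,3) \<open>v \<noteq> r\<close>] by blast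
    then show ?thesis
    proof cases
      case 1
      have "R `` {v} \<inter> C = {q, r}" using no_two_cycle[OF v(2)] v(3) 1 pqr(1) by auto
      then have "closed {q, r}" using P_Int[OF closed_neighbours(1)[OF V(4)] C(2)] by simp
      then have "h q r \<in> {q, r}" "h r q \<in> {q, r}" using closedD by auto
      then show ?thesis using rot mem[of p q] mem[of q p] un un2 un3 pqr by (smt (verit) insert_iff singletonD)
    next
      case 2
      have "R\<inverse> `` {v} \<inter> C = {p, r}" using no_two_cycle[OF _ v(3)] v(2) 2 pqr(1) by auto
      then have "closed {p, r}" using P_Int[OF closed_neighbours(2)[OF V(4)] C(2)] by simp
      then have "h p r \<in> {p, r}" "h r p \<in> {p, r}" using closedD by auto
      then show ?thesis using rot mem[of p q] mem[of q p] un un2 un3 pqr by (smt (verit) insert_iff singletonD)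
    qed
  qed
  \<comment> \<open>The walks \<open>q\<close>, \<open>r\<close>, \<open>p\<close> and
    \<open>p\<close>, \<open>v\<close>, \<open>q\<close> in the two arguments lead from
    \<open>h q p\<close> over \<open>h r v\<close> to \<open>h p q\<close>; equality would make this
    a 2-cycle.\<close>
  moreover have "h p q \<noteq> h q p"
  proof
    assume eq: "h p q = h q p"
    have "(h q p, h r v) \<in> R" using h_R[OF arcs(2) v(2)] .
    moreover have "(h r v, h p q) \<in> R" using h_R[OF arcs(3) v(3)] .
    ultimately show False using no_two_cycle eq by metis
  qed
  ultimately have "(h p q = p \<and> h q p = q) \<or> (h p q = q \<and> h q p = p)" by auto
  then show False
  proof
    assume 1: "h p q = p \<and> h q p = q"
    have "(p, h q r) \<in> R" using rot(1) 1 by simp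
    then have a: "h q r = q" by (rule un) (use mem pqr(1) in auto)
    have "(q, h r p) \<in> R" using rot(2) a by simp
    then have b: "h r p = r" by (rule un2) (use mem pqr(1) in auto)
    have "(q, h r q) \<in> R" using rot(4) 1 by simp
    then have c: "h r q = r" by (rule un2) (use mem pqr(1) in auto)
    have "(r, h p r) \<in> R" using rot(5) c by simp
    then have d: "h p r = p" by (rule un3) (use mem pqr(1) in auto)
    show False using proper_strong(1)[OF C] 1 a b c d idem unfolding pqr(1) by auto
  next
    assume 1: "h p q = q \<and> h q p = p"
    have "(q, h q r) \<in> R" using rot(1) 1 by simp
    then have a: "h q r = r" by (rule un2) (use mem pqr(1) in auto)
    have "(r, h r p) \<in> R" using rot(2) a by simp
    then have b: "h r p = p" by (rule un3) (use mem pqr(1) in auto)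
    have "(p, h r q) \<in> R" using rot(4) 1 by simp
    then have c: "h r q = q" by (rule un) (use mem pqr(1) in auto)
    have "(q, h p r) \<in> R" using rot(5) c by simp
    then have d: "h p r = r" by (rule un2) (use mem pqr(1) in auto)
    show False using proper_strong(2)[OF C] 1 a b c d idem unfolding pqr(1) by auto
  qed
qed

lemma contradiction: False
proof -
  obtain C where C: "closed C" "strong R C" "2 \<le> card C" "C \<subset> V"
    by (rule proper_strong_exists)
  note C' = C(4,1,2,3)
  have CV: "C \<subseteq> V" using C by blast
  have dense: "R `` C = V" "R\<inverse> `` C = V" using proper_strong_dense[OF C'] by auto
  from CV C(2,3) proper_strong(3)[OF C'] show False
  proof (cases rule: nonbranching_cases)
    case (two a b)
    then have "(a, b) \<in> R" "(b, a) \<in> R" by auto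
    then show False by (rule no_two_cycle)
  next
    case (three a b c)
    obtain v where v: "v \<in> V - C" using C by blast
    then have "v \<in> R `` C" "v \<in> R\<inverse> `` C" using dense by auto
    then have io: "(a, v) \<in> R \<or> (b, v) \<in> R \<or> (c, v) \<in> R" "(v, a) \<in> R \<or> (v, b) \<in> R \<or> (v, c) \<in> R"
      using three(4) by auto
    have tot: "(a, v) \<in> R \<or> (v, a) \<in> R" "(b, v) \<in> R \<or> (v, b) \<in> R" "(c, v) \<in> R \<or> (v, c) \<in> R"
      using total v three(4) CV by blast+
    \<comment> \<open>Since \<open>v\<close> has arcs from \<open>C\<close> and to \<open>C\<close>,
      somewhere along the cycle a vertex with an arc to \<open>v\<close> is followed by one with an
      arc from \<open>v\<close>.\<close>
    have "((a, v) \<in> R \<and> (v, b) \<in> R) \<or> ((b, v) \<in> R \<and> (v, c) \<in> R) \<or> ((c, v) \<in> R \<and> (v, a) \<in> R)"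
      using io tot by blast
    then show False
    proof (elim disjE conjE)
      assume "(a, v) \<in> R" "(v, b) \<in> R"
      then show False using no_three_cycle[OF C' three(4) three(1-3,5) v] by blast
    next
      assume *: "(b, v) \<in> R" "(v, c) \<in> R"
      show False by (rule no_three_cycle[OF C', of b c a v]) (use three v * in auto)
    next
      assume *: "(c, v) \<in> R" "(v, a) \<in> R"
      show False by (rule no_three_cycle[OF C', of c a b v]) (use three v * in auto)
    qed
  qed
qed

end

theorem binary_polymorphism_projection:
  assumes "semicomplete_rel V R" "strong R V" "branching R V"
    and "\<And>x y. x \<in> V \<Longrightarrow> y \<in> V \<Longrightarrow> h x y \<in> V"
    and "\<And>x x' y y'. (x, x') \<in> R \<Longrightarrow> (y, y') \<in> R \<Longrightarrow> (h x y, h x' y') \<in> R"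
    and "\<And>x. x \<in> V \<Longrightarrow> h x x = x"
  shows "(\<forall>x\<in>V. \<forall>y\<in>V. h x y = x) \<or> (\<forall>x\<in>V. \<forall>y\<in>V. h x y = y)"
  using assms
proof (induction "card V" arbitrary: V R rule: less_induct)
  case less
  interpret semicomplete_rel V R by (rule less.prems(1))
  have IH: "(\<forall>x\<in>S. \<forall>y\<in>S. h x y = x) \<or> (\<forall>x\<in>S. \<forall>y\<in>S. h x y = y)"
    if S: "S \<subset> V" "\<forall>x\<in>S. \<forall>y\<in>S. h x y \<in> S" "strong R S" "branching R S" for S
  proof (rule less.hyps[of S "R \<inter> S \<times> S"])
    show "card S < card V" using S(1) finite_V by (rule psubset_card_mono[rotated])
    show "semicomplete_rel S (R \<inter> S \<times> S)" using S(1) by (intro restrict) blast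
    show "(h x y, h x' y') \<in> R \<inter> S \<times> S" if "(x, x') \<in> R \<inter> S \<times> S" "(y, y') \<in> R \<inter> S \<times> S" for x x' y y'
      using that S(2) less.prems(5) by auto
  qed (use S less.prems(6) in auto)
  interpret binary_polymorphism V R h
    by unfold_locales (use less.prems IH in auto)
  show ?case
  proof (rule ccontr)
    assume "\<not> ?case"
    then interpret nonprojection V R h by unfold_locales auto
    show False by (rule contradiction)
  qed
qed

section \<open>Majority operations and polymorphisms of higher arity\<close>

locale majority_polymorphism = strong_branching +
  fixes m :: "'a \<Rightarrow> 'a \<Rightarrow> 'a \<Rightarrow> 'a"
  assumes m_V: "x \<in> V \<Longrightarrow> y \<in> V \<Longrightarrow> z \<in> V \<Longrightarrow> m x y z \<in> V"
    and m_R: "(x, x') \<in> R \<Longrightarrow> (y, y') \<in> R \<Longrightarrow> (z, z') \<in> R \<Longrightarrow> (m x y z, m x' y' z') \<in> R"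
    and m_maj: "x \<in> V \<Longrightarrow> y \<in> V \<Longrightarrow> m x x y = x \<and> m x y x = x \<and> m y x x = x"
    and IH: "S \<subset> V \<Longrightarrow> \<forall>x\<in>S. \<forall>y\<in>S. \<forall>z\<in>S. m x y z \<in> S \<Longrightarrow> strong R S \<Longrightarrow> branching R S \<Longrightarrow> False"
begin

text \<open>Singletons are absorbing by the majority law. The notion is chosen for
  \<open>helly\<close>: three absorbing subsets of \<open>V\<close> that meet pairwise have a common
  point.\<close>

definition absorbing :: "'a set \<Rightarrow> bool" where
  "absorbing X \<longleftrightarrow> (\<forall>x\<in>X. \<forall>y\<in>X. \<forall>v\<in>V. m x y v \<in> X \<and> m x v y \<in> X \<and> m v x y \<in> X)"

lemma absorbingD:
  assumes "absorbing X" "x \<in> X" "y \<in> X" "v \<in> V"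
  shows "m x y v \<in> X" "m x v y \<in> X" "m v x y \<in> X"
  using assms unfolding absorbing_def by auto

sublocale definable_family V R absorbing
proof
  show "absorbing {v}" if "v \<in> V" for v
    using m_maj that unfolding absorbing_def by auto
  show "absorbing (X \<inter> Y)" if "absorbing X" "absorbing Y" for X Y
    using that unfolding absorbing_def by blast
  show "absorbing (R `` X)" if X: "absorbing X" for X
    unfolding absorbing_def
  proof (intro ballI)
    fix x y v assume "x \<in> R `` X" "y \<in> R `` X" "v \<in> V"
    then obtain x' y' v' where p: "x' \<in> X" "(x', x) \<in> R" "y' \<in> X" "(y', y) \<in> R" "v' \<in> V" "(v', v) \<in> R"
      using V_pred by blast
    then show "m x y v \<in> R `` X \<and> m x v y \<in> R `` X \<and> m v x y \<in> R `` X"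
      using m_R absorbingD[OF X p(1,3,5)] by blast
  qed
  show "absorbing (R\<inverse> `` X)" if X: "absorbing X" for X
    unfolding absorbing_def
  proof (intro ballI)
    fix x y v assume "x \<in> R\<inverse> `` X" "y \<in> R\<inverse> `` X" "v \<in> V"
    then obtain x' y' v' where p: "x' \<in> X" "(x, x') \<in> R" "y' \<in> X" "(y, y') \<in> R" "v' \<in> V" "(v, v') \<in> R"
      using V_succ by blast
    then show "m x y v \<in> R\<inverse> `` X \<and> m x v y \<in> R\<inverse> `` X \<and> m v x y \<in> R\<inverse> `` X"
      using m_R absorbingD[OF X p(1,3,5)] by blast
  qed
  show "absorbing C" if Z: "Z \<subseteq> V" "absorbing Z" "C \<subseteq> Z" "strong R C"
    and nz: "\<And>z c d. z \<in> Z - C \<Longrightarrow> c \<in> C \<Longrightarrow> d \<in> C \<Longrightarrow> (z, c) \<in> R \<Longrightarrow> (d, z) \<in> R \<Longrightarrow> False" for Z C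
    unfolding absorbing_def
  proof (intro ballI)
    fix a b v assume ab: "a \<in> C" "b \<in> C" and v: "v \<in> V"
    have V: "a \<in> V" "b \<in> V" using ab Z by auto
    have side: "((z, a) \<in> R \<and> (z, b) \<in> R) \<or> ((a, z) \<in> R \<and> (b, z) \<in> R)" if z: "z \<in> Z - C" for z
    proof -
      have "z \<in> V" "z \<noteq> a" "z \<noteq> b" using z ab Z by auto
      then show ?thesis using nz[OF z ab] nz[OF z ab(2,1)] total[of z a] total[of z b] V by blast
    qed
    obtain p s where ps: "p \<in> V" "(p, v) \<in> R" "s \<in> V" "(v, s) \<in> R" using V_pred[OF v] V_succ[OF v] by blast
    have ab': "a \<in> Z" "b \<in> Z" using ab Z(3) by auto
    note abs = absorbingD[OF Z(2) ab' v]
    have "z \<in> C" if z: "z \<in> Z" "z = m a b v \<or> z = m a v b \<or> z = m v a b" for z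
    proof (rule ccontr)
      assume "z \<notin> C"
      then have zZ: "z \<in> Z - C" using z by blast
      have zV: "z \<in> V" using z(1) Z(1) by blast
      note maj = m_maj[OF zV ps(1)] m_maj[OF zV ps(3)]
      \<comment> \<open>The argument \<open>v\<close> is moved along an arc to \<open>p\<close> or
        \<open>s\<close>, the other two arguments to \<open>z\<close>; majority then returns
        \<open>z\<close> at the far end.\<close>
      from side[OF zZ] have "(z, z) \<in> R"
      proof
        assume "(z, a) \<in> R \<and> (z, b) \<in> R"
        then have "(m z z p, m a b v) \<in> R" "(m z p z, m a v b) \<in> R" "(m p z z, m v a b) \<in> R"
          using m_R ps(2) by blast+
        then show ?thesis using z(2) maj(1) by metis
      next
        assume "(a, z) \<in> R \<and> (b, z) \<in> R"
        then have "(m a b v, m z z s) \<in> R" "(m a v b, m z s z) \<in> R" "(m v a b, m s z z) \<in> R"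
          using m_R ps(4) by blast+
        then show ?thesis using z(2) maj(2) by metis
      qed
      then show False using irrefl by blast
    qed
    then show "m a b v \<in> C \<and> m a v b \<in> C \<and> m v a b \<in> C" using abs by blast
  qed
qed

lemma helly:
  assumes "absorbing X" "absorbing Y" "absorbing Z" "X \<subseteq> V" "Y \<subseteq> V"
    and "a \<in> X \<inter> Y" "b \<in> X \<inter> Z" "c \<in> Y \<inter> Z"
  shows "m a b c \<in> X \<inter> Y \<inter> Z"
  using absorbingD(1)[OF assms(1), of a b c] absorbingD(2)[OF assms(2), of a c b]
    absorbingD(3)[OF assms(3), of b c a] assms by blast

text \<open>\<open>helly\<close> produces two-step walks that cannot exist in the cycle
  \<open>D\<close>.\<close>

lemma contradiction: False
proof -
  obtain C0 where C0: "absorbing C0" "strong R C0" "2 \<le> card C0" "C0 \<subset> V"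
    by (rule proper_strong_exists)
  obtain D where D: "C0 \<subseteq> D" "absorbing D" "strong R D" "D \<subset> V"
    and max: "\<forall>E. absorbing E \<longrightarrow> strong R E \<longrightarrow> D \<subset> E \<longrightarrow> E \<subseteq> V \<longrightarrow> E = V"
    using maximal_strong[OF C0(1,2,4)] by blast
  have fin: "finite D" using D(4) finite_V finite_subset by blast
  have D2: "2 \<le> card D" using card_mono[OF fin D(1)] C0(3) by simp
  have DV: "D \<subseteq> V" using D(4) by blast
  have nb: "\<not> branching R D"
    using IH[OF D(4) _ D(3)] absorbingD(1)[OF D(2)] DV by blast
  obtain \<sigma> where sig: "bij_betw \<sigma> D D" "\<forall>x\<in>D. \<forall>y\<in>D. (x, y) \<in> R \<longleftrightarrow> y = \<sigma> x" "\<forall>x\<in>D. \<sigma> x \<noteq> x"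
    using nonbranching_cycle[OF DV D(3) D2 nb] by blast
  have sD: "\<sigma> x \<in> D" if "x \<in> D" for x using sig(1) that by (rule bij_betwE[THEN bspec])
  have arc: "(x, \<sigma> x) \<in> R" if "x \<in> D" for x using sig(2) sD that by blast
  have inv: "\<exists>y\<in>D. \<sigma> y = x" if "x \<in> D" for x using bij_betw_imp_surj_on[OF sig(1)] that by (metis imageE)
  have nbh: "absorbing (R `` {x})" "absorbing (R\<inverse> `` {x})" "R `` {x} \<subseteq> V" "R\<inverse> `` {x} \<subseteq> V" if "x \<in> V" for x
    using P_sing[OF that] P_succ[of "{x}"] P_pred[of "{x}"] that R_V by auto
  from D(4,2,3) D2 max show False
  proof (cases rule: module_cases)
    case dense
    obtain v where v: "v \<in> V - D" using D(4) by blast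
    have vD: "(x, v) \<in> R \<or> (v, x) \<in> R" if "x \<in> D" for x using total[of x v] v that DV by blast
    \<comment> \<open>Given such \<open>i\<close> and \<open>j\<close>, the out-neighbourhood of
      \<open>i\<close>, the in-neighbourhood of \<open>j\<close> and \<open>D\<close> meet pairwise.
      A common point would lie between \<open>i\<close> and \<open>j\<close> on the cycle, making
      \<open>j\<close> equal to \<open>\<sigma> (\<sigma> i)\<close>.\<close>
    have "\<exists>i\<in>D. \<exists>j\<in>D. (i, v) \<in> R \<and> (v, j) \<in> R \<and> j \<noteq> \<sigma> (\<sigma> i)"
    proof (rule ccontr)
      assume "\<not> ?thesis"
      then have all: "j = \<sigma> (\<sigma> i)" if "i \<in> D" "j \<in> D" "(i, v) \<in> R" "(v, j) \<in> R" for i j using that by blast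
      have "v \<in> R `` D" "v \<in> R\<inverse> `` D" using dense v by auto
      then obtain i j where ij: "i \<in> D" "j \<in> D" "(i, v) \<in> R" "(v, j) \<in> R" by auto
      show False
      proof (cases "(v, \<sigma> i) \<in> R")
        case True
        then show False using all[OF ij(1) sD[OF ij(1)] ij(3)] sig(3) sD ij(1) by metis
      next
        case False
        then have "(\<sigma> i, v) \<in> R" using vD sD ij(1) by blast
        then have "j = \<sigma> (\<sigma> (\<sigma> i))" using all sD ij by blast
        moreover have "j = \<sigma> (\<sigma> i)" using all ij by blast
        ultimately show False using sig(3) ij(2) by metis
      qed
    qed
    then obtain i j where ij: "i \<in> D" "j \<in> D" "(i, v) \<in> R" "(v, j) \<in> R" "j \<noteq> \<sigma> (\<sigma> i)" by blast
    obtain k where k: "k \<in> D" "\<sigma> k = j" using inv ij(2) by blast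
    have V: "i \<in> V" "j \<in> V" using ij DV by auto
    have kj: "(k, j) \<in> R" using arc[OF k(1)] k(2) by simp
    have "m v (\<sigma> i) k \<in> R `` {i} \<inter> R\<inverse> `` {j} \<inter> D"
      by (rule helly[OF nbh(1)[OF V(1)] nbh(2)[OF V(2)] D(2) nbh(3)[OF V(1)] nbh(4)[OF V(2)]])
        (use ij arc sD k(1) kj in auto)
    then obtain z where z: "z \<in> D" "(i, z) \<in> R" "(z, j) \<in> R" by blast
    then show False using sig(2) ij by auto
  next
    case (module A B)
    obtain a where a: "a \<in> A" using module by blast
    obtain b where b: "b \<in> B" using module by blast
    obtain x y where xy: "x \<in> D" "y \<in> D" "x \<noteq> y"
      using D2 fin by (metis card_le_Suc0_iff_eq not_less_eq_eq numeral_2_eq_2)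
    have inj: "inj_on \<sigma> D" using sig(1) by (rule bij_betw_imp_inj_on)
    \<comment> \<open>The three sets below meet pairwise in \<open>x\<close>, \<open>a\<close> and
      \<open>b\<close>. A common point lies between \<open>k\<close> and \<open>\<sigma> x\<close>,
      so it is \<open>x\<close>; but a two-step walk from \<open>d\<close> to \<open>x\<close> would
      stay in \<open>D\<close>, against the choice of \<open>d\<close>.\<close>
    have "\<exists>d\<in>D. \<sigma> (\<sigma> d) \<noteq> x"
    proof (rule ccontr)
      assume "\<not> ?thesis"
      then have "\<sigma> (\<sigma> x) = \<sigma> (\<sigma> y)" using xy by auto
      then show False using inj_onD[OF inj] sD xy by metis
    qed
    then obtain d where d: "d \<in> D" "\<sigma> (\<sigma> d) \<noteq> x" by blast
    obtain k where k: "k \<in> D" "\<sigma> k = x" using inv xy(1) by blast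
    have V: "\<sigma> x \<in> V" "k \<in> V" "d \<in> V" using xy k d sD DV by auto
    let ?Z = "R `` (R `` {d})"
    have Z: "absorbing ?Z" using P_succ nbh V(3) by blast
    obtain b' where b': "b' \<in> B" "(b', a) \<in> R" using module(10)[OF a] by blast
    have "(d, b') \<in> R" using module(8)[OF b'(1) d(1)] by blast
    then have aZ: "a \<in> ?Z" using b'(2) by blast
    have bZ: "b \<in> ?Z" using arc[OF d(1)] module(8)[OF b sD[OF d(1)]] by blast
    have kx: "(k, x) \<in> R" using arc[OF k(1)] k(2) by simp
    have "m x a b \<in> R\<inverse> `` {\<sigma> x} \<inter> R `` {k} \<inter> ?Z"
      by (rule helly[OF nbh(2)[OF V(1)] nbh(1)[OF V(2)] Z nbh(4)[OF V(1)] nbh(3)[OF V(2)]])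
        (use aZ bZ kx arc xy(1) module(7)[OF a sD[OF xy(1)]] module(8)[OF b k(1)] in auto)
    then obtain z where z: "(z, \<sigma> x) \<in> R" "(k, z) \<in> R" "z \<in> ?Z" by blast
    have "z \<in> V" using z R_V by blast
    moreover have "z \<notin> A" using module(7) k(1) z(2) by blast
    moreover have "z \<notin> B" using module(8) sD[OF xy(1)] z(1) by blast
    ultimately have zD: "z \<in> D" using module(1) by blast
    then have "z = x" using sig(2) k z(2) by blast
    then obtain w where w: "(d, w) \<in> R" "(w, x) \<in> R" using z(3) by blast
    have "w \<in> V" using w R_V by blast
    moreover have "w \<notin> A" using module(7) d(1) w(1) by blast
    moreover have "w \<notin> B" using module(8) xy(1) w(2) by blast
    ultimately have "w \<in> D" using module(1) by blast
    then show False using sig(2) d xy(1) w by auto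
  qed
qed

end

theorem no_majority_polymorphism:
  assumes "semicomplete_rel V R" "strong R V" "branching R V"
    and "\<And>x y z. x \<in> V \<Longrightarrow> y \<in> V \<Longrightarrow> z \<in> V \<Longrightarrow> m x y z \<in> V"
    and "\<And>x x' y y' z z'. (x, x') \<in> R \<Longrightarrow> (y, y') \<in> R \<Longrightarrow> (z, z') \<in> R \<Longrightarrow> (m x y z, m x' y' z') \<in> R"
    and "\<And>x y. x \<in> V \<Longrightarrow> y \<in> V \<Longrightarrow> m x x y = x \<and> m x y x = x \<and> m y x x = x"
  shows False
  using assms
proof (induction "card V" arbitrary: V R rule: less_induct)
  case less
  interpret semicomplete_rel V R by (rule less.prems(1))
  have IH: False
    if S: "S \<subset> V" "\<forall>x\<in>S. \<forall>y\<in>S. \<forall>z\<in>S. m x y z \<in> S" "strong R S" "branching R S" for S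
  proof (rule less.hyps[of S "R \<inter> S \<times> S"])
    show "card S < card V" using S(1) finite_V by (rule psubset_card_mono[rotated])
    show "semicomplete_rel S (R \<inter> S \<times> S)" using S(1) by (intro restrict) blast
    show "(m x y z, m x' y' z') \<in> R \<inter> S \<times> S"
      if "(x, x') \<in> R \<inter> S \<times> S" "(y, y') \<in> R \<inter> S \<times> S" "(z, z') \<in> R \<inter> S \<times> S" for x x' y y' z z'
      using that S(2) less.prems(5) by auto
    show "m x x y = x \<and> m x y x = x \<and> m y x x = x" if "x \<in> S" "y \<in> S" for x y
      using that S(1) less.prems(6) by blast
  qed (use S in auto)
  interpret majority_polymorphism V R m
  proof
    show "m x x y = x \<and> m x y x = x \<and> m y x x = x" if "x \<in> V" "y \<in> V" for x y
      using that by (rule less.prems(6))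
    show False if "S \<subset> V" "\<forall>x\<in>S. \<forall>y\<in>S. \<forall>z\<in>S. m x y z \<in> S" "strong R S" "branching R S" for S
      using that by (rule IH)
  qed (use less.prems(2-5) in auto)
  show ?case by (rule contradiction)
qed

text \<open>\<open>U\<close> collects the coordinate sets whose value wins over that of the
  complement on two-valued tuples; by the binary case, a set outside \<open>U\<close> loses.\<close>

theorem polymorphism_projection:
  fixes F :: "(nat \<Rightarrow> 'a) \<Rightarrow> 'a"
  assumes sc: "semicomplete_rel V R" and str: "strong R V" and br: "branching R V"
    and F_V: "\<And>x. (\<And>i. x i \<in> V) \<Longrightarrow> F x \<in> V"
    and F_R: "\<And>x y. (\<And>i. (x i, y i) \<in> R) \<Longrightarrow> (F x, F y) \<in> R"
    and F_idem: "\<And>a. a \<in> V \<Longrightarrow> F (\<lambda>_. a) = a"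
    and F_dep: "\<And>x y. (\<And>i. i < n \<Longrightarrow> x i = y i) \<Longrightarrow> F x = F y"
  shows "\<exists>i<n. \<forall>x. (\<forall>j. x j \<in> V) \<longrightarrow> F x = x i"
proof -
  interpret strong_branching V R using sc str br by (simp add: strong_branching_def strong_branching_axioms_def)
  define g where "g I x y = F (\<lambda>i. if i \<in> I then x else y)" for I x y
  define U where "U = {I. I \<subseteq> {..<n} \<and> (\<forall>x\<in>V. \<forall>y\<in>V. g I x y = x)}"
  have alt: "\<forall>x\<in>V. \<forall>y\<in>V. g I x y = y" if "I \<subseteq> {..<n}" "I \<notin> U" for I
  proof -
    have "(\<forall>x\<in>V. \<forall>y\<in>V. g I x y = x) \<or> (\<forall>x\<in>V. \<forall>y\<in>V. g I x y = y)"
      by (rule binary_polymorphism_projection[OF sc str br]) (auto simp: g_def F_V F_R F_idem)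
    then show ?thesis using that unfolding U_def by blast
  qed
  have all: "{..<n} \<in> U"
  proof -
    have "g {..<n} x y = F (\<lambda>_. x)" for x y unfolding g_def by (rule F_dep) auto
    then show ?thesis unfolding U_def using F_idem by auto
  qed
  obtain I where I: "I \<in> U" and min: "\<And>J. J \<in> U \<Longrightarrow> card I \<le> card J"
    using ex_has_least_nat[of "\<lambda>I. I \<in> U" "{..<n}" card] all by blast
  have In: "I \<subseteq> {..<n}" "finite I" using I finite_subset[of I "{..<n}"] unfolding U_def by auto
  obtain a b where ab: "a \<in> V" "b \<in> V" "a \<noteq> b" using branching_V unfolding branching_def by blast
  have "I \<noteq> {}"
  proof
    assume "I = {}"
    then have "F (\<lambda>_. b) = a" using I ab unfolding U_def g_def by auto
    then show False using F_idem ab by auto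
  qed
  then obtain i where i: "i \<in> I" by blast
  have "I = {i}"
  proof (rule ccontr)
    assume ne: "I \<noteq> {i}"
    define I1 I2 where "I1 = {i}" and "I2 = I - {i}"
    have "1 < card I" using ne i In(2) by (metis One_nat_def Suc_lessI card_gt_0_iff card_1_singletonE singletonD empty_iff)
    then have small: "card I1 < card I" "card I2 < card I" using i In(2) unfolding I1_def I2_def by auto
    then have nU: "I1 \<notin> U" "I2 \<notin> U" using min by fastforce+
    have sub: "I1 \<subseteq> {..<n}" "I2 \<subseteq> {..<n}" using In(1) i unfolding I1_def I2_def by auto
    \<comment> \<open>\<open>I1\<close> and \<open>I2\<close> are smaller than \<open>I\<close>, so
      each loses against its complement, whereas their union wins: this is the majority law for
      \<open>m\<close>.\<close>
    define m where "m x y z = F (\<lambda>j. if j \<in> I1 then x else if j \<in> I2 then y else z)" for x y z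
    show False
    proof (rule no_majority_polymorphism[OF sc str br, of m])
      fix x y assume xy: "x \<in> V" "y \<in> V"
      have "m x x y = g I x y" unfolding m_def g_def I1_def I2_def using i by (auto intro!: arg_cong[of _ _ F])
      moreover have "m x y x = g I2 y x" unfolding m_def g_def I1_def I2_def by (auto intro!: arg_cong[of _ _ F])
      moreover have "m y x x = g I1 y x" unfolding m_def g_def by (auto intro!: arg_cong[of _ _ F])
      ultimately show "m x x y = x \<and> m x y x = x \<and> m y x x = x"
        using I alt[OF sub(1) nU(1)] alt[OF sub(2) nU(2)] xy unfolding U_def by auto
    qed (auto simp: m_def F_V F_R)
  qed
  then have gi: "F (\<lambda>j. if j = i then x else y) = x" if "x \<in> V" "y \<in> V" for x y
    using I that unfolding U_def g_def by auto
  have "F x = x i" if x: "\<And>j. x j \<in> V" for x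
  proof -
    let ?T = "{(v, w). \<forall>j. (v j, w j) \<in> R}"
    obtain N where N: "\<forall>l\<ge>N. \<forall>x\<in>V. \<forall>y\<in>V. (x, y) \<in> R ^^ l" using exact by blast
    \<comment> \<open>The walks of the single length \<open>N\<close> run in all coordinates
      simultaneously.\<close>
    have conn: "(v, w) \<in> ?T\<^sup>*" if "\<And>j. v j \<in> V" "\<And>j. w j \<in> V" for v w :: "nat \<Rightarrow> 'a"
    proof -
      have "(v, w) \<in> ?T ^^ N" by (rule relpow_tuples) (use N that in blast)
      then show ?thesis by (rule relpow_imp_rtrancl)
    qed
    have "F (x(i := x i)) = x i"
    proof (rule rigid[of R V "{v. \<forall>j. v j \<in> V}" "\<lambda>v a. F (v(i := a))" ?T "\<lambda>_. a" x "x i"])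
      show "F ((\<lambda>_. a)(i := c)) = c" if "c \<in> V" for c
        using gi[OF that ab(1)] by (simp add: fun_upd_def)
      show "F (v(i := c)) \<in> V" if "v \<in> {v. \<forall>j. v j \<in> V}" "c \<in> V" for v c
        using that by (intro F_V) auto
      show "(F (v(i := c)), F (w(i := d))) \<in> R" if "(v, w) \<in> ?T" "c \<in> V" "d \<in> V" "(c, d) \<in> R" for v w c d
        using that by (intro F_R) auto
      show "?T \<subseteq> {v. \<forall>j. v j \<in> V} \<times> {v. \<forall>j. v j \<in> V}" using R_sub by auto
      show "(\<lambda>_. a, x) \<in> ?T\<^sup>*" "(x, \<lambda>_. a) \<in> ?T\<^sup>*" using conn ab(1) x by simp_all
    qed (use irrefl total ab x in auto)
    then show ?thesis by simp
  qed
  then show ?thesis using i In(1) by blast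
qed

section \<open>Semicomplete relations without sinks\<close>

text \<open>Arguments are infinite sequences, so that tuples can be mixed and updated freely;
  \<open>id_Pol_imp_idempotent_polymorphism\<close> translates from finite tuples.\<close>

definition idempotent_polymorphism :: "'a set \<Rightarrow> 'a rel \<Rightarrow> nat \<Rightarrow> ((nat \<Rightarrow> 'a) \<Rightarrow> 'a) \<Rightarrow> bool" where
  "idempotent_polymorphism V R n F \<longleftrightarrow>
     (\<forall>x. (\<forall>i. x i \<in> V) \<longrightarrow> F x \<in> V) \<and>
     (\<forall>x y. (\<forall>i. (x i, y i) \<in> R) \<longrightarrow> (F x, F y) \<in> R) \<and>
     (\<forall>a\<in>V. F (\<lambda>_. a) = a) \<and>
     (\<forall>x y. (\<forall>i<n. x i = y i) \<longrightarrow> F x = F y)"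

definition depends_only :: "'a set \<Rightarrow> ((nat \<Rightarrow> 'a) \<Rightarrow> 'a) \<Rightarrow> nat set \<Rightarrow> bool" where
  "depends_only S F W \<longleftrightarrow>
     (\<forall>x y. (\<forall>j. x j \<in> S) \<longrightarrow> (\<forall>j. y j \<in> S) \<longrightarrow> (\<forall>j\<in>W. x j = y j) \<longrightarrow> F x = F y)"

lemma depends_onlyD:
  assumes "depends_only S F W" "\<forall>j. x j \<in> S" "\<forall>j. y j \<in> S" "\<forall>j\<in>W. x j = y j"
  shows "F x = F y"
  using assms(1)[unfolded depends_only_def, rule_format, of x y] assms(2-4) by blast

lemma depends_only_Int:
  assumes "depends_only S F W" "depends_only S F W'"
  shows "depends_only S F (W \<inter> W')"
  unfolding depends_only_def
proof (intro allI impI)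
  fix x y assume xy: "\<forall>j. x j \<in> S" "\<forall>j. y j \<in> S" "\<forall>j\<in>W \<inter> W'. x j = y j"
  let ?z = "\<lambda>j. if j \<in> W then x j else y j"
  have "F x = F ?z"
    using assms(1)[unfolded depends_only_def, rule_format, of x ?z] xy by auto
  also have "\<dots> = F y"
    using assms(2)[unfolded depends_only_def, rule_format, of ?z y] xy by auto
  finally show "F x = F y" .
qed

lemma relpow_idempotent_polymorphism:
  assumes "idempotent_polymorphism V R n F" "\<And>j. (x j, x j) \<in> R ^^ q"
  shows "(F x, F x) \<in> R ^^ q"
proof -
  have "(F x, F y) \<in> R ^^ q" if "(x, y) \<in> {(v, w). \<forall>i. (v i, w i) \<in> R} ^^ q" for y
    using that
  proof (induction q arbitrary: y)
    case (Suc q)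
    then obtain z where z: "(x, z) \<in> {(v, w). \<forall>i. (v i, w i) \<in> R} ^^ q" "\<forall>i. (z i, y i) \<in> R"
      by auto
    then have "(F z, F y) \<in> R" using assms(1) unfolding idempotent_polymorphism_def by blast
    then show ?case using Suc.IH[OF z(1)] by auto
  qed auto
  then show ?thesis using relpow_tuples[of x x q R] assms(2) by blast
qed

section \<open>Digraphs without sinks and their terminal component\<close>

context semicomplete_rel
begin

text \<open>The form of \<open>at_most_one_cycle\<close> used in the proofs: the first clause
  concerns cycles within one strong set, the second cycles in different ones.\<close>

definition unicyclic :: bool where
  "unicyclic \<longleftrightarrow>
     (\<forall>S\<subseteq>V. strong R S \<longrightarrow> 2 \<le> card S \<longrightarrow> \<not> branching R S) \<and>
     (\<forall>S\<subseteq>V. \<forall>S'\<subseteq>V. strong R S \<longrightarrow> strong R S' \<longrightarrow> 2 \<le> card S \<longrightarrow> 2 \<le> card S' \<longrightarrow> S = S')"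

lemma scc_strong:
  assumes "u \<in> V" shows "strong R {v. (u, v) \<in> R\<^sup>* \<and> (v, u) \<in> R\<^sup>*}" (is "strong R ?C")
proof -
  have path: "(x, y) \<in> (R \<inter> ?C \<times> ?C)\<^sup>*" if xy: "(x, y) \<in> R\<^sup>*" and ux: "(u, x) \<in> R\<^sup>*" "(y, u) \<in> R\<^sup>*" for x y
    using xy ux
  proof (induction rule: converse_rtrancl_induct)
    case (step x z)
    have uz: "(u, z) \<in> R\<^sup>*" using step.prems(1) step.hyps(1) by (rule rtrancl_into_rtrancl)
    have zu: "(z, u) \<in> R\<^sup>*" using step.hyps(2) step.prems(2) by (rule rtrancl_trans)
    then have xu: "(x, u) \<in> R\<^sup>*" using step.hyps(1) by (rule converse_rtrancl_into_rtrancl[rotated])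
    have "(x, z) \<in> R \<inter> ?C \<times> ?C" using step uz zu xu by auto
    then show ?case using step.IH[OF uz step.prems(2)] by (rule converse_rtrancl_into_rtrancl)
  qed simp
  show ?thesis
    unfolding strong_def
  proof (intro conjI ballI)
    show "?C \<noteq> {}" by blast
    fix x y assume "x \<in> ?C" "y \<in> ?C"
    then show "(x, y) \<in> (R \<inter> ?C \<times> ?C)\<^sup>*" by (intro path) (auto intro: rtrancl_trans)
  qed
qed

lemma reach_V: "(u, v) \<in> R\<^sup>* \<Longrightarrow> u \<in> V \<Longrightarrow> v \<in> V"
  by (induction rule: rtrancl_induct) (auto dest: R_V)

lemma card_ge_2: "S \<subseteq> V \<Longrightarrow> x \<in> S \<Longrightarrow> y \<in> S \<Longrightarrow> x \<noteq> y \<Longrightarrow> 2 \<le> card S"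
  using card_mono[of S "{x, y}"] finite_subset[OF _ finite_V, of S] by auto

lemma scc_card:
  assumes "(u, u) \<in> R\<^sup>+"
  shows "2 \<le> card {v. (u, v) \<in> R\<^sup>* \<and> (v, u) \<in> R\<^sup>*}"
proof -
  obtain w where w: "(u, w) \<in> R" "(w, u) \<in> R\<^sup>*" using tranclD[OF assms] by blast
  then have "u \<noteq> w" "u \<in> V" using irrefl R_V by auto
  then show ?thesis using w reach_V by (intro card_ge_2[of _ u w]) auto
qed

lemma strong_closed_walk:
  assumes "strong R S" "2 \<le> card S" "x \<in> S"
  shows "(x, x) \<in> R\<^sup>+"
proof -
  obtain y where y: "y \<in> S" "(x, y) \<in> R" using strong_succ[OF assms] by blast
  have "(y, x) \<in> (R \<inter> S \<times> S)\<^sup>*" using assms y unfolding strong_def by blast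
  then have "(y, x) \<in> R\<^sup>*" by (rule rtrancl_mono[THEN subsetD, rotated]) blast
  then show ?thesis using y(2) by (rule rtrancl_into_trancl2[rotated])
qed

text \<open>A vertex that reaches the fewest vertices is reached back from all of them. As no arc
  leaves \<open>L\<close>, semicompleteness directs every arc between \<open>V - L\<close> and
  \<open>L\<close> into \<open>L\<close>.\<close>

lemma terminal_component:
  assumes ne: "V \<noteq> {}" and sink: "\<And>v. v \<in> V \<Longrightarrow> \<exists>w. (v, w) \<in> R"
  obtains L where "L \<subseteq> V" "strong R L" "2 \<le> card L" "\<And>x y. x \<in> L \<Longrightarrow> (x, y) \<in> R \<Longrightarrow> y \<in> L"
    "\<And>v x. v \<in> V - L \<Longrightarrow> x \<in> L \<Longrightarrow> (v, x) \<in> R"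
proof -
  obtain v0 where "v0 \<in> V" using ne by blast
  then obtain u where u: "u \<in> V" and min: "\<And>v. v \<in> V \<Longrightarrow> card (R\<^sup>* `` {u}) \<le> card (R\<^sup>* `` {v})"
    using ex_has_least_nat[of "\<lambda>v. v \<in> V" v0 "\<lambda>v. card (R\<^sup>* `` {v})"] by blast
  define L where "L = R\<^sup>* `` {u}"
  have LV: "L \<subseteq> V" using reach_V u unfolding L_def by blast
  have returns: "(v, u) \<in> R\<^sup>*" if v: "v \<in> L" for v
  proof -
    have "R\<^sup>* `` {v} = R\<^sup>* `` {u}"
    proof (rule card_seteq)
      show "finite (R\<^sup>* `` {u})" using LV finite_V finite_subset unfolding L_def by blast
      show "R\<^sup>* `` {v} \<subseteq> R\<^sup>* `` {u}" using v unfolding L_def by (auto intro: rtrancl_trans)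
      show "card (R\<^sup>* `` {u}) \<le> card (R\<^sup>* `` {v})" using min v LV by blast
    qed
    then show ?thesis by blast
  qed
  have L: "L = {v. (u, v) \<in> R\<^sup>* \<and> (v, u) \<in> R\<^sup>*}" using returns unfolding L_def by blast
  have out: "y \<in> L" if "x \<in> L" "(x, y) \<in> R" for x y
    using that unfolding L_def by (auto intro: rtrancl_into_rtrancl)
  obtain w where "(u, w) \<in> R" using sink u by blast
  then have "(u, u) \<in> R\<^sup>+" using returns[of w] unfolding L_def by (auto intro: rtrancl_into_trancl2)
  then have "2 \<le> card L" unfolding L by (rule scc_card)
  moreover have "strong R L" unfolding L by (rule scc_strong[OF u])
  moreover have "(v, x) \<in> R" if "v \<in> V - L" "x \<in> L" for v x
    using total[of v x] out that LV by blast
  ultimately show ?thesis using that LV out by blast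
qed

text \<open>A value outside \<open>C\<close> lies on the same side of all entries of
  \<open>x\<close>, so idempotence gives a loop at it.\<close>

lemma polymorphism_component:
  assumes F: "idempotent_polymorphism V R n F" and C: "C \<subseteq> V"
    and scc: "\<And>z c d. z \<in> V - C \<Longrightarrow> c \<in> C \<Longrightarrow> d \<in> C \<Longrightarrow> (z, c) \<in> R \<Longrightarrow> (d, z) \<in> R \<Longrightarrow> False"
    and x: "\<And>j. x j \<in> C"
  shows "F x \<in> C"
proof (rule ccontr)
  assume "F x \<notin> C"
  moreover have V: "F x \<in> V" using F x C unfolding idempotent_polymorphism_def by blast
  ultimately have z: "F x \<in> V - C" by blast
  have tot: "(F x, x j) \<in> R \<or> (x j, F x) \<in> R" for j
  proof -
    have "F x \<noteq> x j" using z x[of j] by auto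
    then show ?thesis using total[OF V, of "x j"] x[of j] C by blast
  qed
  have "(\<forall>j. (F x, x j) \<in> R) \<or> (\<forall>j. (x j, F x) \<in> R)"
    using tot scc[OF z x x] by blast
  moreover have "(F v, F w) \<in> R" if "\<forall>j. (v j, w j) \<in> R" for v w
    using F that unfolding idempotent_polymorphism_def by blast
  ultimately have "(F (\<lambda>_. F x), F x) \<in> R \<or> (F x, F (\<lambda>_. F x)) \<in> R" by auto
  then show False using F V irrefl unfolding idempotent_polymorphism_def by auto
qed

lemma restrict_projection:
  assumes F: "idempotent_polymorphism V R n F" and C: "C \<subseteq> V" "strong R C" "branching R C"
    and closed: "\<And>x. (\<And>j. x j \<in> C) \<Longrightarrow> F x \<in> C"
  shows "\<exists>i<n. \<forall>x. (\<forall>j. x j \<in> C) \<longrightarrow> F x = x i"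
proof (rule polymorphism_projection[of C "R \<inter> C \<times> C" F n])
  show "semicomplete_rel C (R \<inter> C \<times> C)" using C(1) by (rule restrict)
  show "(F x, F y) \<in> R \<inter> C \<times> C" if "\<And>i. (x i, y i) \<in> R \<inter> C \<times> C" for x y
    using F closed[of x] closed[of y] that unfolding idempotent_polymorphism_def by blast
  show "F x = F y" if "\<And>i. i < n \<Longrightarrow> x i = y i" for x y
    using F that unfolding idempotent_polymorphism_def by blast
qed (use F C closed in \<open>auto simp: idempotent_polymorphism_def subset_iff\<close>)

text \<open>For a cycle \<open>L\<close>, let \<open>J\<close> be a smallest coordinate set that
  determines \<open>F\<close> on \<open>L\<close>. By \<open>dich\<close>, each \<open>j\<close> in
  \<open>J\<close> alone determines \<open>F\<close> on \<open>M\<close>; two of them would make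
  \<open>F\<close> constant on \<open>M\<close>.\<close>

lemma no_sink_projection:
  assumes nu: "\<not> unicyclic"
    and L: "L \<subseteq> V" "strong R L" "2 \<le> card L" "\<And>x y. x \<in> L \<Longrightarrow> (x, y) \<in> R \<Longrightarrow> y \<in> L"
      "\<And>v x. v \<in> V - L \<Longrightarrow> x \<in> L \<Longrightarrow> (v, x) \<in> R"
    and F: "idempotent_polymorphism V R n F"
  shows "\<exists>i<n. \<forall>x. (\<forall>j. x j \<in> L) \<longrightarrow> F x = x i"
proof -
  have F_V: "F x \<in> V" if "\<And>j. x j \<in> V" for x
    using F that unfolding idempotent_polymorphism_def by blast
  have F_R: "(F x, F y) \<in> R" if "\<And>j. (x j, y j) \<in> R" for x y
    using F that unfolding idempotent_polymorphism_def by blast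
  have F_idem: "F (\<lambda>_. a) = a" if "a \<in> V" for a
    using F that unfolding idempotent_polymorphism_def by blast
  have F_L: "F x \<in> L" if "\<And>j. x j \<in> L" for x
    by (rule polymorphism_component[OF F L(1) _ that]) (use L(4) in blast)
  show ?thesis
  proof (cases "branching R L")
    case True
    then show ?thesis using restrict_projection[OF F L(1,2) True] F_L by blast
  next
    case nbL: False
    obtain \<sigma> where s: "bij_betw \<sigma> L L" "\<forall>x\<in>L. \<forall>y\<in>L. (x, y) \<in> R \<longleftrightarrow> y = \<sigma> x"
      "\<forall>x\<in>L. \<sigma> x \<noteq> x \<and> (\<sigma> ^^ 6) x = x"
      using nonbranching_cycle[OF L(1-3) nbL] by blast
    have pow: "(x, (\<tau> ^^ k) x) \<in> R ^^ k \<and> (\<tau> ^^ k) x \<in> C"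
      if "x \<in> C" "bij_betw \<tau> C C" "\<forall>x\<in>C. \<forall>y\<in>C. (x, y) \<in> R \<longleftrightarrow> y = \<tau> x" for C \<tau> x k
    proof (induction k)
      case (Suc k)
      have "\<tau> ((\<tau> ^^ k) x) \<in> C" using Suc bij_betwE[OF that(2)] by blast
      then show ?case using Suc that(3) by auto
    qed (use that in simp)
    have per: "(x, x) \<in> R ^^ 6" if "x \<in> L" for x
      using pow[OF that s(1,2), of 6] s(3) that by auto
    have "\<exists>S\<subseteq>V. strong R S \<and> 2 \<le> card S \<and> \<not> S \<subseteq> L"
    proof (rule ccontr)
      assume "\<not> ?thesis"
      then have "S = L" if "S \<subseteq> V" "strong R S" "2 \<le> card S" for S
        using strong_subset_branching[OF that(2,3) L(2)] nbL that by blast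
      then show False using nu nbL unfolding unicyclic_def by blast
    qed
    then obtain S u0 where S: "S \<subseteq> V" "strong R S" "2 \<le> card S" "u0 \<in> S" "u0 \<notin> L" by blast
    \<comment> \<open>Minimal reach makes \<open>M\<close> the lowest nontrivial component above
      \<open>L\<close>: a vertex on a closed walk that is entered from \<open>M\<close> lies in
      \<open>M\<close> or \<open>L\<close>.\<close>
    let ?Q = "\<lambda>v. v \<in> V - L \<and> (v, v) \<in> R\<^sup>+"
    have "?Q u0" using S strong_closed_walk by blast
    then obtain u where u: "?Q u" and min: "\<And>v. ?Q v \<Longrightarrow> card (R\<^sup>* `` {u}) \<le> card (R\<^sup>* `` {v})"
      using ex_has_least_nat[of ?Q u0 "\<lambda>v. card (R\<^sup>* `` {v})"] by blast
    define M where "M = {v. (u, v) \<in> R\<^sup>* \<and> (v, u) \<in> R\<^sup>*}"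
    have uM: "u \<in> M" "u \<in> V" "u \<notin> L" using u unfolding M_def by auto
    have M: "M \<subseteq> V" "strong R M" "2 \<le> card M"
      using reach_V scc_strong scc_card u unfolding M_def by auto
    have L_reach: "y \<in> L" if "(x, y) \<in> R\<^sup>*" "x \<in> L" for x y
      using that by (induction rule: rtrancl_induct) (auto intro: L(4))
    have notL: "x \<notin> L" if "x \<in> M" for x using that L_reach u unfolding M_def by blast
    have arcML: "(x, y) \<in> R" if "x \<in> M" "y \<in> L" for x y using L(5) notL that M(1) by blast
    have scc: False if "z \<in> V - M" "c \<in> M" "d \<in> M" "(z, c) \<in> R" "(d, z) \<in> R" for z c d
      using that unfolding M_def by (auto intro: rtrancl_into_rtrancl converse_rtrancl_into_rtrancl)
    have F_M: "F x \<in> M" if "\<And>j. x j \<in> M" for x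
      by (rule polymorphism_component[OF F M(1) scc that])
    have zM: "z \<in> M" if z: "(z, z) \<in> R\<^sup>+" "z \<notin> L" "d \<in> M" "(d, z) \<in> R" for z d
    proof -
      have uz: "(u, z) \<in> R\<^sup>*" using z(3,4) unfolding M_def by (auto intro: rtrancl_into_rtrancl)
      have zV: "z \<in> V" using z(4) R_V by blast
      have "R\<^sup>* `` {z} = R\<^sup>* `` {u}"
      proof (rule card_seteq)
        have "R\<^sup>* `` {u} \<subseteq> V" using reach_V uM(2) by blast
        then show "finite (R\<^sup>* `` {u})" using finite_V finite_subset by blast
        show "R\<^sup>* `` {z} \<subseteq> R\<^sup>* `` {u}" using uz by (auto intro: rtrancl_trans)
        show "card (R\<^sup>* `` {u}) \<le> card (R\<^sup>* `` {z})" using min z(1,2) zV by blast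
      qed
      then have "(z, u) \<in> R\<^sup>*" by blast
      then show ?thesis using uz unfolding M_def by blast
    qed
    \<comment> \<open>The length \<open>q\<close> is divisible by 6 to fit the cycle
      \<open>L\<close> too. If \<open>F\<close> is the projection to \<open>i\<close> on
      \<open>M\<close>, then \<open>i\<close> is outside \<open>W\<close>, and
      \<open>y i = z\<close> prevents the arc by irreflexivity. On a cycle, two tuples that agree on
      \<open>W\<close> but have different values have no common successor.\<close>
    have M_branch: "\<exists>x\<^sub>0 q. (\<forall>j. x\<^sub>0 j \<in> M \<and> (x\<^sub>0 j, x\<^sub>0 j) \<in> R ^^ q) \<and> 0 < q \<and> 6 dvd q \<and>
        (\<forall>z\<in>M. \<exists>y. (\<forall>j. y j \<in> M) \<and> (\<forall>j\<in>W. (y j, x\<^sub>0 j) \<in> R) \<and> (F y, z) \<notin> R)"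
      if W: "\<not> depends_only M F W" for W
    proof (cases "branching R M")
      case True
      then obtain i where i: "\<forall>x. (\<forall>j. x j \<in> M) \<longrightarrow> F x = x i"
        using restrict_projection[OF F M(1,2) True] F_M by blast
      have iW: "i \<notin> W" using W i unfolding depends_only_def by metis
      obtain p where p: "0 < p" "(u, u) \<in> R ^^ p" using u by (auto simp: trancl_power)
      obtain v where v: "v \<in> M" "(v, u) \<in> R" using strong_pred[OF M(2,3) uM(1)] by blast
      have "\<exists>y. (\<forall>j. y j \<in> M) \<and> (\<forall>j\<in>W. (y j, u) \<in> R) \<and> (F y, z) \<notin> R" if z: "z \<in> M" for z
      proof -
        let ?y = "\<lambda>j. if j = i then z else v"
        have y: "\<forall>j. ?y j \<in> M" using z v by auto
        then have "F ?y = z" using i by auto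
        then show ?thesis using y v(2) iW irrefl by (intro exI[of _ ?y]) auto
      qed
      moreover have "(u, u) \<in> R ^^ (6 * p)" using p(2) by (rule relpow_period)
      ultimately show ?thesis using uM(1) p(1)
        by (intro exI[of _ "\<lambda>_. u"] exI[of _ "6 * p"]) auto
    next
      case False
      obtain \<tau> where t: "bij_betw \<tau> M M" "\<forall>x\<in>M. \<forall>y\<in>M. (x, y) \<in> R \<longleftrightarrow> y = \<tau> x"
        "\<forall>x\<in>M. \<tau> x \<noteq> x \<and> (\<tau> ^^ 6) x = x"
        using nonbranching_cycle[OF M False] by blast
      have tM: "\<tau> x \<in> M" if "x \<in> M" for x using bij_betwE[OF t(1)] that by blast
      obtain y y' where y: "\<forall>j. y j \<in> M" "\<forall>j. y' j \<in> M" "\<forall>j\<in>W. y j = y' j" "F y \<noteq> F y'"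
        using W unfolding depends_only_def by blast
      have FyM: "F y \<in> M" "F y' \<in> M" using F_M y(1,2) by blast+
      have "(F y, z) \<notin> R \<or> (F y', z) \<notin> R" if "z \<in> M" for z
      proof (rule ccontr)
        assume "\<not> ?thesis"
        then have "\<tau> (F y) = \<tau> (F y')" using t(2) FyM that by metis
        then show False using y(4) FyM inj_onD[OF bij_betw_imp_inj_on[OF t(1)]] by blast
      qed
      moreover have "(y j, \<tau> (y j)) \<in> R" for j using t(2) y(1) tM by blast
      moreover have "(\<tau> (y j), \<tau> (y j)) \<in> R ^^ 6" for j
        using pow[OF tM t(1,2), of "y j" 6] t(3) tM y(1) by auto
      ultimately show ?thesis using y(1-3) tM
        by (intro exI[of _ "\<lambda>j. \<tau> (y j)"] exI[of _ 6]) (auto, metis)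
    qed
    have dich: "depends_only M F W \<or> depends_only L F (- W)" for W
    proof (cases "depends_only M F W")
      case False
      then obtain x\<^sub>0 q where x0: "\<forall>j. x\<^sub>0 j \<in> M \<and> (x\<^sub>0 j, x\<^sub>0 j) \<in> R ^^ q" "0 < q" "6 dvd q"
        and no: "\<forall>z\<in>M. \<exists>y. (\<forall>j. y j \<in> M) \<and> (\<forall>j\<in>W. (y j, x\<^sub>0 j) \<in> R) \<and> (F y, z) \<notin> R"
        using M_branch[OF False] by (elim exE conjE)
      have "depends_only L F (- W)"
        unfolding depends_only_def
      proof (intro allI impI)
        fix w w' assume w: "\<forall>j. w j \<in> L" "\<forall>j. w' j \<in> L" "\<forall>j\<in>- W. w j = w' j"
        have "\<exists>l\<in>L. \<sigma> l = w j" for j using bij_betw_imp_surj_on[OF s(1)] w(1) by (metis imageE)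
        then obtain l where l: "\<And>j. l j \<in> L" "\<And>j. \<sigma> (l j) = w j" by metis
        \<comment> \<open>\<open>F ?x\<close> lies on a closed walk and succeeds values in
          \<open>M\<close>, so it is in \<open>M\<close> or \<open>L\<close>, and \<open>no\<close>
          excludes \<open>M\<close>. Its only successor in \<open>L\<close> is \<open>F v\<close>
          for every \<open>v\<close> over \<open>L\<close> that agrees with \<open>w\<close> off
          \<open>W\<close>, since \<open>M\<close> dominates \<open>L\<close>; so the entries on
          \<open>W\<close> do not affect the value.\<close>
        let ?x = "\<lambda>j. if j \<in> W then x\<^sub>0 j else l j"
        have xV: "?x j \<in> V" for j using x0(1) l(1) M(1) L(1) by auto
        obtain r where r: "q = r * 6" using x0(3) by (auto simp: dvd_def mult.commute)
        have "(?x j, ?x j) \<in> R ^^ q" for j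
          using x0(1) relpow_period[OF per[OF l(1)[of j]], of r] r by auto
        then have "(F ?x, F ?x) \<in> R ^^ q" by (rule relpow_idempotent_polymorphism[OF F])
        then have cyc: "(F ?x, F ?x) \<in> R\<^sup>+" using x0(2) by (auto simp: trancl_power)
        have preds: "(F y, F ?x) \<in> R" if "\<forall>j. y j \<in> M" "\<forall>j\<in>W. (y j, x\<^sub>0 j) \<in> R" for y
          using that arcML l(1) by (intro F_R) auto
        have zL: "F ?x \<in> L"
        proof (rule ccontr)
          assume nL: "F ?x \<notin> L"
          have "\<forall>j. \<exists>v. v \<in> M \<and> (v, x\<^sub>0 j) \<in> R"
            using strong_pred[OF M(2,3)] x0(1) by blast
          then obtain y where y: "\<forall>j. y j \<in> M \<and> (y j, x\<^sub>0 j) \<in> R" by metis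
          then have "F y \<in> M" "(F y, F ?x) \<in> R" using F_M preds by simp_all
          then have "F ?x \<in> M" by (rule zM[OF cyc nL])
          then show False using no preds by blast
        qed
        have succs: "F v = \<sigma> (F ?x)" if v: "\<forall>j. v j \<in> L" "\<forall>j\<in>- W. v j = w j" for v
        proof -
          have "(?x j, v j) \<in> R" for j
          proof (cases "j \<in> W")
            case True
            then show ?thesis using arcML x0(1) v(1) by simp
          next
            case False
            then have "v j = \<sigma> (l j)" using v(2) l(2) by simp
            then have "(l j, v j) \<in> R" using s(2) l(1) v(1) by blast
            then show ?thesis using False by simp
          qed
          then have "(F ?x, F v) \<in> R" by (rule F_R)
          then show ?thesis using s(2) zL F_L v(1) by blast
        qed
        show "F w = F w'" using succs[of w] succs[of w'] w by simp
      qed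
      then show ?thesis ..
    qed simp
    have depn: "depends_only L F {..<n}"
      using F unfolding depends_only_def idempotent_polymorphism_def by auto
    let ?P = "\<lambda>J. J \<subseteq> {..<n} \<and> depends_only L F J"
    obtain J where J: "?P J" and Jmin: "\<And>K. ?P K \<Longrightarrow> card J \<le> card K"
      using ex_has_least_nat[of ?P "{..<n}" card] depn by blast
    have Jfin: "finite J" using J finite_subset by blast
    have nonempty: "\<not> depends_only C F {}" if C: "C \<subseteq> V" "2 \<le> card C" for C
    proof
      assume d: "depends_only C F {}"
      have "\<not> card C \<le> Suc 0" using C(2) by simp
      moreover have "finite C" using C(1) finite_V finite_subset by blast
      ultimately obtain a b where ab: "a \<in> C" "b \<in> C" "a \<noteq> b" using card_le_Suc0_iff_eq by blast
      have "F (\<lambda>_. a) = F (\<lambda>_. b)"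
        using d[unfolded depends_only_def, rule_format, of "\<lambda>_. a" "\<lambda>_. b"] ab by simp
      then show False using F_idem[of a] F_idem[of b] ab C(1) by auto
    qed
    have single: "depends_only M F {j}" if j: "j \<in> J" for j
    proof (rule ccontr)
      assume "\<not> ?thesis"
      then have "depends_only L F (- {j})" using dich by blast
      then have "depends_only L F (J \<inter> - {j})" using depends_only_Int J by blast
      then have "card J \<le> card (J \<inter> - {j})" using J by (intro Jmin) auto
      moreover have "card (J \<inter> - {j}) < card J" by (rule psubset_card_mono[OF Jfin]) (use j in blast)
      ultimately show False by simp
    qed
    have "J \<noteq> {}" using nonempty[OF L(1,3)] J by blast
    then obtain j where j: "j \<in> J" by blast
    have "J = {j}"
    proof (rule ccontr)
      assume "J \<noteq> {j}"
      then obtain k where k: "k \<in> J" "k \<noteq> j" using j by blast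
      have "depends_only M F ({j} \<inter> {k})" by (rule depends_only_Int[OF single[OF j] single[OF k(1)]])
      moreover have "{j} \<inter> {k} = {}" using k(2) by simp
      ultimately show False using nonempty[OF M(1,3)] by simp
    qed
    have "F x = x j" if x: "\<forall>i. x i \<in> L" for x
    proof -
      have "depends_only L F {j}" using J \<open>J = {j}\<close> by simp
      then have "F x = F (\<lambda>_. x j)"
        by (rule depends_onlyD) (use x in simp_all)
      then show ?thesis using F_idem[of "x j"] x L(1) by auto
    qed
    then show ?thesis using J j by blast
  qed
qed

theorem no_sink_avoids:
  assumes "\<not> unicyclic" and sink: "\<And>v. v \<in> V \<Longrightarrow> \<exists>w. (v, w) \<in> R"
  shows "\<exists>g. (\<forall>v\<in>V. g v \<in> V) \<and> (\<forall>n F. idempotent_polymorphism V R n F \<longrightarrow>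
    (\<exists>i<n. \<forall>x. (\<forall>j. x j \<in> V) \<longrightarrow> F x \<noteq> g (x i)))"
proof -
  have "unicyclic" if "V = {}" unfolding unicyclic_def using that by auto
  then have "V \<noteq> {}" using assms(1) by blast
  then obtain L where L: "L \<subseteq> V" "strong R L" "2 \<le> card L" "\<And>x y. x \<in> L \<Longrightarrow> (x, y) \<in> R \<Longrightarrow> y \<in> L"
      "\<And>v x. v \<in> V - L \<Longrightarrow> x \<in> L \<Longrightarrow> (v, x) \<in> R"
    by (rule terminal_component[OF _ sink]) auto
  have "\<exists>w\<in>L. (v, w) \<in> R" if "v \<in> V" for v
  proof (cases "v \<in> L")
    case True
    then show ?thesis using sink[OF that] L(4) by blast
  next
    case False
    then show ?thesis using L(2,5) that unfolding strong_def by blast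
  qed
  then obtain g where g: "\<And>v. v \<in> V \<Longrightarrow> g v \<in> L \<and> (v, g v) \<in> R" by metis
  have "\<exists>i<n. \<forall>x. (\<forall>j. x j \<in> V) \<longrightarrow> F x \<noteq> g (x i)" if F: "idempotent_polymorphism V R n F" for n F
  proof -
    have "\<exists>i<n. \<forall>x. (\<forall>j. x j \<in> L) \<longrightarrow> F x = x i"
      by (rule no_sink_projection[OF assms(1) L(1-3) _ _ F]) (use L(4,5) in blast)+
    then obtain i where i: "i < n" "\<forall>x. (\<forall>j. x j \<in> L) \<longrightarrow> F x = x i" by blast
    have "F x \<noteq> g (x i)" if x: "\<forall>j. x j \<in> V" for x
    proof
      assume eq: "F x = g (x i)"
      have "F (\<lambda>j. g (x j)) = g (x i)" using i(2) g x by auto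
      moreover have "\<forall>j. (x j, g (x j)) \<in> R" using g x by blast
      then have "(F x, F (\<lambda>j. g (x j))) \<in> R"
        using F unfolding idempotent_polymorphism_def by (elim conjE allE[of _ x] allE[of _ "\<lambda>j. g (x j)"]) blast
      ultimately show False using eq irrefl by metis
    qed
    then show ?thesis using i(1) by blast
  qed
  then show ?thesis using g L(1) by blast
qed

end

section \<open>Generating sets of powers\<close>

lemma id_PolI:
  assumes "\<And>x. x \<in> tuples (pverts H) k \<Longrightarrow> f x \<in> pverts H"
    and "\<And>x y. x \<in> tuples (pverts H) k \<Longrightarrow> y \<in> tuples (pverts H) k \<Longrightarrow>
      (\<And>i. i < k \<Longrightarrow> (x i, y i) \<in> parcs H) \<Longrightarrow> (f x, f y) \<in> parcs H"
    and "\<And>a. a \<in> pverts H \<Longrightarrow> f (\<lambda>i\<in>{..<k}. a) = a"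
  shows "f \<in> id_Pol H k"
  using assms unfolding id_Pol_def polymorphism_def idempotent_def by blast

lemma generates_tuples: "generates (pverts H) (id_Pol H) m (tuples (pverts H) m)"
proof -
  have f: "(\<lambda>x. x 0) \<in> id_Pol H 1" by (rule id_PolI) (auto simp: tuples_def)
  have "t = apply_coordinatewise (\<lambda>x. x 0) 1 m (\<lambda>_. t)" if "t \<in> tuples (pverts H) m" for t
    using that unfolding apply_coordinatewise_def tuples_def by (intro ext) (auto simp: PiE_def extensional_def)
  then show ?thesis unfolding generates_def using f by (meson order_refl zero_less_one)
qed

lemma finite_tuples: "finite A \<Longrightarrow> finite (tuples A m)"
  unfolding tuples_def by (intro finite_PiE) auto

lemma card_tuples: "card (tuples A m) = card A ^ m"
  unfolding tuples_def by (simp add: card_PiE)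

lemma tuples_mem: "t \<in> tuples A m \<Longrightarrow> j < m \<Longrightarrow> t j \<in> A"
  unfolding tuples_def by auto

lemma PGP_linear:
  assumes "\<And>m. \<exists>S. finite S \<and> generates A F m S \<and> card S \<le> m + c"
  shows "PGP A F"
proof -
  have le: "min_generating_size A F m \<le> m + c" for m
  proof -
    obtain S where S: "finite S" "generates A F m S" "card S \<le> m + c" using assms by blast
    have "min_generating_size A F m \<le> card S"
      unfolding min_generating_size_def by (rule Least_le) (use S in blast)
    then show ?thesis using S(3) by simp
  qed
  have "(\<lambda>m. real (min_generating_size A F m)) \<in> O(\<lambda>m. poly [:real c, 1:] (real m))"
  proof (intro bigoI[where c = 1] always_eventually allI)
    fix m show "norm (real (min_generating_size A F m)) \<le> 1 * norm (poly [:real c, 1:] (real m))"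
      using le[of m] by simp
  qed
  then show ?thesis unfolding PGP_def by blast
qed

text \<open>A single vertex is source and sink at once, whereas \<open>PGP_source_sink\<close> works
  with two different vertices.\<close>

lemma PGP_trivial:
  assumes "finite (pverts H)" "card (pverts H) \<le> 1"
  shows "PGP (pverts H) (id_Pol H)"
proof (rule PGP_linear)
  fix m
  have "card (tuples (pverts H) m) \<le> 1"
    using power_mono[OF assms(2), of m] by (simp add: card_tuples)
  then have "card (tuples (pverts H) m) \<le> m + 1" by simp
  then show "\<exists>S. finite S \<and> generates (pverts H) (id_Pol H) m S \<and> card S \<le> m + 1"
    using generates_tuples finite_tuples[OF assms(1)] by blast
qed

text \<open>The generators \<open>r i\<close> are the rows of a matrix whose columns are the
  argument tuples, so \<open>f\<close> has to take prescribed values at \<open>m\<close>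
  columns.\<close>

lemma generates_by_rows:
  assumes "k > 0" and row: "\<And>i. i < k \<Longrightarrow> r i \<in> tuples A m"
    and op: "\<And>t. t \<in> tuples A m \<Longrightarrow> \<exists>f\<in>F k. \<forall>j<m. f (\<lambda>i\<in>{..<k}. r i j) = t j"
  shows "\<exists>S. finite S \<and> generates A F m S \<and> card S \<le> k"
proof (intro exI conjI)
  show "finite (r ` {..<k})" by simp
  show "card (r ` {..<k}) \<le> k" using card_image_le[of "{..<k}" r] by simp
  show "generates A F m (r ` {..<k})"
    unfolding generates_def
  proof (intro conjI ballI)
    show "r ` {..<k} \<subseteq> tuples A m" using row by blast
    fix t assume t: "t \<in> tuples A m"
    then obtain f where f: "f \<in> F k" "\<forall>j<m. f (\<lambda>i\<in>{..<k}. r i j) = t j" using op by blast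
    have "t = apply_coordinatewise f k m r"
      using t f(2) unfolding apply_coordinatewise_def tuples_def by (intro ext) (auto simp: PiE_def extensional_def)
    then show "\<exists>k'>0. \<exists>f\<in>F k'. \<exists>s. (\<forall>i<k'. s i \<in> r ` {..<k}) \<and> t = apply_coordinatewise f k' m s"
      using \<open>k > 0\<close> f(1) by blast
  qed
qed

text \<open>No arc of the power digraph enters a tuple containing a source or leaves a tuple containing a
  sink, so a polymorphism is unconstrained on the tuples that contain both.\<close>

lemma PGP_source_sink:
  assumes R: "parcs H \<subseteq> pverts H \<times> pverts H" and ab: "a \<in> pverts H" "b \<in> pverts H" "a \<noteq> b"
    and src: "\<And>x. (x, a) \<notin> parcs H" and snk: "\<And>x. (b, x) \<notin> parcs H"
  shows "PGP (pverts H) (id_Pol H)"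
proof (rule PGP_linear)
  fix m :: nat
  let ?A = "pverts H"
  \<comment> \<open>A square block with \<open>b\<close> on the diagonal and \<open>a\<close>
    elsewhere, then a row of \<open>a\<close> and a row of \<open>b\<close>. The last two put the
    source and the sink at the fixed positions where \<open>f\<close> tests for them; the first
    \<open>b\<close> in column \<open>j\<close> is at position \<open>j\<close>.\<close>
  define r where "r i = (\<lambda>j\<in>{..<m}. if i < m then (if i = j then b else a) else if i = m then a else b)" for i
  show "\<exists>S. finite S \<and> generates ?A (id_Pol H) m S \<and> card S \<le> m + 2"
  proof (rule generates_by_rows)
    show "r i \<in> tuples ?A m" for i using ab unfolding r_def tuples_def by auto
    fix t assume t: "t \<in> tuples ?A m"
    define f where "f x = (if x m = a \<and> x (m + 1) = b \<and> (\<exists>j<m. x j = b)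
      then t (LEAST j. x j = b) else x 0)" for x
    have "f \<in> id_Pol H (m + 2)"
    proof (rule id_PolI)
      fix x assume x: "x \<in> tuples ?A (m + 2)"
      have "(LEAST j. x j = b) < m" if "j < m" "x j = b" for j
        using Least_le[of "\<lambda>j. x j = b" j] that by linarith
      then show "f x \<in> ?A" using tuples_mem[OF t] tuples_mem[OF x] unfolding f_def by auto
    next
      fix x y assume xy: "\<And>i. i < m + 2 \<Longrightarrow> (x i, y i) \<in> parcs H"
      have "x (m + 1) \<noteq> b" using xy[of "m + 1"] snk by auto
      moreover have "y m \<noteq> a" using xy[of m] src by auto
      ultimately show "(f x, f y) \<in> parcs H" using xy[of 0] unfolding f_def by simp
    qed (use ab(3) in \<open>auto simp: f_def\<close>)
    moreover have "f (\<lambda>i\<in>{..<m + 2}. r i j) = t j" if j: "j < m" for j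
    proof -
      let ?x = "\<lambda>i\<in>{..<m + 2}. r i j"
      have xi: "?x i = (if i = j then b else a)" if "i < m" for i using that j unfolding r_def by auto
      have "(LEAST i. ?x i = b) = j"
      proof (rule Least_equality)
        show "?x j = b" using xi[OF j] by simp
        show "j \<le> i" if "?x i = b" for i
        proof (rule ccontr)
          assume "\<not> j \<le> i"
          then show False using xi[of i] that j ab(3) by simp
        qed
      qed
      moreover have "?x m = a" "?x (m + 1) = b" "\<exists>i<m. ?x i = b"
        using j xi[OF j] unfolding r_def by auto
      ultimately show ?thesis unfolding f_def by presburger
    qed
    ultimately show "\<exists>f\<in>id_Pol H (m + 2). \<forall>j<m. f (\<lambda>i\<in>{..<m + 2}. r i j) = t j" by blast
  qed simp
qed

text \<open>Here \<open>C\<close> is the cycle. The operation that produces \<open>t\<close> is a projection on each set of tuples over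
  \<open>C\<close> with a fixed equality pattern, and each column of the generating matrix (row \<open>0\<close> aside) has
  its own pattern. Only the source in row \<open>0\<close> lets a column over \<open>C\<close> be mapped outside \<open>C\<close>.\<close>

lemma PGP_cycle:
  assumes sc: "semicomplete_rel (pverts H) (parcs H)"
    and C: "C \<subseteq> pverts H" "2 \<le> card C"
    and out: "\<And>x y. x \<in> C \<Longrightarrow> (x, y) \<in> parcs H \<Longrightarrow> y \<in> C"
    and cyc: "inj_on \<sigma> C" "\<And>x y. x \<in> C \<Longrightarrow> y \<in> C \<Longrightarrow> (x, y) \<in> parcs H \<longleftrightarrow> y = \<sigma> x"
    and above: "\<And>x y. x \<in> pverts H - C \<Longrightarrow> y \<in> C \<Longrightarrow> (x, y) \<in> parcs H"
    and rank: "\<And>x y. x \<in> pverts H - C \<Longrightarrow> y \<in> pverts H - C \<Longrightarrow> (x, y) \<in> parcs H \<Longrightarrow> \<rho> x < (\<rho> y :: nat)"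
  shows "PGP (pverts H) (id_Pol H)"
proof -
  interpret semicomplete_rel "pverts H" "parcs H" by (rule sc)
  let ?A = "pverts H" and ?R = "parcs H"
  define n where "n = card C"
  have "finite C" using C(1) finite_V finite_subset by blast
  then obtain e where e: "bij_betw e {..<n} C" unfolding n_def using ex_bij_betw_nat_finite[of C] by (metis atLeast0LessThan)
  have eC: "e i \<in> C" if "i < n" for i using bij_betwE[OF e] that by blast
  have n2: "2 \<le> n" using C(2) n_def by simp
  have e01: "e 0 \<noteq> e 1" using bij_betw_imp_inj_on[OF e] n2 by (auto dest: inj_onD)
  have "\<exists>ix. \<forall>c\<in>C. ix c < n \<and> e (ix c) = c"
    using bij_betw_imp_surj_on[OF e] by (intro bchoice) (auto simp: image_iff)
  then obtain ix where ix: "\<And>c. c \<in> C \<Longrightarrow> ix c < n \<and> e (ix c) = c" by blast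
  \<comment> \<open>Outside \<open>C\<close>, a vertex of least rank is a source, because no arc
    leaves \<open>C\<close>.\<close>
  have src: "\<exists>p\<in>?A. p \<in> C \<and> ?A = C \<or> p \<notin> C \<and> (\<forall>x. (x, p) \<notin> ?R)"
  proof (cases "?A = C")
    case True
    then show ?thesis using eC[of 0] n2 C(1) by force
  next
    case False
    then obtain q where "q \<in> ?A - C" using C(1) by blast
    then obtain p where p: "p \<in> ?A - C" "\<And>q. q \<in> ?A - C \<Longrightarrow> \<rho> p \<le> \<rho> q"
      using ex_has_least_nat[of "\<lambda>q. q \<in> ?A - C" q \<rho>] by blast
    have "(x, p) \<notin> ?R" for x
    proof
      assume x: "(x, p) \<in> ?R"
      then have "x \<in> ?A - C" using out p(1) R_V by blast
      then show False using rank[OF _ p(1) x] p(2) by fastforce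
    qed
    then show ?thesis using p(1) by blast
  qed
  then obtain p where p: "p \<in> ?A" "p \<in> C \<and> ?A = C \<or> p \<notin> C \<and> (\<forall>x. (x, p) \<notin> ?R)" by blast
  show ?thesis
  proof (rule PGP_linear)
    fix m :: nat
    define k where "k = m + (n + 1)"
    \<comment> \<open>Row 0 is \<open>p\<close>, rows 1 to \<open>n\<close> list \<open>C\<close>
      starting with \<open>e 0\<close>, and the last \<open>m\<close> rows have \<open>e 1\<close>
      on the diagonal and \<open>e 0\<close> elsewhere. So in the last block of column
      \<open>j\<close>, exactly the entry \<open>n + 1 + j\<close> differs from entry 1.\<close>
    define r where "r i = (\<lambda>j\<in>{..<m}. if i = 0 then p else if i \<le> n then e (i - 1)
      else if i = n + 1 + j then e 1 else e 0)" for i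
    show "\<exists>S. finite S \<and> generates ?A (id_Pol H) m S \<and> card S \<le> m + (n + 1)"
      unfolding k_def[symmetric]
    proof (rule generates_by_rows)
      show "k > 0" unfolding k_def by simp
      show "r i \<in> tuples ?A m" if "i < k" for i
      proof -
        have "e 0 \<in> ?A" "e 1 \<in> ?A" using eC C(1) n2 by auto
        moreover have "e (i - 1) \<in> ?A" if "i \<noteq> 0" "i \<le> n" using eC[of "i - 1"] C(1) that by auto
        ultimately show ?thesis using p(1) unfolding r_def tuples_def by auto
      qed
      fix t assume t: "t \<in> tuples ?A m"
      define inC where "inC x \<longleftrightarrow> (\<forall>i\<in>{1..<k}. x i \<in> C)" for x
      \<comment> \<open>This pattern is invariant along arcs between tuples over \<open>C\<close>,
        because \<sigma> is injective.\<close>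
      define J where "J x = {i. i < m \<and> x (n + 1 + i) \<noteq> x 1}" for x :: "nat \<Rightarrow> 'a"
      \<comment> \<open>Ranks increase along arcs outside \<open>C\<close>, so the minimum is
        compatible with arcs there.\<close>
      define low where "low x = (ARG_MIN (\<lambda>i. \<rho> (x i)) i. i \<in> {1..<k} \<and> x i \<notin> C)" for x :: "nat \<Rightarrow> 'a"
      \<comment> \<open>Entry \<open>ix (t j) + 1\<close> of each column is \<open>t j\<close> if
        this is in \<open>C\<close>, the shift by one skipping row 0. If \<open>t j\<close> is
        outside \<open>C\<close>, it is returned only at tuples starting with the source
        \<open>p\<close>, which have no predecessors.\<close>
      define f where "f x = (if \<not> inC x then x (low x)
        else if \<exists>j<m. J x = {j} then
          (let j = the_elem (J x) in if t j \<in> C then x (ix (t j) + 1) else if x 0 = p then t j else x 1)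
        else x 1)" for x
      have k1: "1 < k" using n2 unfolding k_def by simp
      have low: "low x \<in> {1..<k} \<and> x (low x) \<notin> C \<and> (\<forall>i\<in>{1..<k}. x i \<notin> C \<longrightarrow> \<rho> (x (low x)) \<le> \<rho> (x i))"
        if nC: "\<not> inC x" for x
      proof -
        obtain i where i: "i \<in> {1..<k} \<and> x i \<notin> C" using nC unfolding inC_def by blast
        show ?thesis
          using arg_min_natI[of "\<lambda>i. i \<in> {1..<k} \<and> x i \<notin> C", OF i, of "\<lambda>i. \<rho> (x i)"]
            arg_min_nat_le[of "\<lambda>i. i \<in> {1..<k} \<and> x i \<notin> C" _ "\<lambda>i. \<rho> (x i)"]
          unfolding low_def[symmetric] by blast
      qed
      have fC: "f x \<in> C" if x: "inC x" "x 0 = p \<Longrightarrow> p \<in> C" and tt: "x \<in> tuples ?A k" for x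
      proof -
        have ixk: "ix c + 1 \<in> {1..<k}" if "c \<in> C" for c using ix[OF that] unfolding k_def by auto
        have "t j \<in> C" if "j < m" "x 0 = p" for j
          using x(2)[OF that(2)] p(2) tuples_mem[OF t that(1)] by auto
        then show ?thesis
          using x(1) k1 ixk unfolding f_def inC_def by (auto simp: Let_def)
      qed
      have fA: "f x \<in> ?A" if x: "x \<in> tuples ?A k" for x
      proof (cases "inC x")
        case False
        then show ?thesis using low[OF False] tuples_mem[OF x] unfolding f_def by auto
      next
        case True
        have "ix c + 1 < k" if "c \<in> C" for c using ix[OF that] unfolding k_def by auto
        then show ?thesis using tuples_mem[OF x] tuples_mem[OF t] k1 True unfolding f_def by (auto simp: Let_def)
      qed
      have "f \<in> id_Pol H k"
      proof (rule id_PolI)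
        show "f x \<in> ?A" if "x \<in> tuples ?A k" for x using that by (rule fA)
      next
        fix x y assume xt: "x \<in> tuples ?A k" and yt: "y \<in> tuples ?A k"
          and xy: "\<And>i. i < k \<Longrightarrow> (x i, y i) \<in> ?R"
        have "p \<in> C" if "y 0 = p" using xy[of 0] p(2) that k1 by auto
        then have fy: "f y \<in> C" if "inC y" using fC[OF that _ yt] by blast
        show "(f x, f y) \<in> ?R"
        proof (cases "inC x")
          case True
          have s: "y i = \<sigma> (x i) \<and> x i \<in> C" if "i \<in> {1..<k}" for i
          proof -
            have "(x i, y i) \<in> ?R" "x i \<in> C" using xy True that unfolding inC_def by auto
            then show ?thesis using out cyc(2) by blast
          qed
          have iy: "inC y" unfolding inC_def
          proof
            fix i assume "i \<in> {1..<k}"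
            then have "i < k" "x i \<in> C" using True unfolding inC_def by auto
            then show "y i \<in> C" using out xy by blast
          qed
          have JJ: "J y = J x"
          proof -
            have "x (n + 1 + i) = x 1 \<longleftrightarrow> y (n + 1 + i) = y 1" if "i < m" for i
            proof -
              have "n + 1 + i \<in> {1..<k}" "1 \<in> {1..<k}" using that k1 unfolding k_def by auto
              then show ?thesis using s cyc(1) unfolding inj_on_def by metis
            qed
            then show ?thesis unfolding J_def by blast
          qed
          show ?thesis
          proof (cases "\<exists>j<m. J x = {j}")
            case False
            then have "f x = x 1" "f y = y 1" using True iy JJ unfolding f_def by auto
            then show ?thesis using xy[OF k1] by simp
          next
            case jx: True
            then obtain j where j: "j < m" "J x = {j}" by blast
            have F: "f v = (if t j \<in> C then v (ix (t j) + 1) else if v 0 = p then t j else v 1)"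
              if "inC v" "J v = {j}" for v
              using that j(1) unfolding f_def by (auto simp: Let_def)
            note fx = F[OF True j(2)] and fy' = F[OF iy]
            show ?thesis
            proof (cases "t j \<in> C")
              case True
              then have "ix (t j) + 1 < k" using ix unfolding k_def by force
              then show ?thesis using fx fy' JJ j(2) True xy by simp
            next
              case False
              have y0: "y 0 \<noteq> p" using p(2) xy[of 0] k1 False tuples_mem[OF t j(1)] by auto
              have fy1: "f y = y 1" using fy' JJ j(2) False y0 by simp
              have y1C: "y 1 \<in> C" using fy1 fy[OF iy] by simp
              show ?thesis
              proof (cases "x 0 = p")
                case True
                then have "f x = t j" using fx False by simp
                then show ?thesis using above[of "t j"] False tuples_mem[OF t j(1)] y1C fy1 by simp
              next
                case neq: False
                then have "f x = x 1" using fx False by simp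
                then show ?thesis using fy1 xy[OF k1] by simp
              qed
            qed
          qed
        next
          case False
          note lx = low[OF False]
          have fx: "f x = x (low x)" using False unfolding f_def by simp
          have fxP: "f x \<in> ?A - C" using lx fA[OF xt] fx by simp
          show ?thesis
          proof (cases "inC y")
            case True
            then show ?thesis using above[OF fxP fy] by blast
          next
            case yn: False
            note ly = low[OF yn]
            have fy2: "f y = y (low y)" using yn unfolding f_def by simp
            have fyP: "f y \<in> ?A - C" using ly fA[OF yt] fy2 by simp
            let ?i = "low y"
            have arc: "(x ?i, y ?i) \<in> ?R" using ly xy by simp
            then have xi: "x ?i \<in> ?A - C" using out ly R_V by blast
            have "\<rho> (f x) \<le> \<rho> (x ?i)" using lx ly xi fx by simp
            also have "\<dots> < \<rho> (f y)" using rank[OF xi _ arc] fyP fy2 by simp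
            finally have lt: "\<rho> (f x) < \<rho> (f y)" .
            \<comment> \<open>The ranks exclude equality and the reverse arc; semicompleteness
              supplies the arc itself.\<close>
            then have "(f y, f x) \<notin> ?R" "f x \<noteq> f y" using rank[OF fyP fxP] by auto
            then show ?thesis using total[of "f x" "f y"] fxP fyP by blast
          qed
        qed
      next
        fix a assume a: "a \<in> ?A"
        let ?a = "\<lambda>i\<in>{..<k}. a"
        show "f ?a = a"
        proof (cases "a \<in> C")
          case True
          have "J ?a = {}" unfolding J_def k_def using n2 by auto
          moreover have "inC ?a" unfolding inC_def using True by auto
          ultimately show ?thesis using k1 unfolding f_def by auto
        next
          case False
          then have ni: "\<not> inC ?a" unfolding inC_def using k1 by force
          then show ?thesis using low[OF ni] unfolding f_def by auto
        qed
      qed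
      moreover have "f (\<lambda>i\<in>{..<k}. r i j) = t j" if j: "j < m" for j
      proof -
        define X where "X = (\<lambda>i\<in>{..<k}. r i j)"
        have xi: "X i = (if i = 0 then p else if i \<le> n then e (i - 1)
            else if i = n + 1 + j then e 1 else e 0)" if "i < k" for i
          using that j unfolding X_def r_def by simp
        have iC: "inC X"
          unfolding inC_def
        proof
          fix i assume i: "i \<in> {1..<k}"
          then have "X i = (if i \<le> n then e (i - 1) else if i = n + 1 + j then e 1 else e 0)"
            using xi[of i] by auto
          moreover have "e 0 \<in> C" "e 1 \<in> C" using eC n2 by auto
          moreover have "i \<le> n \<Longrightarrow> e (i - 1) \<in> C" using eC[of "i - 1"] i by auto
          ultimately show "X i \<in> C" by auto
        qed
        have x1: "X 1 = e 0" using xi[OF k1] n2 by simp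
        have "X (n + 1 + i) \<noteq> X 1 \<longleftrightarrow> i = j" if "i < m" for i
          using xi[of "n + 1 + i"] that x1 e01 unfolding k_def by auto
        then have Jx: "J X = {j}" unfolding J_def using j by blast
        have x0: "X 0 = p" using xi[of 0] k1 by simp
        have "X (ix c + 1) = c" if "c \<in> C" for c
          using xi[of "ix c + 1"] ix[OF that] unfolding k_def by auto
        then show ?thesis unfolding X_def[symmetric] f_def using iC Jx j x0 by (auto simp: Let_def)
      qed
      ultimately show "\<exists>f\<in>id_Pol H k. \<forall>j<m. f (\<lambda>i\<in>{..<k}. r i j) = t j" by blast
    qed
  qed
qed

section \<open>The exponential lower bound\<close>

lemma EGP_avoiding:
  assumes fin: "finite (pverts H)" and two: "2 \<le> card (pverts H)"
    and g: "\<And>v. v \<in> pverts H \<Longrightarrow> g v \<in> pverts H"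
    and avoid: "\<And>k f. f \<in> id_Pol H k \<Longrightarrow> \<exists>i<k. \<forall>x\<in>tuples (pverts H) k. f x \<noteq> g (x i)"
  shows "EGP (pverts H) (id_Pol H)"
proof -
  let ?A = "pverts H"
  define a where "a = card ?A"
  \<comment> \<open>The base comes from the covering bound
    \<open>a ^ m \<le> card S * (a - 1) ^ m\<close>.\<close>
  define b where "b = real a / real (a - 1)"
  have b1: "b > 1" using two unfolding b_def a_def by (simp add: field_simps of_nat_diff)
  have bound: "b ^ m \<le> real (min_generating_size ?A (id_Pol H) m)" for m
  proof -
    let ?P = "\<lambda>n. \<exists>S. finite S \<and> generates ?A (id_Pol H) m S \<and> card S = n"
    have "?P (card (tuples ?A m))" using generates_tuples finite_tuples[OF fin] by blast
    then have "?P (min_generating_size ?A (id_Pol H) m)"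
      unfolding min_generating_size_def by (rule LeastI)
    then obtain S where S: "finite S" "generates ?A (id_Pol H) m S" "card S = min_generating_size ?A (id_Pol H) m"
      by blast
    \<comment> \<open>\<open>T s\<close> contains every result of an operation whose coordinate
      given by \<open>avoid\<close> receives the generator \<open>s\<close>.\<close>
    define T where "T s = (\<Pi>\<^sub>E j\<in>{..<m}. ?A - {g (s j)})" for s
    have cT: "card (T s) = (a - 1) ^ m" if "s \<in> S" for s
    proof -
      have "s \<in> tuples ?A m" using S(2) that unfolding generates_def by blast
      then have "card (?A - {g (s j)}) = a - 1" if "j < m" for j
        using g tuples_mem[of s ?A m j] that fin unfolding a_def by simp
      then show ?thesis unfolding T_def by (simp add: card_PiE)
    qed
    have "tuples ?A m \<subseteq> (\<Union>s\<in>S. T s)"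
    proof
      fix t assume t: "t \<in> tuples ?A m"
      then obtain k f s where kf: "f \<in> id_Pol H k" "\<forall>i<k. s i \<in> S" "t = apply_coordinatewise f k m s"
        using S(2) unfolding generates_def by blast
      obtain i where i: "i < k" "\<forall>x\<in>tuples ?A k. f x \<noteq> g (x i)" using avoid[OF kf(1)] by blast
      have "t j \<noteq> g (s i j)" if j: "j < m" for j
      proof -
        have "s i' j \<in> ?A" if "i' < k" for i'
          using kf(2) S(2) j that tuples_mem[of "s i'" ?A m] unfolding generates_def by blast
        then have "(\<lambda>i\<in>{..<k}. s i j) \<in> tuples ?A k" unfolding tuples_def by auto
        then have "f (\<lambda>i\<in>{..<k}. s i j) \<noteq> g (s i j)" using i by fastforce
        then show ?thesis using j unfolding kf(3) apply_coordinatewise_def by simp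
      qed
      then have "t \<in> T (s i)" using t unfolding T_def tuples_def by auto
      then show "t \<in> (\<Union>s\<in>S. T s)" using kf(2) i(1) by blast
    qed
    moreover have "finite (\<Union>s\<in>S. T s)" using S(1) fin unfolding T_def by (auto intro: finite_PiE)
    ultimately have "card (tuples ?A m) \<le> card (\<Union>s\<in>S. T s)" by (rule card_mono[rotated])
    also have "\<dots> \<le> (\<Sum>s\<in>S. card (T s))" by (rule card_UN_le[OF S(1)])
    also have "\<dots> = card S * (a - 1) ^ m" using cT by simp
    finally have "a ^ m \<le> card S * (a - 1) ^ m" by (simp add: card_tuples a_def)
    then have "real (a ^ m) \<le> real (card S * (a - 1) ^ m)" by (rule of_nat_mono)
    moreover have "real (a - 1) ^ m > 0" using two unfolding a_def by simp
    ultimately show ?thesis unfolding S(3)[symmetric] b_def power_divide by (simp add: field_simps)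
  qed
  have "(\<lambda>m. real (min_generating_size ?A (id_Pol H) m)) \<in> \<Omega>(\<lambda>m. b ^ m)"
  proof (rule landau_omega.bigI[where c = 1])
    show "eventually (\<lambda>m. norm (real (min_generating_size ?A (id_Pol H) m)) \<ge> 1 * norm (b ^ m)) at_top"
      using bound b1 by (intro always_eventually allI) simp
  qed simp
  then show ?thesis unfolding EGP_def using b1 by blast
qed

section \<open>Cycles\<close>

context
  fixes H :: "'a pair_pre_digraph"
begin

abbreviation (input) "cas \<equiv> pre_digraph.cas (with_proj H)"

lemma cas_simps [simp]:
  "cas u [] v \<longleftrightarrow> u = v" "cas u (e # p) v \<longleftrightarrow> fst e = u \<and> cas (snd e) p v"
  by (simp_all add: pre_digraph.cas.simps)

lemma cas_reach: "cas u p v \<Longrightarrow> (u, v) \<in> (set p)\<^sup>*"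
proof (induction p arbitrary: u)
  case (Cons e p)
  then have "(snd e, v) \<in> (set p)\<^sup>*" by simp
  then have "(snd e, v) \<in> (set (e # p))\<^sup>*" by (rule rtrancl_mono[THEN subsetD, rotated]) auto
  moreover have "(u, snd e) \<in> set (e # p)" using Cons.prems by (cases e) auto
  ultimately show ?case by (rule converse_rtrancl_into_rtrancl[rotated])
qed simp

lemma cas_reach_arc: "cas u p v \<Longrightarrow> e \<in> set p \<Longrightarrow> (u, fst e) \<in> (set p)\<^sup>* \<and> (snd e, v) \<in> (set p)\<^sup>*"
proof (induction p arbitrary: u)
  case (Cons d p)
  have mono: "(set p)\<^sup>* \<subseteq> (set (d # p))\<^sup>*" by (rule rtrancl_mono) auto
  have c: "cas (snd d) p v" "fst d = u" using Cons.prems by auto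
  have ud: "(u, snd d) \<in> set (d # p)" using c by (cases d) auto
  show ?case
  proof (cases "e = d")
    case True
    then show ?thesis using cas_reach[OF c(1)] mono c(2) by auto
  next
    case False
    then have "(snd d, fst e) \<in> (set p)\<^sup>* \<and> (snd e, v) \<in> (set p)\<^sup>*" using Cons.IH[OF c(1)] Cons.prems by simp
    then have "(snd d, fst e) \<in> (set (d # p))\<^sup>*" "(snd e, v) \<in> (set (d # p))\<^sup>*" using mono by auto
    then show ?thesis using ud by (auto intro: converse_rtrancl_into_rtrancl simp del: list.set)
  qed
qed simp

lemma cas_tail: "cas u p v \<Longrightarrow> e \<in> set p \<Longrightarrow> fst e = u \<or> fst e \<in> snd ` set p"
  by (induction p arbitrary: u) auto

lemma cas_last: "cas u p v \<Longrightarrow> p \<noteq> [] \<Longrightarrow> v \<in> snd ` set p"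
proof (induction p arbitrary: u)
  case (Cons e p)
  then show ?case by (cases "p = []") auto
qed simp

lemma cas_prefix: "cas u (p @ e # q) w \<Longrightarrow> cas u (p @ [e]) (snd e)"
  by (induction p arbitrary: u) auto

lemma cas_snoc: "cas u p y \<Longrightarrow> cas u (p @ [(y, z)]) z"
  by (induction p arbitrary: u) auto

text \<open>When a vertex recurs, the path is cut back to its earlier visit. Including
  \<open>v\<close> in the distinct list lets \<open>cycle_through\<close> close the path by an arc
  into \<open>v\<close>.\<close>

lemma simple_path:
  "(v, u) \<in> T\<^sup>* \<Longrightarrow> \<exists>p. cas v p u \<and> set p \<subseteq> T \<and> distinct (v # map snd p)"
proof (induction rule: rtrancl_induct)
  case base
  show ?case by (rule exI[of _ "[]"]) simp
next
  case (step y z)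
  then obtain p where p: "cas v p y" "set p \<subseteq> T" "distinct (v # map snd p)" by blast
  consider "z = v" | "z \<noteq> v" "z \<in> snd ` set p" | "z \<noteq> v" "z \<notin> snd ` set p" by blast
  then show ?case
  proof cases
    case 1
    then show ?thesis by (intro exI[of _ "[]"]) simp
  next
    case 2
    then obtain e where e: "e \<in> set p" "snd e = z" by blast
    then obtain q r where qr: "p = q @ e # r" by (meson split_list)
    then have "cas v (q @ [e]) z" using p(1) cas_prefix e(2) by metis
    then show ?thesis using p(2,3) qr by (intro exI[of _ "q @ [e]"]) auto
  next
    case 3
    then show ?thesis using cas_snoc[OF p(1), of z] p(2,3) step.hyps(2)
      by (intro exI[of _ "p @ [(y, z)]"]) auto
  qed
qed

lemma cycle_iff:
  "pre_digraph.cycle (with_proj H) p \<longleftrightarrow>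
    p \<noteq> [] \<and> set p \<subseteq> parcs H \<and> distinct (map snd p) \<and> (\<exists>u\<in>pverts H. cas u p u)"
proof -
  have verts: "tl (pre_digraph.awalk_verts (with_proj H) u p) = map snd p" if "cas u p u" "p \<noteq> []" for u
    using pre_digraph.awalk_verts_conv'[OF that(1)] that(2) by simp
  show ?thesis
    unfolding pre_digraph.cycle_def pre_digraph.awalk_def using verts by auto
qed

end

context semicomplete_rel
begin

lemma unicyclic_converse:
  assumes "unicyclic" shows "semicomplete_rel.unicyclic V (R\<inverse>)"
proof -
  interpret c: semicomplete_rel V "R\<inverse>" by (rule converse)
  have "\<not> branching (R\<inverse>) S" if "S \<subseteq> V" "strong R S" "2 \<le> card S" for S
    using c.branching_converse[of S] assms that unfolding unicyclic_def by auto
  then show ?thesis using assms unfolding c.unicyclic_def unicyclic_def by simp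
qed

end

text \<open>On a closed walk every tail is also a head, so the heads are all its vertices.\<close>

lemma cycle_strong:
  assumes sc: "semicomplete_rel (pverts H) (parcs H)" and p: "pre_digraph.cycle (with_proj H) p"
  shows "snd ` set p \<subseteq> pverts H" "strong (parcs H) (snd ` set p)" "2 \<le> card (snd ` set p)"
    "set p \<subseteq> snd ` set p \<times> snd ` set p"
proof -
  interpret semicomplete_rel "pverts H" "parcs H" by (rule sc)
  let ?S = "snd ` set p"
  obtain u where u: "p \<noteq> []" "set p \<subseteq> parcs H" "pre_digraph.cas (with_proj H) u p u"
    using p unfolding cycle_iff by blast
  show SV: "?S \<subseteq> pverts H" using u(2) R_sub by auto
  have fs: "fst e \<in> ?S" if "e \<in> set p" for e
    using cas_tail[OF u(3) that] cas_last[OF u(3,1)] by auto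
  then show sub: "set p \<subseteq> ?S \<times> ?S" by force
  have "(x, y) \<in> (parcs H \<inter> ?S \<times> ?S)\<^sup>*" if xy: "x \<in> ?S" "y \<in> ?S" for x y
  proof -
    obtain d e where de: "d \<in> set p" "x = snd d" "e \<in> set p" "y = snd e" using xy by blast
    have "(x, u) \<in> (set p)\<^sup>*" "(u, fst e) \<in> (set p)\<^sup>*" "(fst e, y) \<in> set p"
      using cas_reach_arc[OF u(3)] de by auto
    then have "(x, y) \<in> (set p)\<^sup>*" by (meson rtrancl.rtrancl_into_rtrancl rtrancl_trans)
    then show ?thesis by (rule rtrancl_mono[THEN subsetD, rotated]) (use u(2) sub in blast)
  qed
  moreover have "?S \<noteq> {}" using u(1) by simp
  ultimately show "strong (parcs H) ?S" unfolding strong_def by blast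
  obtain e where e: "e \<in> set p" using u(1) by (meson hd_in_set)
  then have "(fst e, snd e) \<in> parcs H" using u(2) by auto
  then have "fst e \<noteq> snd e" using irrefl by metis
  then show "2 \<le> card ?S" using card_ge_2[OF SV fs[OF e], of "snd e"] e by blast
qed

lemma cycle_through:
  assumes "strong (parcs H) S" "S \<subseteq> pverts H" "u \<in> S" "v \<in> S" "(u, v) \<in> parcs H"
  obtains p where "pre_digraph.cycle (with_proj H) p" "(u, v) \<in> set p" "set p \<subseteq> S \<times> S"
proof -
  have "(v, u) \<in> (parcs H \<inter> S \<times> S)\<^sup>*" using assms unfolding strong_def by blast
  from simple_path[OF this, of H] obtain p where p: "pre_digraph.cas (with_proj H) v p u"
      "set p \<subseteq> parcs H \<inter> S \<times> S" "distinct (v # map snd p)"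
    by blast
  have "pre_digraph.cycle (with_proj H) ((u, v) # p)"
    unfolding cycle_iff using p assms by auto
  then show ?thesis by (rule that) (use p assms in auto)
qed

text \<open>If the digraph is unicyclic, a cycle consists of all arcs between its vertices, and
  these form the only nontrivial strong set. Conversely, branching yields, through
  \<open>branching_converse\<close>, two arcs into one vertex; cycles through them differ, as the
  heads of a cycle are distinct.\<close>

lemma at_most_one_cycle_iff_unicyclic:
  assumes sc: "semicomplete_rel (pverts H) (parcs H)"
  shows "at_most_one_cycle H \<longleftrightarrow> semicomplete_rel.unicyclic (pverts H) (parcs H)"
proof -
  interpret semicomplete_rel "pverts H" "parcs H" by (rule sc)
  let ?cycle = "pre_digraph.cycle (with_proj H)"
  have amoc: "at_most_one_cycle H \<longleftrightarrow> (\<forall>p q. ?cycle p \<longrightarrow> ?cycle q \<longrightarrow> set p = set q)"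
    unfolding at_most_one_cycle_def cycles_of_def by blast
  show ?thesis
  proof
    assume u: "unicyclic"
    have "set p = parcs H \<inter> (snd ` set p) \<times> (snd ` set p)" if p: "?cycle p" for p
    proof
      let ?S = "snd ` set p"
      note S = cycle_strong[OF sc p]
      have pR: "set p \<subseteq> parcs H" using p unfolding cycle_iff by blast
      show "set p \<subseteq> parcs H \<inter> ?S \<times> ?S" using pR S(4) by blast
      have nb: "\<not> branching (parcs H) ?S" using u S unfolding unicyclic_def by blast
      show "parcs H \<inter> ?S \<times> ?S \<subseteq> set p"
      proof
        fix e assume e: "e \<in> parcs H \<inter> ?S \<times> ?S"
        obtain x y where xy: "e = (x, y)" by (cases e)
        have "\<exists>z. (x, z) \<in> set p"
        proof (rule ccontr)
          assume none: "\<not> ?thesis"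
          obtain u where u: "p \<noteq> []" "pre_digraph.cas (with_proj H) u p u"
            using p unfolding cycle_iff by blast
          obtain d where d: "d \<in> set p" "snd d = x" using e xy by auto
          \<comment> \<open>Without an outgoing arc in \<open>p\<close>, \<open>x\<close> reaches
            only itself and must be the base point \<open>u\<close>, where the first arc of
            \<open>p\<close> starts.\<close>
          have "(x, u) \<in> (set p)\<^sup>*" using cas_reach_arc[OF u(2) d(1)] d(2) by blast
          then have "x = u" using none by (auto elim: converse_rtranclE)
          moreover have "fst (hd p) = u" "hd p \<in> set p" using u by (cases p; simp)+
          ultimately show False using none by (metis prod.collapse)
        qed
        then obtain z where z: "(x, z) \<in> set p" by blast
        then have "(x, z) \<in> parcs H" "z \<in> ?S" using pR by force+
        then have "z = y" using nb e xy unfolding branching_def by blast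
        then show "e \<in> set p" using z xy by simp
      qed
    qed
    moreover have "snd ` set p = snd ` set q" if "?cycle p" "?cycle q" for p q
      using u cycle_strong(1-3)[OF sc that(1)] cycle_strong(1-3)[OF sc that(2)] unfolding unicyclic_def by blast
    ultimately show "at_most_one_cycle H" unfolding amoc by metis
  next
    assume "at_most_one_cycle H"
    then have one: "set p = set q" if "?cycle p" "?cycle q" for p q using that unfolding amoc by blast
    have nb: "\<not> branching (parcs H) S" if S: "S \<subseteq> pverts H" "strong (parcs H) S" for S
    proof
      assume "branching (parcs H) S"
      then have "branching ((parcs H)\<inverse>) S" by (rule branching_converse[OF S])
      then obtain v x y where v: "v \<in> S" "x \<in> S" "y \<in> S" "x \<noteq> y" "(x, v) \<in> parcs H" "(y, v) \<in> parcs H"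
        unfolding branching_def by auto
      obtain p where p: "?cycle p" "(x, v) \<in> set p" using cycle_through[OF S(2,1) v(2,1,5)] by blast
      obtain q where q: "?cycle q" "(y, v) \<in> set q" using cycle_through[OF S(2,1) v(3,1,6)] by blast
      have "(y, v) \<in> set p" using one[OF p(1) q(1)] q(2) by blast
      moreover have "inj_on snd (set p)" using p(1) unfolding cycle_iff by (simp add: distinct_map)
      ultimately show False using inj_onD[of snd "set p" "(x, v)" "(y, v)"] p(2) v(4) by simp
    qed
    have cover: "\<exists>p. ?cycle p \<and> snd ` set p = S" if S: "S \<subseteq> pverts H" "strong (parcs H) S" "2 \<le> card S" for S
    proof -
      obtain x where x: "x \<in> S" using S(2) unfolding strong_def by blast
      obtain y where y: "y \<in> S" "(x, y) \<in> parcs H" using strong_succ[OF S(2,3) x] by blast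
      obtain p where p: "?cycle p" "(x, y) \<in> set p" "set p \<subseteq> S \<times> S"
        using cycle_through[OF S(2,1) x y] by blast
      note c = cycle_strong[OF sc p(1)]
      have "snd ` set p \<subseteq> S" using p(3) by auto
      then show ?thesis using strong_subset_branching[OF c(2,3) S(2)] nb[OF S(1,2)] p(1) by blast
    qed
    have "S = S'" if SS: "S \<subseteq> pverts H" "strong (parcs H) S" "2 \<le> card S"
      "S' \<subseteq> pverts H" "strong (parcs H) S'" "2 \<le> card S'" for S S'
    proof -
      obtain p q where "?cycle p" "snd ` set p = S" "?cycle q" "snd ` set q = S'"
        using cover[OF SS(1-3)] cover[OF SS(4-6)] by blast
      then show ?thesis using one by metis
    qed
    then show "unicyclic" unfolding unicyclic_def using nb by blast
  qed
qed

section \<open>The dichotomy\<close>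

lemma PGP_no_sink:
  assumes sc: "semicomplete_rel (pverts H) (parcs H)"
    and uni: "semicomplete_rel.unicyclic (pverts H) (parcs H)"
    and ne: "pverts H \<noteq> {}" and sink: "\<And>v. v \<in> pverts H \<Longrightarrow> \<exists>w. (v, w) \<in> parcs H"
  shows "PGP (pverts H) (id_Pol H)"
proof -
  interpret semicomplete_rel "pverts H" "parcs H" by (rule sc)
  let ?A = "pverts H" and ?R = "parcs H"
  obtain L where L: "L \<subseteq> ?A" "strong ?R L" "2 \<le> card L" "\<And>x y. x \<in> L \<Longrightarrow> (x, y) \<in> ?R \<Longrightarrow> y \<in> L"
      "\<And>v x. v \<in> ?A - L \<Longrightarrow> x \<in> L \<Longrightarrow> (v, x) \<in> ?R"
    by (rule terminal_component[OF ne sink]) auto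
  have nb: "\<not> branching ?R L" using uni L(1-3) unfolding unicyclic_def by blast
  obtain \<sigma> where s: "bij_betw \<sigma> L L" "\<forall>x\<in>L. \<forall>y\<in>L. (x, y) \<in> ?R \<longleftrightarrow> y = \<sigma> x"
    using nonbranching_cycle[OF L(1-3) nb] by blast
  let ?T = "?R \<inter> (?A - L) \<times> (?A - L)"
  \<comment> \<open>This counts ancestors outside \<open>L\<close>. There are no closed walks
    outside \<open>L\<close>, as they would yield a second nontrivial strong set, so the count
    increases strictly along arcs.\<close>
  define \<rho> where "\<rho> x = card {q. (q, x) \<in> ?T\<^sup>+}" for x
  have acyc: "(x, x) \<notin> ?T\<^sup>+" for x
  proof
    assume xx: "(x, x) \<in> ?T\<^sup>+"
    then have x: "x \<in> ?A - L" by (auto dest: tranclD)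
    have "(x, x) \<in> ?R\<^sup>+" using xx by (rule trancl_mono) blast
    then have "2 \<le> card {v. (x, v) \<in> ?R\<^sup>* \<and> (v, x) \<in> ?R\<^sup>*}" by (rule scc_card)
    moreover have "{v. (x, v) \<in> ?R\<^sup>* \<and> (v, x) \<in> ?R\<^sup>*} \<subseteq> ?A" using reach_V x by blast
    moreover have "strong ?R {v. (x, v) \<in> ?R\<^sup>* \<and> (v, x) \<in> ?R\<^sup>*}" using scc_strong x by blast
    ultimately have "{v. (x, v) \<in> ?R\<^sup>* \<and> (v, x) \<in> ?R\<^sup>*} = L" using uni L(1-3) unfolding unicyclic_def by blast
    then show False using x by blast
  qed
  show ?thesis
  proof (rule PGP_cycle[OF sc L(1,3)])
    show "y \<in> L" if "x \<in> L" "(x, y) \<in> ?R" for x y using that by (rule L(4))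
    show "inj_on \<sigma> L" using s(1) by (rule bij_betw_imp_inj_on)
    show "(x, y) \<in> ?R \<longleftrightarrow> y = \<sigma> x" if "x \<in> L" "y \<in> L" for x y using s(2) that by blast
    show "(x, y) \<in> ?R" if "x \<in> ?A - L" "y \<in> L" for x y using that by (rule L(5))
    show "\<rho> x < \<rho> y" if xy: "x \<in> ?A - L" "y \<in> ?A - L" "(x, y) \<in> ?R" for x y
      unfolding \<rho>_def
    proof (rule psubset_card_mono)
      have "{q. (q, y) \<in> ?T\<^sup>+} \<subseteq> ?A" by (auto dest: tranclD)
      then show "finite {q. (q, y) \<in> ?T\<^sup>+}" using finite_V finite_subset by blast
      have T: "(x, y) \<in> ?T" using xy by blast
      then have "{q. (q, x) \<in> ?T\<^sup>+} \<subseteq> {q. (q, y) \<in> ?T\<^sup>+}" by (auto intro: trancl_into_trancl)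
      moreover have "x \<in> {q. (q, y) \<in> ?T\<^sup>+}" using T by blast
      ultimately show "{q. (q, x) \<in> ?T\<^sup>+} \<subset> {q. (q, y) \<in> ?T\<^sup>+}" using acyc by blast
    qed
  qed
qed

lemma id_Pol_imp_idempotent_polymorphism:
  assumes R: "parcs H \<subseteq> pverts H \<times> pverts H" and f: "f \<in> id_Pol H k"
  shows "idempotent_polymorphism (pverts H) (parcs H) k (\<lambda>x. f (restrict x {..<k}))"
proof -
  have tup: "restrict x {..<k} \<in> tuples (pverts H) k" if "\<forall>i. x i \<in> pverts H" for x
    using that unfolding tuples_def by auto
  have pol: "polymorphism H k f" and idem: "\<forall>a\<in>pverts H. f (\<lambda>i\<in>{..<k}. a) = a"
    using f unfolding id_Pol_def idempotent_def by auto
  have "f (restrict x {..<k}) \<in> pverts H" if "\<forall>i. x i \<in> pverts H" for x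
    using pol tup[OF that] unfolding polymorphism_def by blast
  moreover have "(f (restrict x {..<k}), f (restrict y {..<k})) \<in> parcs H" if xy: "\<forall>i. (x i, y i) \<in> parcs H" for x y
  proof -
    have "\<forall>i. x i \<in> pverts H" "\<forall>i. y i \<in> pverts H" using xy R by blast+
    then show ?thesis using pol tup xy unfolding polymorphism_def by simp
  qed
  moreover have "f (restrict x {..<k}) = f (restrict y {..<k})" if "\<forall>i<k. x i = y i" for x y
  proof -
    have "restrict x {..<k} = restrict y {..<k}" using that by (intro restrict_ext) auto
    then show ?thesis by simp
  qed
  ultimately show ?thesis unfolding idempotent_polymorphism_def using idem by blast
qed

lemma EGP_no_sink:
  assumes sc: "semicomplete_rel (pverts H) (parcs H)"
    and nu: "\<not> semicomplete_rel.unicyclic (pverts H) (parcs H)"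
    and sink: "\<And>v. v \<in> pverts H \<Longrightarrow> \<exists>w. (v, w) \<in> parcs H"
  shows "EGP (pverts H) (id_Pol H)"
proof -
  interpret semicomplete_rel "pverts H" "parcs H" by (rule sc)
  let ?A = "pverts H"
  obtain S where S: "S \<subseteq> ?A" "2 \<le> card S" using nu unfolding unicyclic_def by blast
  have two: "2 \<le> card ?A" using card_mono[OF finite_V S(1)] S(2) by simp
  then obtain a where a: "a \<in> ?A" by fastforce
  obtain g where g: "\<forall>v\<in>?A. g v \<in> ?A" and avoid: "\<forall>n F. idempotent_polymorphism ?A (parcs H) n F \<longrightarrow>
      (\<exists>i<n. \<forall>x. (\<forall>j. x j \<in> ?A) \<longrightarrow> F x \<noteq> g (x i))"
    using no_sink_avoids[OF nu sink] by blast
  show ?thesis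
  proof (rule EGP_avoiding[OF finite_V two])
    show "g v \<in> ?A" if "v \<in> ?A" for v using g that by blast
    fix k f assume "f \<in> id_Pol H k"
    then have "idempotent_polymorphism ?A (parcs H) k (\<lambda>x. f (restrict x {..<k}))"
      by (rule id_Pol_imp_idempotent_polymorphism[OF R_sub])
    then obtain i where i: "i < k" "\<forall>x. (\<forall>j. x j \<in> ?A) \<longrightarrow> f (restrict x {..<k}) \<noteq> g (x i)"
      using avoid by blast
    have "f x \<noteq> g (x i)" if x: "x \<in> tuples ?A k" for x
    proof -
      \<comment> \<open>Padding by an arbitrary vertex turns the tuple into an infinite sequence
        over \<open>?A\<close>.\<close>
      define x' where "x' j = (if j < k then x j else a)" for j
      have "\<forall>j. x' j \<in> ?A" using tuples_mem[OF x] a unfolding x'_def by simp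
      moreover have "restrict x' {..<k} = x"
        using x unfolding x'_def tuples_def by (intro ext) (auto simp: PiE_def extensional_def)
      moreover have "x' i = x i" using i(1) unfolding x'_def by simp
      ultimately show ?thesis using i(2) by metis
    qed
    then show "\<exists>i<k. \<forall>x\<in>tuples ?A k. f x \<noteq> g (x i)" using i(1) by blast
  qed
qed

definition reverse :: "'a pair_pre_digraph \<Rightarrow> 'a pair_pre_digraph" where
  "reverse H = \<lparr>pverts = pverts H, parcs = (parcs H)\<inverse>\<rparr>"

lemma reverse_simps [simp]: "pverts (reverse H) = pverts H" "parcs (reverse H) = (parcs H)\<inverse>"
  by (simp_all add: reverse_def)

lemma id_Pol_reverse: "id_Pol (reverse H) = id_Pol H"
proof -
  have "polymorphism (reverse H) k f \<longleftrightarrow> polymorphism H k f" for k and f :: "'a operation"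
    unfolding polymorphism_def by auto
  then show ?thesis unfolding id_Pol_def by auto
qed

lemma semicomplete_digraph_imp_rel:
  assumes "semicomplete_digraph H"
  shows "semicomplete_rel (pverts H) (parcs H)"
proof -
  interpret semicomplete_digraph H by (rule assms)
  show ?thesis
  proof
    show "finite (pverts H)" by simp
    show "parcs H \<subseteq> pverts H \<times> pverts H" using arc_fst_in_verts arc_snd_in_verts by fastforce
    show "(x, x) \<notin> parcs H" for x using no_loops by fastforce
    show "(x, y) \<in> parcs H \<or> (y, x) \<in> parcs H" if "x \<in> pverts H" "y \<in> pverts H" "x \<noteq> y" for x y
      using that by (rule semicomplete)
  qed
qed

lemma
  assumes "semicomplete_rel (pverts H) (parcs H)"
  shows is_source_iff: "is_source H v \<longleftrightarrow> v \<in> pverts H \<and> (\<forall>x. (x, v) \<notin> parcs H)"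
    and is_sink_iff: "is_sink H v \<longleftrightarrow> v \<in> pverts H \<and> (\<forall>x. (v, x) \<notin> parcs H)"
proof -
  interpret semicomplete_rel "pverts H" "parcs H" by (rule assms)
  \<comment> \<open>Degrees are cardinalities, so degree zero expresses the absence of arcs only for
    finite arc sets.\<close>
  have "finite (parcs H)" using R_sub finite_V by (meson finite_SigmaI finite_subset)
  then have "finite (in_arcs (with_proj H) v)" "finite (out_arcs (with_proj H) v)"
    unfolding in_arcs_def out_arcs_def by simp_all
  then show "is_source H v \<longleftrightarrow> v \<in> pverts H \<and> (\<forall>x. (x, v) \<notin> parcs H)"
    and "is_sink H v \<longleftrightarrow> v \<in> pverts H \<and> (\<forall>x. (v, x) \<notin> parcs H)"
    unfolding is_source_def is_sink_def in_degree_def out_degree_def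
    by (auto simp: in_arcs_def out_arcs_def)
qed

theorem theorem2:
  fixes H :: "'a pair_pre_digraph"
  assumes "semicomplete_digraph H"
  shows "(at_most_one_cycle H \<or> ((\<exists>v. is_source H v) \<and> (\<exists>w. is_sink H w))
            \<longrightarrow> PGP (pverts H) (id_Pol H))
       \<and> (\<not> (at_most_one_cycle H \<or> ((\<exists>v. is_source H v) \<and> (\<exists>w. is_sink H w)))
            \<longrightarrow> EGP (pverts H) (id_Pol H))"
proof -
  have sc: "semicomplete_rel (pverts H) (parcs H)" by (rule semicomplete_digraph_imp_rel[OF assms])
  interpret semicomplete_rel "pverts H" "parcs H" by (rule sc)
  interpret rev: semicomplete_rel "pverts H" "(parcs H)\<inverse>" by (rule converse)
  have rsc: "semicomplete_rel (pverts (reverse H)) (parcs (reverse H))" using converse by simp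
  note amoc = at_most_one_cycle_iff_unicyclic[OF sc]
  note src = is_source_iff[OF sc] and snk = is_sink_iff[OF sc]
  have sinks: "\<exists>w. (v, w) \<in> parcs H" if "\<nexists>w. is_sink H w" "v \<in> pverts H" for v
    using that snk by blast
  have sources: "\<exists>w. (v, w) \<in> parcs (reverse H)" if "\<nexists>w. is_source H w" "v \<in> pverts (reverse H)" for v
    using that src by auto
  have "PGP (pverts H) (id_Pol H)"
    if *: "at_most_one_cycle H \<or> ((\<exists>v. is_source H v) \<and> (\<exists>w. is_sink H w))"
  proof (cases "card (pverts H) \<le> 1")
    case True
    then show ?thesis by (rule PGP_trivial[OF finite_V])
  next
    case False
    then have ne: "pverts H \<noteq> {}" by auto
    show ?thesis
    proof (cases "(\<exists>v. is_source H v) \<and> (\<exists>w. is_sink H w)")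
      case True
      then obtain a b where a: "a \<in> pverts H" "\<And>x. (x, a) \<notin> parcs H"
        and b: "b \<in> pverts H" "\<And>x. (b, x) \<notin> parcs H"
        using src snk by blast
      have "a \<noteq> b"
      proof
        assume "a = b"
        then have "pverts H = {a}" using a b total by blast
        then show False using False by simp
      qed
      then show ?thesis using PGP_source_sink[OF R_sub a(1) b(1)] a(2) b(2) by blast
    next
      case nss: False
      then have uni: unicyclic using * amoc by blast
      show ?thesis
      proof (cases "\<exists>w. is_sink H w")
        case False
        then show ?thesis using PGP_no_sink[OF sc uni ne sinks] by blast
      next
        case True
        then have "\<nexists>w. is_source H w" using nss by blast
        moreover have "semicomplete_rel.unicyclic (pverts (reverse H)) (parcs (reverse H))"
          using unicyclic_converse[OF uni] by simp
        ultimately have "PGP (pverts (reverse H)) (id_Pol (reverse H))"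
          using PGP_no_sink[OF rsc] ne sources by simp
        then show ?thesis by (simp add: id_Pol_reverse)
      qed
    qed
  qed
  moreover have "EGP (pverts H) (id_Pol H)"
    if *: "\<not> (at_most_one_cycle H \<or> ((\<exists>v. is_source H v) \<and> (\<exists>w. is_sink H w)))"
  proof (cases "\<exists>w. is_sink H w")
    case False
    then show ?thesis using EGP_no_sink[OF sc _ sinks] * amoc by blast
  next
    case True
    then have "\<nexists>w. is_source H w" using * by blast
    moreover have "\<not> semicomplete_rel.unicyclic (pverts (reverse H)) (parcs (reverse H))"
      using rev.unicyclic_converse * amoc by auto
    ultimately have "EGP (pverts (reverse H)) (id_Pol (reverse H))"
      using EGP_no_sink[OF rsc] sources by simp
    then show ?thesis by (simp add: id_Pol_reverse)
  qed
  ultimately show ?thesis by blast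
qed

end
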